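(* Let $n$ be a positive integer. The numbers of nonequivalent $n$-fold coverings over $\mathcal{G}_5$ (with connected total space), according to the isomorphism type of the fundamental group of the total space, are given by the following formulas: $$(i)\quad c_{\pi_1(\mathcal{G}_5),\pi_1(\mathcal{G}_5)}(n)=\sum_{k\mid n,\ (\frac{n}{k},6)=1}\theta(k),$$ $$(ii)\quad c_{\pi_1(\mathcal{G}_3),\pi_1(\mathcal{G}_5)}(n)=\sum_{k\mid\frac{n}{2}}\theta(k)-\sum_{k\mid\frac{n}{18}}\theta(k),$$ $$(iii)\quad c_{\pi_1(\mathcal{G}_2),\pi_1(\mathcal{G}_5)}(n)=\frac{1}{3}\Big(\sigma_2\!\left(\frac{n}{3}\right)+2\sigma_2\!\left(\frac{n}{6}\right)-3\sigma_2\!\left(\frac{n}{12}\right)+2\sum_{k\mid\frac{n}{3}}\theta(k)-2\sum_{k\mid\frac{n}{6}}\theta(k)\Big),$$ $$(iv)\quad c_{\mathbb{Z}^3,\pi_1(\mathcal{G}_5)}(n)=\frac{1}{6}\Big(\omega\!\left(\frac{n}{6}\right)+\sigma_2\!\left(\frac{n}{6}\right)+3\sigma_2\!\left(\frac{n}{12}\right)+4\sum_{k\mid\frac{n}{6}}\theta(k)+4\sum_{k\mid\frac{n}{18}}\theta(k)\Big).$$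
   Context: $\mathcal{G}_2,\mathcal{G}_3,\mathcal{G}_5$ are closed orientable flat (Euclidean) 3-manifolds with $H_1(\mathcal{G}_2)=\mathbb{Z}_2\oplus\mathbb{Z}_2\oplus\mathbb{Z}$, $H_1(\mathcal{G}_3)=\mathbb{Z}_3\oplus\mathbb{Z}$, $H_1(\mathcal{G}_5)=\mathbb{Z}$. Their fundamental groups are $$\pi_1(\mathcal{G}_2)=\langle x,y,z : xyx^{-1}y^{-1}=1,\ zxz^{-1}=x^{-1},\ zyz^{-1}=y^{-1}\rangle,$$ $$\pi_1(\mathcal{G}_3)=\langle x,y,z : xyx^{-1}y^{-1}=1,\ zxz^{-1}=y,\ zyz^{-1}=(xy)^{-1}\rangle,$$ $$\pi_1(\mathcal{G}_5)=\langle \tilde x,\tilde y,\tilde z : \tilde x\tilde y\tilde x^{-1}\tilde y^{-1}=1,\ \tilde z\tilde x\tilde z^{-1}=\tilde x\tilde y,\ \tilde z\tilde y\tilde z^{-1}=\tilde x^{-1}\rangle.$$ Two coverings $p_1:\mathcal{M}_1\to\mathcal{M}$ and $p_2:\mathcal{M}_2\to\mathcal{M}$ are equivalent if there is a homeomorphism $h:\mathcal{M}_1\to\mathcal{M}_2$ with $p_1=p_2\circ h$. Equivalence classes of connected $n$-fold coverings of $\mathcal{M}$ correspond bijectively to conjugacy classes of subgroups of index $n$ in $\pi_1(\mathcal{M})$. For groups $H,G$, $c_{H,G}(n)$ denotes the number of conjugacy classes (in $G$) of subgroups of index $n$ in $G$ that are isomorphic to $H$; thus $c_{H,\pi_1(\mathcal{M})}(n)$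 is the number of nonequivalent connected $n$-fold coverings of $\mathcal{M}$ whose total space has fundamental group isomorphic to $H$. $(a,b)$ denotes the greatest common divisor. Arithmetic functions, for a positive integer $n$: $\sigma_1(n)=\sum_{k\mid n}k$, $\sigma_2(n)=\sum_{k\mid n}\sigma_1(k)$, $\omega(n)=\sum_{k\mid n}k\,\sigma_1(k)$, and $\theta(n)=\sum_{k\mid n}\left(\frac{k}{3}\right)$, where $\left(\frac{k}{3}\right)$ is the Legendre symbol ($1,-1,0$ for $k\equiv 1,2,0 \bmod 3$). (Here $\sigma_2$ is not the sum of squares of divisors.) All sums are over positive divisors. Each of these functions is taken to be $0$ at arguments that are not positive integers, and a sum over $k\mid m$ is $0$ if $m$ is not a positive integer. *)

theory Defs
  imports "HOL-Algebra.Algebra" "HOL-Number_Theory.Number_Theory"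
begin

section \<open>Groups given by generators and relations\<close>

text \<open>A letter is a generator together with a sign; \<open>(a, False)\<close> is the formal inverse
  of \<open>(a, True)\<close>. All elements of the type \<open>'g\<close> are generators.\<close>

type_synonym 'g word = "('g \<times> bool) list"

definition word_inv :: "'g word \<Rightarrow> 'g word"
  where "word_inv w = rev (map (\<lambda>(a, s). (a, \<not> s)) w)"

text \<open>A pair \<open>(u, v) \<in> R\<close> stands for the defining relation \<open>u = v\<close>.\<close>

inductive word_eq :: "('g word \<times> 'g word) set \<Rightarrow> 'g word \<Rightarrow> 'g word \<Rightarrow> bool"
  for R :: "('g word \<times> 'g word) set"
  where
    rel: "(u, v) \<in> R \<Longrightarrow> word_eq R u v"
  | cancel: "word_eq R [(a, s), (a, \<not> s)] []"
  | refl: "word_eq R u u"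
  | sym: "word_eq R u v \<Longrightarrow> word_eq R v u"
  | trans: "word_eq R u v \<Longrightarrow> word_eq R v w \<Longrightarrow> word_eq R u w"
  | append: "word_eq R u v \<Longrightarrow> word_eq R u' v' \<Longrightarrow> word_eq R (u @ u') (v @ v')"

definition presented_group :: "('g word \<times> 'g word) set \<Rightarrow> 'g word set monoid"
  where "presented_group R =
    \<lparr>carrier = UNIV // {(u, v). word_eq R u v},
     monoid.mult = (\<lambda>A B. {w. \<exists>u\<in>A. \<exists>v\<in>B. word_eq R (u @ v) w}),
     one = {w. word_eq R [] w}\<rparr>"

lemma word_inv_Cons: "word_inv ((a, s) # w) = word_inv w @ [(a, \<not> s)]"
  by (simp add: word_inv_def)

lemma word_eq_inv_left: "word_eq R (word_inv w @ w) []"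
proof (induction w)
  case Nil
  show ?case by (simp add: word_inv_def word_eq.refl)
next
  case (Cons p w)
  obtain a s where p: "p = (a, s)" by force
  have "word_eq R ([(a, \<not> s), (a, s)] @ w) ([] @ w)"
    using word_eq.append[OF word_eq.cancel[of R a "\<not> s"] word_eq.refl[of R w]] by simp
  then have "word_eq R (word_inv w @ ([(a, \<not> s), (a, s)] @ w)) (word_inv w @ ([] @ w))"
    by (rule word_eq.append[OF word_eq.refl])
  then have "word_eq R (word_inv (p # w) @ (p # w)) (word_inv w @ w)"
    by (simp add: p word_inv_Cons)
  then show ?case using Cons.IH by (rule word_eq.trans)
qed

lemma presented_group_carrier:
  "A \<in> carrier (presented_group R) \<longleftrightarrow> (\<exists>u. A = Collect (word_eq R u))"
  by (auto simp: presented_group_def quotient_def)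

lemma word_class_eq_iff: "Collect (word_eq R u) = Collect (word_eq R v) \<longleftrightarrow> word_eq R u v"
  by (auto intro: word_eq.refl word_eq.sym word_eq.trans)

lemma presented_group_mult:
  "Collect (word_eq R u) \<otimes>\<^bsub>presented_group R\<^esub> Collect (word_eq R v) = Collect (word_eq R (u @ v))"
  by (auto simp: presented_group_def intro: word_eq.refl word_eq.trans word_eq.append)

lemma presented_group_one: "\<one>\<^bsub>presented_group R\<^esub> = Collect (word_eq R [])"
  by (simp add: presented_group_def)

lemma group_presented_group: "group (presented_group R)"
proof (rule groupI)
  fix A assume "A \<in> carrier (presented_group R)"
  then obtain u where A: "A = Collect (word_eq R u)" by (auto simp: presented_group_carrier)
  show "\<one>\<^bsub>presented_group R\<^esub> \<otimes>\<^bsub>presented_group R\<^esub> A = A"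
    by (simp add: A presented_group_one presented_group_mult)
  have "Collect (word_eq R (word_inv u)) \<otimes>\<^bsub>presented_group R\<^esub> A = \<one>\<^bsub>presented_group R\<^esub>"
    by (simp add: A presented_group_one presented_group_mult word_class_eq_iff word_eq_inv_left)
  then show "\<exists>B\<in>carrier (presented_group R).
      B \<otimes>\<^bsub>presented_group R\<^esub> A = \<one>\<^bsub>presented_group R\<^esub>"
    using presented_group_carrier by blast
qed (auto simp: presented_group_carrier presented_group_mult presented_group_one)


section \<open>The fundamental groups\<close>

datatype gen = Gen_x | Gen_y | Gen_z

abbreviation x\<^sub>w :: "gen word" where "x\<^sub>w \<equiv> [(Gen_x, True)]"
abbreviation y\<^sub>w :: "gen word" where "y\<^sub>w \<equiv> [(Gen_y, True)]"
abbreviation z\<^sub>w :: "gen word" where "z\<^sub>w \<equiv> [(Gen_z, True)]"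

definition pi1_G2 :: "gen word set monoid"
  where "pi1_G2 = presented_group
    {(x\<^sub>w @ y\<^sub>w @ word_inv x\<^sub>w @ word_inv y\<^sub>w, []),
     (z\<^sub>w @ x\<^sub>w @ word_inv z\<^sub>w, word_inv x\<^sub>w),
     (z\<^sub>w @ y\<^sub>w @ word_inv z\<^sub>w, word_inv y\<^sub>w)}"

definition pi1_G3 :: "gen word set monoid"
  where "pi1_G3 = presented_group
    {(x\<^sub>w @ y\<^sub>w @ word_inv x\<^sub>w @ word_inv y\<^sub>w, []),
     (z\<^sub>w @ x\<^sub>w @ word_inv z\<^sub>w, y\<^sub>w),
     (z\<^sub>w @ y\<^sub>w @ word_inv z\<^sub>w, word_inv (x\<^sub>w @ y\<^sub>w))}"

definition pi1_G5 :: "gen word set monoid"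
  where "pi1_G5 = presented_group
    {(x\<^sub>w @ y\<^sub>w @ word_inv x\<^sub>w @ word_inv y\<^sub>w, []),
     (z\<^sub>w @ x\<^sub>w @ word_inv z\<^sub>w, x\<^sub>w @ y\<^sub>w),
     (z\<^sub>w @ y\<^sub>w @ word_inv z\<^sub>w, word_inv x\<^sub>w)}"

definition Z3_group :: "(int \<times> int \<times> int) monoid"
  where "Z3_group = integer_group \<times>\<times> integer_group \<times>\<times> integer_group"


section \<open>Counting subgroups up to conjugacy\<close>

text \<open>The number \<open>c\<^bsub>H,G\<^esub>(n)\<close>. It is meant for \<open>n > 0\<close>: the cardinality of an infinite set is
  \<open>0\<close>, so for \<open>n = 0\<close> subgroups of infinite index would be selected.\<close>

definition conj_classes_count :: "('b, 'c) monoid_scheme \<Rightarrow> ('a, 'd) monoid_scheme \<Rightarrow> nat \<Rightarrow> nat"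
  where "conj_classes_count H G n =
    card (orbits G {S. subgroup S G \<and> card (rcosets\<^bsub>G\<^esub> S) = n \<and> G\<lparr>carrier := S\<rparr> \<cong> H}
      (\<lambda>g S. g <#\<^bsub>G\<^esub> S #>\<^bsub>G\<^esub> inv\<^bsub>G\<^esub> g))"


section \<open>Arithmetic functions\<close>

text \<open>The argument is rational and the set of divisors is empty unless the argument is a positive
  integer, so all divisor sums vanish at arguments such as \<open>n/6\<close> when \<open>6\<close> does not
  divide \<open>n\<close>.\<close>

definition divisors_of :: "rat \<Rightarrow> nat set"
  where "divisors_of q = {k. \<exists>m::nat. m > 0 \<and> q = of_nat m \<and> k dvd m}"

definition sigma1 :: "rat \<Rightarrow> rat"
  where "sigma1 q = (\<Sum>k\<in>divisors_of q. of_nat k)"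

text \<open>Not the sum of the squares of the divisors.\<close>

definition sigma2 :: "rat \<Rightarrow> rat"
  where "sigma2 q = (\<Sum>k\<in>divisors_of q. sigma1 (of_nat k))"

definition omega :: "rat \<Rightarrow> rat"
  where "omega q = (\<Sum>k\<in>divisors_of q. of_nat k * sigma1 (of_nat k))"

definition theta :: "rat \<Rightarrow> rat"
  where "theta q = (\<Sum>k\<in>divisors_of q. of_int (Legendre (int k) 3))"

end

theory Submission
  imports Defs "HOL-Library.Product_Plus" "HOL-Computational_Algebra.Nth_Powers"
begin

text \<open>The three nonabelian groups and \<open>\<int>\<^sup>3\<close> are semidirect products of the Eisenstein lattice
  \<open>E = \<int>[\<omega>]\<close> with \<open>\<int>\<close>, the generator of \<open>\<int>\<close> acting by a power of the sixth root of unity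
  \<open>\<zeta> = - \<omega>\<^sup>2\<close>. A subgroup of index \<open>n\<close> of \<open>\<pi>\<^sub>1(G\<^sub>5)\<close> amounts to a divisor \<open>l\<close> of \<open>n\<close>, a
  sublattice \<open>L\<close> of \<open>E\<close> of index \<open>n / l\<close> with \<open>\<zeta>\<^sup>l L = L\<close>, and a coset of \<open>L\<close>; its isomorphism type
  is decided by \<open>\<plusminus> l\<close> modulo \<open>6\<close> because \<open>E\<close> is a principal ideal domain.

  Conjugation by \<open>E\<close> merges the cosets of \<open>L\<close> to cosets of \<open>L + (1 - \<zeta>\<^sup>l) E\<close>, on which a group of order
  \<open>6\<close> is left acting, and Burnside's lemma applies. Since an endomorphism of a finite abelian group has as
  many kernel elements as cokernel elements, the fixed points of \<open>\<zeta>\<^sup>k\<close> are counted by the sum of the indices of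
  \<open>L + (1 - \<zeta>\<^sup>g) E\<close> over the \<open>\<zeta>\<^sup>g\<close>-invariant lattices \<open>L\<close>, where \<open>g = gcd(k, l, 6)\<close>. For the four
  possible \<open>g\<close> these sums follow from the number \<open>\<sigma>\<^sub>1(m)\<close> of all sublattices and the number \<open>\<theta>(m)\<close>
  of all ideals of index \<open>m\<close>. An ideal is an integer multiple of one with cyclic quotient, so that the latter
  number comes from counting the roots of \<open>X\<^sup>2 - X + 1\<close> modulo divisors of \<open>m\<close>.\<close>

section \<open>Lattices and their cosets\<close>

text \<open>The shape of the formulas comes from the size of \<open>1 - \<zeta>\<^sup>g\<close>: it
  is a unit for \<open>g = 1\<close>, has norm 3 for \<open>g = 2\<close>, equals 2 for
  \<open>g = 3\<close> and 0 for \<open>g = 6\<close>. So \<open>L + (1 - \<zeta>\<^sup>g) E\<close>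
  has index 1 in the first case, 1 or 3 in the second, 1, 2 or 4 in the third, and is
  \<open>L\<close> itself in the last. Lattices inside the prime above 3, or inside the kernel of a
  character modulo 2, are counted by the same functions at an argument divided by 3 or 2; together
  with levels divisible by 2, 3 or 6 this produces the denominators 2, 3, 6, 12 and 18.

  An isomorphism from a model group to a subgroup must carry \<open>E\<close> to the base lattice
  compatibly with the action. For levels prime to 3 it has to commute with \<zeta>, and this is
  where principal ideals are needed; for levels divisible by 3 the action is by signs and any
  lattice basis will do. Conversely, the types are told apart by the exponents \<open>k\<close> for
  which all \<open>k\<close>-th powers commute with each other.\<close>

definition sublat :: "'a::ab_group_add set \<Rightarrow> bool"
  where "sublat L \<longleftrightarrow> 0 \<in> L \<and> (\<forall>u\<in>L. \<forall>v\<in>L. u - v \<in> L)"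

definition cosets :: "'a::ab_group_add set \<Rightarrow> 'a set set"
  where "cosets L = range (\<lambda>v. (+) v ` L)"

text \<open>The value is \<open>0\<close> for a lattice of infinite index.\<close>

definition lat_index :: "'a::ab_group_add set \<Rightarrow> nat"
  where "lat_index L = card (cosets L)"

text \<open>For additive \<open>f\<close> this is the lattice \<open>L + range f\<close>. If
  \<open>f\<close> maps \<open>L\<close> into itself, the quotient by it is the cokernel of the
  endomorphism that \<open>f\<close> induces modulo \<open>L\<close>.\<close>

definition lat_ext :: "('a \<Rightarrow> 'a) \<Rightarrow> 'a::ab_group_add set \<Rightarrow> 'a set"
  where "lat_ext f L = {u. \<exists>w. u - f w \<in> L}"

lemma sublat_zero: "sublat L \<Longrightarrow> 0 \<in> L"
  and sublat_diff: "sublat L \<Longrightarrow> u \<in> L \<Longrightarrow> v \<in> L \<Longrightarrow> u - v \<in> L"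
  by (auto simp: sublat_def)

lemma sublat_uminus: "sublat L \<Longrightarrow> u \<in> L \<Longrightarrow> - u \<in> L"
  using sublat_diff[of L 0 u] by (simp add: sublat_zero)

lemma sublat_add: "sublat L \<Longrightarrow> u \<in> L \<Longrightarrow> v \<in> L \<Longrightarrow> u + v \<in> L"
  using sublat_diff[of L u "- v"] by (simp add: sublat_uminus)

lemma sublat_uminus_iff: "sublat L \<Longrightarrow> - u \<in> L \<longleftrightarrow> u \<in> L"
  using sublat_uminus[of L u] sublat_uminus[of L "- u"] by auto

lemma sublat_minus_commute: "sublat L \<Longrightarrow> u - v \<in> L \<longleftrightarrow> v - u \<in> L"
  using sublat_uminus_iff[of L "u - v"] by simp

lemma sublat_add_cancel: "sublat L \<Longrightarrow> v \<in> L \<Longrightarrow> u + v \<in> L \<longleftrightarrow> u \<in> L"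
  using sublat_diff[of L "u + v" v] sublat_add[of L u v] by auto

lemma mem_coset_iff: "w \<in> (+) v ` L \<longleftrightarrow> w - v \<in> (L :: 'a::ab_group_add set)"
  by (auto simp: image_iff algebra_simps intro!: bexI[of _ "w - v"])

lemma coset_eq_iff:
  assumes "sublat L"
  shows "(+) u ` L = (+) v ` L \<longleftrightarrow> u - v \<in> L"
proof
  assume "(+) u ` L = (+) v ` L"
  moreover have "u \<in> (+) u ` L" using sublat_zero[OF assms] by (simp add: mem_coset_iff)
  ultimately show "u - v \<in> L" by (simp add: mem_coset_iff)
next
  assume uv: "u - v \<in> L"
  have "w - u \<in> L \<longleftrightarrow> w - v \<in> L" for w
    using sublat_add_cancel[OF assms uv, of "w - u"] by simp
  then show "(+) u ` L = (+) v ` L" by (auto simp: mem_coset_iff set_eq_iff)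
qed

text \<open>Both images are the quotient of \<open>A\<close> by one and the same equivalence
  relation. Index formulas below are obtained by replacing cosets with a more explicit complete
  invariant.\<close>

lemma card_image_cong:
  assumes "\<And>x y. x \<in> A \<Longrightarrow> y \<in> A \<Longrightarrow> f x = f y \<longleftrightarrow> g x = g y"
  shows "card (f ` A) = card (g ` A)"
proof (rule bij_betw_same_card[of "\<lambda>c. g (SOME x. x \<in> A \<and> f x = c)"])
  have s: "(SOME x. x \<in> A \<and> f x = f a) \<in> A \<and> f (SOME x. x \<in> A \<and> f x = f a) = f a"
    if "a \<in> A" for a using someI[of "\<lambda>x. x \<in> A \<and> f x = f a" a] that by blast
  then have "g (SOME x. x \<in> A \<and> f x = f a) = g a" if "a \<in> A" for a
    using assms that by blast
  then show "bij_betw (\<lambda>c. g (SOME x. x \<in> A \<and> f x = c)) (f ` A) (g ` A)"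
    using assms by (auto simp: bij_betw_def inj_on_def image_iff)
qed

text \<open>With a representative \<open>s u\<close> chosen in each coset of \<open>M\<close>, the
  class of \<open>u\<close> modulo \<open>L\<close> is the same as its class modulo \<open>M\<close>
  together with the class of \<open>u - s u\<close> modulo \<open>L\<close>. The convention that
  infinite sets have cardinality 0 is compatible with the product.\<close>

lemma lat_index_tower:
  assumes L: "sublat L" and M: "sublat M" and LM: "L \<subseteq> M"
  shows "lat_index L = lat_index M * card ((\<lambda>v. (+) v ` L) ` M)"
proof -
  define s where "s u = (SOME w. w - u \<in> M)" for u
  have s1: "s u - u \<in> M" for u
    unfolding s_def by (rule someI[of _ u]) (simp add: sublat_zero[OF M])
  have s2: "s u = s v" if "u - v \<in> M" for u v
  proof -
    have "w - u \<in> M \<longleftrightarrow> w - v \<in> M" for w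
      using sublat_add_cancel[OF M that, of "w - u"] by simp
    then show ?thesis by (simp add: s_def)
  qed
  have "card (range (\<lambda>u. (+) u ` L)) = card (range (\<lambda>u. ((+) u ` M, (+) (u - s u) ` L)))"
  proof (rule card_image_cong)
    fix u v
    show "(+) u ` L = (+) v ` L \<longleftrightarrow>
      ((+) u ` M, (+) (u - s u) ` L) = ((+) v ` M, (+) (v - s v) ` L)"
      using LM s2[of u v] by (auto simp: coset_eq_iff L M)
  qed
  also have "range (\<lambda>u. ((+) u ` M, (+) (u - s u) ` L)) = cosets M \<times> (\<lambda>v. (+) v ` L) ` M"
  proof (intro equalityI subsetI)
    fix p assume "p \<in> cosets M \<times> (\<lambda>v. (+) v ` L) ` M"
    then obtain u v where p: "p = ((+) u ` M, (+) v ` L)" "v \<in> M" by (auto simp: cosets_def)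
    \<comment> \<open>The vector with representative \<open>s u\<close> and remainder
      \<open>v\<close> realizes the prescribed pair.\<close>
    let ?w = "s u + v"
    have "?w - u \<in> M" using s1[of u] p(2) sublat_add[OF M, of "s u - u" v] by (simp add: algebra_simps)
    then have "s ?w = s u" and "(+) ?w ` M = (+) u ` M" by (auto simp: coset_eq_iff M intro: s2)
    then have "p = ((+) ?w ` M, (+) (?w - s ?w) ` L)" by (simp add: p)
    then show "p \<in> range (\<lambda>u. ((+) u ` M, (+) (u - s u) ` L))" by (rule image_eqI) simp
  qed (use s1 sublat_minus_commute[OF M] in \<open>auto simp: cosets_def\<close>)
  finally show ?thesis by (simp add: lat_index_def cosets_def card_cartesian_product)
qed

lemma sublat_UNIV: "sublat UNIV"
  by (simp add: sublat_def)

lemma lat_index_UNIV: "lat_index (UNIV :: 'a::ab_group_add set) = 1"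
proof -
  have "cosets (UNIV :: 'a set) = {UNIV}" by (auto simp: cosets_def mem_coset_iff)
  then show ?thesis by (simp add: lat_index_def)
qed

lemma sublat_lat_ext:
  assumes L: "sublat L" and hom: "additive f"
  shows "sublat (lat_ext f L)"
proof -
  interpret additive f by fact
  have "\<exists>w. u - v - f w \<in> L" if "u - f a \<in> L" "v - f b \<in> L" for u v a b
    using sublat_diff[OF L that] by (intro exI[of _ "a - b"]) (simp add: diff algebra_simps)
  moreover have "\<exists>w. - f w \<in> L" using sublat_zero[OF L] zero by (metis minus_zero)
  ultimately show ?thesis by (auto simp: sublat_def lat_ext_def)
qed

lemma subset_lat_ext: "additive f \<Longrightarrow> L \<subseteq> lat_ext f L"
  using additive.zero[of f] by (auto simp: lat_ext_def intro!: exI[of _ 0])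

text \<open>On the finite group \<open>E/L\<close>, the kernel is \<open>K/L\<close> and the image
  is \<open>M/L\<close> with \<open>M = L + f(E)\<close>. The image is also \<open>E/K\<close>, so
  comparing the towers \<open>L\<close>, \<open>K\<close>, \<open>E\<close> and \<open>L\<close>,
  \<open>M\<close>, \<open>E\<close> leaves equal sizes for kernel and cokernel.\<close>

lemma card_kernel_cosets:
  assumes L: "sublat L" and hom: "additive f" and fL: "f ` L \<subseteq> L" and fin: "lat_index L > 0"
  shows "card ((\<lambda>v. (+) v ` L) ` {v. f v \<in> L}) = lat_index (lat_ext f L)"
proof -
  interpret additive f by fact
  let ?K = "{v. f v \<in> L}" and ?M = "lat_ext f L"
  have K: "sublat ?K" using L by (auto simp: sublat_def zero diff)
  have M: "sublat ?M" by (rule sublat_lat_ext[OF L hom])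
  have tK: "lat_index L = lat_index ?K * card ((\<lambda>v. (+) v ` L) ` ?K)"
    using fL by (intro lat_index_tower L K) auto
  have tM: "lat_index L = lat_index ?M * card ((\<lambda>v. (+) v ` L) ` ?M)"
    by (intro lat_index_tower L M subset_lat_ext hom)
  \<comment> \<open>The classes of \<open>?M\<close> modulo \<open>L\<close> are those of the values
    of \<open>f\<close>, and two values agree modulo \<open>L\<close> exactly when the arguments
    agree modulo \<open>?K\<close>.\<close>
  have "(\<lambda>v. (+) v ` L) ` ?M = range (\<lambda>v. (+) (f v) ` L)"
  proof -
    have "\<exists>w. (+) u ` L = (+) (f w) ` L" if "u \<in> ?M" for u
      using that by (auto simp: lat_ext_def coset_eq_iff L)
    moreover have "f w \<in> ?M" for w using sublat_zero[OF L] by (auto simp: lat_ext_def intro!: exI[of _ w])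
    ultimately show ?thesis by (auto simp: image_iff)
  qed
  also have "card \<dots> = lat_index ?K"
    unfolding lat_index_def cosets_def
    by (rule card_image_cong) (simp add: coset_eq_iff L K diff)
  finally show ?thesis using tK tM fin by (metis mult.commute mult_left_cancel mult_is_0 neq0_conv)
qed

lemma sublat_image:
  assumes "additive f" "sublat L"
  shows "sublat (f ` L)"
proof -
  interpret additive f by fact
  show ?thesis
    using assms(2) unfolding sublat_def by (auto simp: image_iff zero[symmetric] diff[symmetric])
qed

lemma sublat_vimage:
  assumes "additive f" "sublat L"
  shows "sublat (f -` L)"
proof -
  interpret additive f by fact
  show ?thesis using assms(2) by (auto simp: sublat_def zero diff)
qed

lemma lat_index_image:
  assumes hom: "additive f" and inj: "inj f" and L: "sublat L"
  shows "lat_index (f ` L) = lat_index (range f) * lat_index L"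
proof -
  interpret additive f by fact
  have fL: "sublat (f ` L)" and fU: "sublat (range f)"
    using sublat_image[OF hom] L sublat_UNIV by auto
  have "(\<lambda>v. (+) v ` f ` L) ` range f = range (\<lambda>v. (+) (f v) ` f ` L)" by auto
  also have "card \<dots> = lat_index L"
    unfolding lat_index_def cosets_def
    by (rule card_image_cong) (simp add: coset_eq_iff L fL diff[symmetric] inj_image_mem_iff[OF inj])
  finally show ?thesis using lat_index_tower[OF fL fU] by auto
qed

lemma lat_index_image_bij:
  assumes "additive f" "bij f" "sublat L"
  shows "lat_index (f ` L) = lat_index L"
  using lat_index_image[of f L] assms by (simp add: bij_def lat_index_UNIV)

text \<open>Reduces counting the lattices inside a fixed sublattice \<open>range f\<close> to
  counting all lattices, at an index divided by that of \<open>range f\<close>.\<close>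

lemma bij_betw_image_lattices:
  assumes hom: "additive f" and inj: "inj f" and pos: "lat_index (range f) > 0"
  shows "bij_betw ((`) f) {L. sublat L \<and> lat_index L = m}
    {L. sublat L \<and> L \<subseteq> range f \<and> lat_index L = lat_index (range f) * m}"
proof (rule bij_betwI[of _ _ _ "(-`) f"])
  show "(-`) f \<in> {L. sublat L \<and> L \<subseteq> range f \<and> lat_index L = lat_index (range f) * m}
    \<rightarrow> {L. sublat L \<and> lat_index L = m}"
  proof (intro funcsetI)
    fix L assume a: "L \<in> {L. sublat L \<and> L \<subseteq> range f \<and> lat_index L = lat_index (range f) * m}"
    then have "f ` (f -` L) = L" by (auto simp: image_vimage_eq)
    moreover have s: "sublat (f -` L)" using a by (auto intro: sublat_vimage hom)
    ultimately have "lat_index L = lat_index (range f) * lat_index (f -` L)"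
      using lat_index_image[OF hom inj s] by simp
    then show "f -` L \<in> {L. sublat L \<and> lat_index L = m}" using a s pos by simp
  qed
qed (auto simp: lat_index_image hom inj sublat_image inj_vimage_image_eq)

section \<open>Semidirect products with the integers\<close>

lemma sublat_int_mult: "sublat A \<Longrightarrow> x \<in> A \<Longrightarrow> q * x \<in> A" for x q :: int
  by (induction q rule: int_induct[of _ 0])
    (auto simp: sublat_zero distrib_right left_diff_distrib sublat_add sublat_diff)

text \<open>Division with remainder by the least positive element. Writing the generator as
  \<open>Gcd A\<close> covers the zero subgroup as well.\<close>

lemma sublat_int_eq_multiples:
  assumes A: "sublat (A :: int set)"
  shows "A = {x. Gcd A dvd x}"
proof (cases "\<exists>a\<in>A. a \<noteq> 0")
  case False
  then have "A = {0}" using sublat_zero[OF A] by auto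
  then show ?thesis by simp
next
  case True
  then obtain a where "a \<in> A" "a \<noteq> 0" by blast
  then have "\<bar>a\<bar> \<in> A \<and> \<bar>a\<bar> > 0" using sublat_uminus[OF A] by (simp add: abs_if)
  then have ex: "\<exists>k::nat. int k \<in> A \<and> k > 0" by (intro exI[of _ "nat \<bar>a\<bar>"]) simp
  define l where "l = (LEAST k::nat. int k \<in> A \<and> k > 0)"
  have l: "int l \<in> A" "l > 0" using LeastI_ex[OF ex] by (auto simp: l_def)
  have least: "l \<le> k" if "int k \<in> A" "k > 0" for k
    unfolding l_def using that by (intro Least_le) simp
  have sub: "int l dvd x" if "x \<in> A" for x
  proof (rule ccontr)
    assume "\<not> int l dvd x"
    then have "x mod int l \<noteq> 0" by (simp add: dvd_eq_mod_eq_0)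
    moreover have "x mod int l \<ge> 0" using l(2) by simp
    ultimately have pos: "x mod int l > 0" by linarith
    have "x mod int l = x - x div int l * int l" by (simp add: minus_div_mult_eq_mod)
    then have "x mod int l \<in> A" using sublat_diff[OF A that sublat_int_mult[OF A l(1)]] by simp
    then have "l \<le> nat (x mod int l)" using pos by (intro least) auto
    then show False using pos l(2) pos_mod_bound[of "int l" x] by linarith
  qed
  have "Gcd A = int l"
  proof (rule Gcd_eqI)
    show "c dvd int l" if "\<And>b. b \<in> A \<Longrightarrow> c dvd b" for c using that l(1) by blast
  qed (use sub l in auto)
  moreover have "x \<in> A" if "int l dvd x" for x
    using that sublat_int_mult[OF A l(1)] by (metis dvd_def mult.commute)
  ultimately show ?thesis using sub by auto
qed

lemma (in group) rcos_eq_iff: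
  assumes "subgroup S G" "a \<in> carrier G" "b \<in> carrier G"
  shows "S #> a = S #> b \<longleftrightarrow> a \<otimes> inv b \<in> S"
proof -
  have "S #> a = S #> b \<longleftrightarrow> a \<in> S #> b"
    using assms by (metis rcos_self repr_independence)
  then show ?thesis using subgroup.rcos_module[OF assms(1) is_group assms(3,2)] by simp
qed

locale int_action =
  fixes r :: "int \<Rightarrow> 'a::ab_group_add \<Rightarrow> 'a"
  assumes act_0 [simp]: "r 0 v = v"
    and act_add: "r (i + j) v = r i (r j v)"
    and act_plus: "r i (u + v) = r i u + r i v"

definition sdp :: "(int \<Rightarrow> 'a::ab_group_add \<Rightarrow> 'a) \<Rightarrow> ('a \<times> int) monoid"
  where "sdp r = \<lparr>carrier = UNIV, monoid.mult = (\<lambda>(u, i) (v, j). (u + r i v, i + j)), one = (0, 0)\<rparr>"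

definition base :: "('a::ab_group_add \<times> int) set \<Rightarrow> 'a set"
  where "base S = {w. (w, 0) \<in> S}"

text \<open>The nonnegative generator of the projection to the integers; it is 0 exactly when a
  subgroup projects trivially, and then its index is infinite.\<close>

definition lev :: "('a::ab_group_add \<times> int) set \<Rightarrow> nat"
  where "lev S = nat (Gcd (snd ` S))"

text \<open>The elements lying over the generator of the projection. They form one coset of
  \<open>base S\<close>, the third datum that pins down a subgroup.\<close>

definition fibre :: "('a::ab_group_add \<times> int) set \<Rightarrow> 'a set"
  where "fibre S = {v. (v, int (lev S)) \<in> S}"

lemma carrier_sdp [simp]: "carrier (sdp r) = UNIV"
  and mult_sdp [simp]: "(u, i) \<otimes>\<^bsub>sdp r\<^esub> (v, j) = (u + r i v, i + j)"
  and one_sdp [simp]: "\<one>\<^bsub>sdp r\<^esub> = (0, 0)"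
  by (simp_all add: sdp_def)

context int_action
begin

lemma act_additive: "additive (r i)"
  by unfold_locales (rule act_plus)

lemma act_zero [simp]: "r i 0 = 0"
  by (rule additive.zero[OF act_additive])

lemma act_minus: "r i (- v) = - r i v"
  by (rule additive.minus[OF act_additive])

lemma act_diff: "r i (u - v) = r i u - r i v"
  by (rule additive.diff[OF act_additive])

lemma act_inverse [simp]: "r (- i) (r i v) = v" "r i (r (- i) v) = v"
  using act_add[of "- i" i v] act_add[of i "- i" v] by auto

lemma bij_act: "bij (r i)"
  by (rule bij_betw_byWitness[of _ "r (- i)"]) auto

sublocale sdp: group "sdp r"
proof (rule groupI)
  fix x assume "x \<in> carrier (sdp r)"
  show "\<exists>y\<in>carrier (sdp r). y \<otimes>\<^bsub>sdp r\<^esub> x = \<one>\<^bsub>sdp r\<^esub>"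
    by (cases x, rule bexI[of _ "(- r (- snd x) (fst x), - snd x)"]) auto
qed (auto simp: act_add act_plus algebra_simps)

lemma inv_sdp [simp]: "inv\<^bsub>sdp r\<^esub> (u, i) = (- r (- i) u, - i)"
  by (rule sdp.inv_equality) auto

lemma snd_int_pow: "snd ((v, l) [^]\<^bsub>sdp r\<^esub> (q :: int)) = l * q"
proof -
  have nat: "snd ((v, l) [^]\<^bsub>sdp r\<^esub> (k :: nat)) = l * int k" for k
  proof (induction k)
    case (Suc k)
    obtain a b where "(v, l) [^]\<^bsub>sdp r\<^esub> k = (a, b)" by force
    then show ?case using Suc by (simp add: algebra_simps)
  qed simp
  show ?thesis
  proof (cases q rule: int_cases2)
    case (nonneg k)
    then show ?thesis using nat[of k] by (simp only: int_pow_int)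
  next
    case (nonpos k)
    obtain a b where ab: "(v, l) [^]\<^bsub>sdp r\<^esub> k = (a, b)" by force
    have "(v, l) [^]\<^bsub>sdp r\<^esub> q = inv\<^bsub>sdp r\<^esub> (a, b)"
      unfolding nonpos ab[symmetric] by (rule sdp.int_pow_neg_int) simp
    then show ?thesis using nat[of k] by (simp add: ab nonpos)
  qed
qed

text \<open>The translation part of a power. For \<open>q \<ge> 0\<close> it is the crossed sum
  \<open>v + r l v + ... + r (l * (q - 1)) v\<close>.\<close>

definition pw :: "'a \<Rightarrow> int \<Rightarrow> int \<Rightarrow> 'a"
  where "pw v l q = fst ((v, l) [^]\<^bsub>sdp r\<^esub> q)"

lemma int_pow_eq: "(v, l) [^]\<^bsub>sdp r\<^esub> (q :: int) = (pw v l q, l * q)"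
  using snd_int_pow[of v l q] by (simp add: pw_def prod_eq_iff)

lemma pw_add: "pw v l (p + q) = pw v l p + r (l * p) (pw v l q)"
  using sdp.int_pow_mult[of "(v, l)" p q] by (simp add: int_pow_eq)

lemma pw_0 [simp]: "pw v l 0 = 0" and pw_1 [simp]: "pw v l 1 = v"
  by (simp_all add: pw_def)

lemma pw_minus: "pw v l (- q) = - r (- (l * q)) (pw v l q)"
  using sdp.int_pow_neg[of "(v, l)" q] by (simp add: int_pow_eq)

text \<open>The one-step subgroup test: the pair on the right is the product of
  \<open>(u, i)\<close> with the inverse of \<open>(v, j)\<close>.\<close>

lemma subgroup_sdp_iff:
  "subgroup S (sdp r) \<longleftrightarrow> (0, 0) \<in> S \<and> (\<forall>u i v j. (u, i) \<in> S \<longrightarrow> (v, j) \<in> S \<longrightarrow> (u - r (i - j) v, i - j) \<in> S)"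
  (is "_ \<longleftrightarrow> ?R")
proof
  assume S: "subgroup S (sdp r)"
  have "(u - r (i - j) v, i - j) \<in> S" if "(u, i) \<in> S" "(v, j) \<in> S" for u i v j
    using subgroup.m_closed[OF S that(1) subgroup.m_inv_closed[OF S that(2)]]
    by (simp add: act_minus act_add[symmetric])
  then show ?R using subgroup.one_closed[OF S] by auto
next
  assume R: ?R
  have inv: "(- r (- j) v, - j) \<in> S" if "(v, j) \<in> S" for v j
  proof -
    have "(0 - r (0 - j) v, 0 - j) \<in> S" using R that by blast
    then show ?thesis by simp
  qed
  have mult: "(u + r i v, i + j) \<in> S" if "(u, i) \<in> S" "(v, j) \<in> S" for u i v j
  proof -
    have "(u - r (i - - j) (- r (- j) v), i - - j) \<in> S" using R that(1) inv[OF that(2)] by blast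
    then show ?thesis by (simp add: act_minus act_add)
  qed
  show "subgroup S (sdp r)"
    using R inv mult by (intro sdp.subgroupI) auto
qed

lemma subgroup_sdp_diff:
  "subgroup S (sdp r) \<Longrightarrow> (u, i) \<in> S \<Longrightarrow> (v, j) \<in> S \<Longrightarrow> (u - r (i - j) v, i - j) \<in> S"
  by (simp add: subgroup_sdp_iff)

lemma sublat_snd:
  assumes "subgroup S (sdp r)"
  shows "sublat (snd ` S)"
proof -
  have "i - j \<in> snd ` S" if "(u, i) \<in> S" "(v, j) \<in> S" for u i v j
    using subgroup_sdp_diff[OF assms that] by (rule rev_image_eqI) simp
  moreover have "0 \<in> snd ` S"
    using subgroup.one_closed[OF assms] by (rule rev_image_eqI) simp
  ultimately show ?thesis by (auto simp: sublat_def)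
qed

lemma snd_subgroup: "subgroup S (sdp r) \<Longrightarrow> snd ` S = {x. int (lev S) dvd x}"
  using sublat_int_eq_multiples[OF sublat_snd, of S] by (simp add: lev_def)

lemma lev_eqI:
  assumes "snd ` S = {x. int l dvd x}"
  shows "lev S = l"
proof -
  have "Gcd {x. int l dvd x} = int l" by (rule Gcd_eqI) auto
  then show ?thesis by (simp add: lev_def assms)
qed

text \<open>Multiplication on the left by \<open>(u - v, 0)\<close> stays at height
  \<open>j\<close>, so each nonempty slice of a subgroup is a coset of its base.\<close>

lemma slice:
  assumes "subgroup S (sdp r)" "(v, j) \<in> S"
  shows "(u, j) \<in> S \<longleftrightarrow> u - v \<in> base S"
proof
  show "u - v \<in> base S" if "(u, j) \<in> S"
    using subgroup_sdp_diff[OF assms(1) that assms(2)] by (simp add: base_def)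
  show "(u, j) \<in> S" if "u - v \<in> base S"
    using subgroup.m_closed[OF assms(1) _ assms(2), of "(u - v, 0)"] that by (simp add: base_def)
qed

lemma sublat_base:
  assumes "subgroup S (sdp r)"
  shows "sublat (base S)"
  using subgroup_sdp_diff[OF assms, of _ 0 _ 0] subgroup.one_closed[OF assms]
  by (simp add: sublat_def base_def)

lemma fibre_nonempty:
  assumes "subgroup S (sdp r)"
  shows "\<exists>v. v \<in> fibre S"
proof -
  have "int (lev S) \<in> snd ` S" by (simp add: snd_subgroup[OF assms])
  then show ?thesis by (auto simp: fibre_def)
qed

lemma fibre_eq_coset:
  assumes "subgroup S (sdp r)" "v \<in> fibre S"
  shows "fibre S = (+) v ` base S"
  using slice[OF assms(1), of v "int (lev S)"] assms(2)
  by (auto simp: fibre_def mem_coset_iff set_eq_iff)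

lemma pw_closed:
  assumes "subgroup S (sdp r)" "(v, l) \<in> S"
  shows "(pw v l q, l * q) \<in> S"
proof -
  have "(v, l) [^]\<^bsub>sdp r\<^esub> q \<in> S"
    using sdp.subgroup_int_pow_closed[OF assms] .
  then show ?thesis by (simp add: int_pow_eq)
qed

text \<open>Conjugation by \<open>(v, j)\<close> maps \<open>(w, 0)\<close> to
  \<open>(r j w, 0)\<close>. The inverse of \<open>(v, j)\<close> gives the opposite
  inclusion.\<close>

lemma base_act:
  assumes S: "subgroup S (sdp r)" "(v, j) \<in> S"
  shows "r j ` base S = base S"
proof -
  have *: "r j w \<in> base S" if "w \<in> base S" "(v, j) \<in> S" for w v j
  proof -
    have "(v + r j w, j) \<in> S"
      using subgroup.m_closed[OF S(1) that(2), of "(w, 0)"] that(1) by (simp add: base_def)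
    then show ?thesis using slice[OF S(1) that(2), of "v + r j w"] by simp
  qed
  have "(- r (- j) v, - j) \<in> S" using subgroup.m_inv_closed[OF S] by simp
  then have "r (- j) w \<in> base S" if "w \<in> base S" for w using *[OF that] by blast
  then have "w \<in> r j ` base S" if "w \<in> base S" for w
    using that by (intro image_eqI[of _ _ "r (- j) w"]) auto
  then show ?thesis using *[OF _ S(2)] by auto
qed

text \<open>Each occurring height is \<open>lev S * q\<close> and the slice there is the base coset
  of the \<open>q\<close>-th power of an element over \<open>lev S\<close>; these powers are common
  to both subgroups.\<close>

lemma subgroup_eqI:
  assumes S: "subgroup S (sdp r)" and T: "subgroup T (sdp r)"
    and "lev S = lev T" "base S = base T" "fibre S = fibre T"
  shows "S = T"
proof -
  obtain v where v: "(v, int (lev S)) \<in> S" "(v, int (lev S)) \<in> T"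
    using fibre_nonempty[OF S] assms(3,5) by (auto simp: fibre_def)
  have "(u, j) \<in> S \<longleftrightarrow> (u, j) \<in> T" for u j
  proof (cases "int (lev S) dvd j")
    case True
    then obtain q where j: "j = int (lev S) * q" by blast
    show ?thesis
      using slice[OF S pw_closed[OF S v(1)], of u q] slice[OF T pw_closed[OF T v(2)], of u q]
      by (simp add: j assms(4))
  next
    case False
    then have "j \<notin> snd ` S" "j \<notin> snd ` T" by (simp_all add: snd_subgroup S T flip: assms(3))
    then show ?thesis by (metis image_eqI snd_conv)
  qed
  then show ?thesis by auto
qed

text \<open>For a lattice \<open>L\<close> invariant under \<open>r l\<close> this is the subgroup
  generated by \<open>L\<close> and \<open>(v, l)\<close>: every level and fibre compatible with
  \<open>L\<close> is realized.\<close>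

definition spl :: "'a set \<Rightarrow> 'a \<Rightarrow> int \<Rightarrow> ('a \<times> int) set"
  where "spl L v l = {(w + pw v l q, l * q) | w q. w \<in> L}"

lemma act_mult_image: "r l ` L = L \<Longrightarrow> r (l * q) ` L = L"
proof (induction q rule: int_induct[of _ 0])
  case (step1 i)
  then show ?case using act_add[of "l * i" l] by (simp add: distrib_left image_image[symmetric])
next
  case (step2 i)
  have "r (l * i) ` L = r (l * (i - 1)) ` (r l ` L)"
    using act_add[of "l * (i - 1)" l] by (simp add: image_image algebra_simps)
  then show ?case using step2 by simp
qed simp

lemma spl:
  assumes L: "sublat L" and rL: "r (int l) ` L = L" and l: "l > 0"
  shows "subgroup (spl L v (int l)) (sdp r)" "lev (spl L v (int l)) = l"
    "base (spl L v (int l)) = L" "fibre (spl L v (int l)) = (+) v ` L"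
proof -
  let ?S = "spl L v (int l)"
  have rLq: "r (int l * q) w \<in> L" if "w \<in> L" for q w
    using act_mult_image[OF rL, of q] that by blast
  have "(0, 0) \<in> ?S"
    using sublat_zero[OF L] by (auto simp: spl_def intro!: exI[of _ 0])
  moreover have "(a - r (i - j) b, i - j) \<in> ?S" if "(a, i) \<in> ?S" "(b, j) \<in> ?S" for a i b j
  proof -
    obtain w p z q where *: "a = w + pw v (int l) p" "i = int l * p" "w \<in> L"
      "b = z + pw v (int l) q" "j = int l * q" "z \<in> L"
      using \<open>(a, i) \<in> ?S\<close> \<open>(b, j) \<in> ?S\<close> by (auto simp: spl_def)
    have "pw v (int l) p = pw v (int l) (p - q) + r (int l * (p - q)) (pw v (int l) q)"
      using pw_add[of v "int l" "p - q" q] by simp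
    then have "a - r (i - j) b = (w - r (int l * (p - q)) z) + pw v (int l) (p - q)"
      by (simp add: * act_plus flip: right_diff_distrib)
    moreover have "w - r (int l * (p - q)) z \<in> L" using * rLq L by (simp add: sublat_diff)
    moreover have "i - j = int l * (p - q)" by (simp add: * right_diff_distrib)
    ultimately show ?thesis unfolding spl_def by blast
  qed
  ultimately show S: "subgroup ?S (sdp r)" by (simp add: subgroup_sdp_iff)
  show lev: "lev ?S = l"
  proof (rule lev_eqI)
    show "snd ` ?S = {x. int l dvd x}"
    proof (intro equalityI subsetI)
      fix x assume "x \<in> {x. int l dvd x}"
      then obtain q where x: "x = int l * q" by blast
      have "(0 + pw v (int l) q, x) \<in> ?S" unfolding spl_def x using sublat_zero[OF L] by blast
      then show "x \<in> snd ` ?S" by (rule rev_image_eqI) simp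
    qed (auto simp: spl_def)
  qed
  show b: "base ?S = L" using l by (auto simp: base_def spl_def)
  have "(v, int l) \<in> ?S"
    using sublat_zero[OF L] by (auto simp: spl_def intro!: exI[of _ 0] exI[of _ 1])
  then show "fibre ?S = (+) v ` L" using fibre_eq_coset[OF S, of v] by (simp add: fibre_def lev b)
qed

lemma rcosets_sdp: "rcosets\<^bsub>sdp r\<^esub> S = range (\<lambda>g. S #>\<^bsub>sdp r\<^esub> g)"
  by (auto simp: RCOSETS_def)

text \<open>Left multiplication by powers of an element over the level brings the height into the
  range from 0 to the level; what remains free is the translation part modulo the base.\<close>

lemma card_rcosets_eq:
  assumes S: "subgroup S (sdp r)"
  shows "card (rcosets\<^bsub>sdp r\<^esub> S) = lev S * lat_index (base S)"
proof (cases "lev S = 0")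
  case True
  \<comment> \<open>At level 0 the elements \<open>(0, i)\<close> lie in distinct cosets, so the
    index is infinite and both sides are 0 by convention.\<close>
  have "inj (\<lambda>i. S #>\<^bsub>sdp r\<^esub> (0, i))"
  proof (rule injI)
    fix i j assume "S #>\<^bsub>sdp r\<^esub> (0, i) = S #>\<^bsub>sdp r\<^esub> (0, j)"
    then have "(0, i - j) \<in> S" by (simp add: sdp.rcos_eq_iff[OF S])
    then have "i - j \<in> snd ` S" by (rule rev_image_eqI) simp
    then show "i = j" using snd_subgroup[OF S] True by simp
  qed
  then have "infinite (range (\<lambda>i. S #>\<^bsub>sdp r\<^esub> (0, i)))"
    using finite_imageD infinite_UNIV_int by blast
  then have "infinite (rcosets\<^bsub>sdp r\<^esub> S)"
    by (rule contrapos_nn) (auto simp: rcosets_sdp elim: finite_subset[rotated])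
  then show ?thesis using True by simp
next
  case False
  define l where "l = int (lev S)"
  have l: "l > 0" using False by (simp add: l_def)
  obtain v where v: "(v, l) \<in> S" using fibre_nonempty[OF S] by (auto simp: fibre_def l_def)
  \<comment> \<open>The reduced representative of the coset of \<open>g\<close>: its height is the
    remainder modulo \<open>l\<close>.\<close>
  define f where "f g = (v, l) [^]\<^bsub>sdp r\<^esub> (- (snd g div l)) \<otimes>\<^bsub>sdp r\<^esub> g" for g
  have fS: "S #>\<^bsub>sdp r\<^esub> f g = S #>\<^bsub>sdp r\<^esub> g" for g
  proof -
    have "(v, l) [^]\<^bsub>sdp r\<^esub> (- (snd g div l)) \<in> S"
      using sdp.subgroup_int_pow_closed[OF S v] .
    then show ?thesis by (simp add: f_def sdp.rcos_eq_iff[OF S] sdp.m_assoc int_pow_eq)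
  qed
  have f2: "snd (f g) = snd g mod l" for g
    by (cases g) (simp add: f_def int_pow_eq minus_mult_div_eq_mod[symmetric])
  have "card (range (\<lambda>g. S #>\<^bsub>sdp r\<^esub> g)) = card (range (\<lambda>g. ((+) (fst (f g)) ` base S, snd (f g))))"
  proof (rule card_image_cong)
    fix g h
    obtain a i b j where *: "f g = (a, i)" "f h = (b, j)" by force
    have ij: "0 \<le> i" "i < l" "0 \<le> j" "j < l" using f2[of g] f2[of h] * l by auto
    have "S #>\<^bsub>sdp r\<^esub> g = S #>\<^bsub>sdp r\<^esub> h \<longleftrightarrow> (a - r (i - j) b, i - j) \<in> S"
      using fS[of g] fS[of h] * sdp.rcos_eq_iff[OF S, of "f g" "f h"]
      by (simp add: act_minus flip: act_add)
    also have "\<dots> \<longleftrightarrow> i = j \<and> a - b \<in> base S"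
    proof
      assume "(a - r (i - j) b, i - j) \<in> S"
      moreover from this have "i - j \<in> snd ` S" by (rule rev_image_eqI) simp
      then have "l dvd i - j" using snd_subgroup[OF S] by (simp add: l_def)
      then have "i mod l = j mod l" by (simp add: mod_eq_dvd_iff)
      then have "i = j" using ij by simp
      ultimately show "i = j \<and> a - b \<in> base S" by (simp add: base_def)
    qed (auto simp: base_def)
    finally show "S #>\<^bsub>sdp r\<^esub> g = S #>\<^bsub>sdp r\<^esub> h \<longleftrightarrow>
      ((+) (fst (f g)) ` base S, snd (f g)) = ((+) (fst (f h)) ` base S, snd (f h))"
      by (auto simp: * coset_eq_iff[OF sublat_base[OF S]])
  qed
  also have "range (\<lambda>g. ((+) (fst (f g)) ` base S, snd (f g))) = cosets (base S) \<times> {0..<l}"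
  proof -
    have "f (u, i) = (u, i)" if "i \<in> {0..<l}" for u i
      using that by (simp add: f_def int_pow_eq)
    then have "((+) u ` base S, i) \<in> range (\<lambda>g. ((+) (fst (f g)) ` base S, snd (f g)))"
      if "i \<in> {0..<l}" for u i
      using that by (intro image_eqI[of _ _ "(u, i)"]) auto
    then show ?thesis using l by (auto simp: cosets_def f2)
  qed
  finally show ?thesis
    by (simp add: rcosets_sdp card_cartesian_product lat_index_def l_def)
qed

text \<open>Applied below to the trivial action on the integers, where it enumerates the sublattices
  of the plane by their Hermite normal form.\<close>

lemma bij_betw_subgroups:
  assumes l: "l > 0"
  shows "bij_betw (\<lambda>S. (base S, fibre S))
    {S. subgroup S (sdp r) \<and> card (rcosets\<^bsub>sdp r\<^esub> S) = n \<and> lev S = l}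
    {(L, C). sublat L \<and> r (int l) ` L = L \<and> l * lat_index L = n \<and> C \<in> cosets L}"
    (is "bij_betw ?f ?A ?B")
proof -
  have "?f ` ?A = ?B"
  proof (intro equalityI subsetI)
    fix p assume "p \<in> ?f ` ?A"
    then obtain S where S: "subgroup S (sdp r)" "card (rcosets\<^bsub>sdp r\<^esub> S) = n" "lev S = l"
      "p = (base S, fibre S)" by blast
    obtain v where v: "v \<in> fibre S" using fibre_nonempty[OF S(1)] by blast
    then have "r (int l) ` base S = base S" using base_act[OF S(1)] S(3) by (simp add: fibre_def)
    then show "p \<in> ?B"
      using S card_rcosets_eq[OF S(1)] fibre_eq_coset[OF S(1) v] sublat_base[OF S(1)]
      by (auto simp: cosets_def)
  next
    fix p assume "p \<in> ?B"
    then obtain L v where p: "p = (L, (+) v ` L)" and L: "sublat L" "r (int l) ` L = L" "l * lat_index L = n"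
      by (auto simp: cosets_def)
    have "spl L v (int l) \<in> ?A" "p = ?f (spl L v (int l))"
      using spl[OF L(1,2) l, of v] card_rcosets_eq[OF spl(1)[OF L(1,2) l, of v]] L(3) by (auto simp: p)
    then show "p \<in> ?f ` ?A" by blast
  qed
  moreover have "inj_on ?f ?A"
    by (rule inj_onI, rule subgroup_eqI) auto
  ultimately show ?thesis by (simp add: bij_betw_def)
qed

text \<open>The isomorphism sends \<open>(u, j)\<close> to \<open>\<phi> u\<close> times the
  \<open>j\<close>-th power of an element of \<open>S\<close> over \<open>e\<close>. Admitting both
  signs of \<open>e\<close> is what identifies opposite levels.\<close>

lemma sdp_iso_subgroup:
  fixes r' :: "int \<Rightarrow> 'b::ab_group_add \<Rightarrow> 'b"
  assumes S: "subgroup S (sdp r)" and l: "lev S > 0"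
    and e: "\<bar>e\<bar> = int (lev S)"
    and phi: "additive \<phi>" "inj \<phi>" "range \<phi> = base S"
    and equiv: "\<And>j u. \<phi> (r' j u) = r (e * j) (\<phi> u)"
  shows "sdp r' \<cong> sdp r\<lparr>carrier := S\<rparr>"
proof -
  interpret \<phi>: additive \<phi> by fact
  have "e \<in> snd ` S" using e unfolding snd_subgroup[OF S] by (metis dvd_abs_iff dvd_refl mem_Collect_eq)
  then obtain v where v: "(v, e) \<in> S" by auto
  define \<Psi> where "\<Psi> = (\<lambda>(u, j). (\<phi> u + pw v e j, e * j))"
  have mem: "\<Psi> g \<in> S" for g
  proof -
    obtain u j where g: "g = (u, j)" by force
    have "\<phi> u \<in> base S" using phi(3) by blast
    then show ?thesis
      using slice[OF S pw_closed[OF S v, of j], of "\<phi> u + pw v e j"] by (simp add: g \<Psi>_def)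
  qed
  have "\<Psi> \<in> hom (sdp r') (sdp r\<lparr>carrier := S\<rparr>)"
  proof (rule homI)
    fix g h show "\<Psi> (g \<otimes>\<^bsub>sdp r'\<^esub> h) = \<Psi> g \<otimes>\<^bsub>sdp r\<lparr>carrier := S\<rparr>\<^esub> \<Psi> h"
      by (cases g; cases h) (simp add: \<Psi>_def \<phi>.add pw_add act_plus equiv algebra_simps)
  qed (simp add: mem)
  moreover have "inj \<Psi>"
    using e l inj_eq[OF phi(2)] by (auto simp: \<Psi>_def inj_def)
  moreover have "S \<subseteq> range \<Psi>"
  proof
    fix p assume p: "p \<in> S"
    obtain a i where ai: "p = (a, i)" by force
    have "i \<in> snd ` S" using p by (rule rev_image_eqI) (simp add: ai)
    then have "int (lev S) dvd i" by (simp add: snd_subgroup[OF S])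
    then have "e dvd i" using e by (metis abs_dvd_iff)
    then obtain j where i: "i = e * j" by blast
    have "a - pw v e j \<in> base S"
      using slice[OF S pw_closed[OF S v, of j], of a] p by (simp add: ai i)
    then obtain u where "\<phi> u = a - pw v e j" using phi(3) by (metis imageE)
    then have "p = \<Psi> (u, j)" by (simp add: \<Psi>_def ai i)
    then show "p \<in> range \<Psi>" by blast
  qed
  ultimately have "\<Psi> \<in> iso (sdp r') (sdp r\<lparr>carrier := S\<rparr>)"
    using mem by (auto simp: iso_def bij_betw_def)
  then show ?thesis by (rule is_isoI)
qed

text \<open>Conjugation by \<open>(w, k)\<close> rotates base and fibre by \<open>k\<close> and
  shifts the fibre by \<open>w - r (lev S) w\<close>; the shift is the only trace of
  \<open>w\<close>.\<close>

lemma conj_subgroup: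
  assumes S: "subgroup S (sdp r)"
  defines "T w k \<equiv> (w, k) <#\<^bsub>sdp r\<^esub> S #>\<^bsub>sdp r\<^esub> inv\<^bsub>sdp r\<^esub> (w, k)"
  shows "T w k = (\<lambda>(v, j). (w + r k v - r j w, j)) ` S" "subgroup (T w k) (sdp r)"
    "lev (T w k) = lev S" "base (T w k) = r k ` base S"
    "fibre (T w k) = (\<lambda>v. r k v + (w - r (int (lev S)) w)) ` fibre S"
proof -
  have r_r: "r (k + j) (r (- k) w) = r j w" for j
    by (simp flip: act_add)
  have "T w k = (\<lambda>s. (w, k) \<otimes>\<^bsub>sdp r\<^esub> s \<otimes>\<^bsub>sdp r\<^esub> inv\<^bsub>sdp r\<^esub> (w, k)) ` S"
    by (auto simp: T_def l_coset_def r_coset_def)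
  also have "\<dots> = (\<lambda>(v, j). (w + r k v - r j w, j)) ` S"
    by (rule image_cong) (auto simp: act_minus r_r)
  finally show T: "T w k = (\<lambda>(v, j). (w + r k v - r j w, j)) ` S" .
  have mem_T: "(x, j) \<in> T w k \<longleftrightarrow> (\<exists>v. (v, j) \<in> S \<and> x = w + r k v - r j w)" for x j
    unfolding T image_iff Bex_def split_paired_Ex by auto
  show "subgroup (T w k) (sdp r)"
  proof -
    have *: "w + r k v - r j w - r (j - i) (w + r k u - r i w) = w + r k (v - r (j - i) u) - r (j - i) w"
      for v j u i
      by (simp add: act_plus act_diff add.commute flip: act_add)
    show ?thesis
      unfolding subgroup_sdp_iff
    proof (intro conjI allI impI)
      show "(0, 0) \<in> T w k" using subgroup.one_closed[OF S] unfolding T by (rule rev_image_eqI) simp_all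
      fix u i v j assume "(u, i) \<in> T w k" "(v, j) \<in> T w k"
      then obtain a b where ab: "(a, i) \<in> S" "u = w + r k a - r i w" "(b, j) \<in> S" "v = w + r k b - r j w"
        by (auto simp: T)
      then have "(a - r (i - j) b, i - j) \<in> S" using S unfolding subgroup_sdp_iff by blast
      then show "(u - r (i - j) v, i - j) \<in> T w k"
        unfolding T ab * by (rule rev_image_eqI) simp
    qed
  qed
  have "snd ` T w k = snd ` S" by (simp add: T image_image case_prod_unfold)
  then show lev: "lev (T w k) = lev S" by (simp add: lev_def)
  show "base (T w k) = r k ` base S" by (auto simp: base_def mem_T)
  show "fibre (T w k) = (\<lambda>v. r k v + (w - r (int (lev S)) w)) ` fibre S"
    by (auto simp: fibre_def mem_T lev image_iff algebra_simps)
qed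

end

section \<open>Sublattices of the hexagonal lattice\<close>

text \<open>The pair \<open>(a, b)\<close> stands for \<open>a + b \<omega>\<close> with \<open>\<omega>\<close> a primitive third root of unity,
  and \<open>rot k\<close> is multiplication by the \<open>k\<close>-th power of \<open>- \<omega>\<^sup>2 = 1 + \<omega>\<close>.\<close>

type_synonym eis = "int \<times> int"

definition rot :: "int \<Rightarrow> eis \<Rightarrow> eis"
  where "rot k = (\<lambda>(a, b). let m = k mod 6 in
    if m = 0 then (a, b) else if m = 1 then (a - b, a) else if m = 2 then (- b, a - b)
    else if m = 3 then (- a, - b) else if m = 4 then (b - a, - a) else (b, b - a))"

lemma mod6_cases:
  obtains "k mod 6 = 0" | "k mod 6 = 1" | "k mod 6 = 2" | "k mod 6 = 3" | "k mod 6 = 4" | "k mod 6 = (5::int)"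
  using pos_mod_bound[of 6 k] pos_mod_sign[of 6 k] by linarith

lemma rot_simps:
  "k mod 6 = 0 \<Longrightarrow> rot k (a, b) = (a, b)"
  "k mod 6 = 1 \<Longrightarrow> rot k (a, b) = (a - b, a)"
  "k mod 6 = 2 \<Longrightarrow> rot k (a, b) = (- b, a - b)"
  "k mod 6 = 3 \<Longrightarrow> rot k (a, b) = (- a, - b)"
  "k mod 6 = 4 \<Longrightarrow> rot k (a, b) = (b - a, - a)"
  "k mod 6 = 5 \<Longrightarrow> rot k (a, b) = (b, b - a)"
  by (simp_all add: rot_def)

lemma rot_cong: "i mod 6 = j mod 6 \<Longrightarrow> rot i = rot j"
  by (simp add: rot_def)

lemma rot_add: "rot (i + j) v = rot i (rot j v)"
proof -
  obtain a b where v: "v = (a, b)" by force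
  have *: "(i + j) mod 6 = (i mod 6 + j mod 6) mod 6" by (simp add: mod_add_eq)
  show ?thesis unfolding v
    by (cases i rule: mod6_cases; cases j rule: mod6_cases; simp add: rot_simps *)
qed

lemma rot_plus: "rot i (u + v) = rot i u + rot i v"
  by (cases u; cases v; cases i rule: mod6_cases) (simp_all add: rot_simps)

interpretation rot: int_action rot
  by unfold_locales (simp add: rot_def split_def, rule rot_add, rule rot_plus)

text \<open>The values 0, 1, 2, 3 of \<open>c\<close> give the four model groups.\<close>

lemma rot_power: "int_action (\<lambda>j. rot (c * j))"
  by unfold_locales (simp, simp add: distrib_left rot_add, rule rot_plus)

text \<open>With this action the semidirect product of two copies of the integers is the plane
  lattice itself, on the type \<open>eis\<close>. Thus \<open>lev\<close>, \<open>base\<close> and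
  \<open>fibre\<close> become coordinates for sublattices of \<open>E\<close>.\<close>

definition triv :: "int \<Rightarrow> int \<Rightarrow> int"
  where triv_simp: "triv i v = v"

interpretation triv: int_action triv
  by unfold_locales (auto simp: triv_simp)

lemma subgroup_triv_iff: "subgroup L (sdp triv) \<longleftrightarrow> sublat L"
  by (auto simp: triv.subgroup_sdp_iff triv_simp sublat_def zero_prod_def) (metis diff_Pair)

lemma card_rcosets_triv:
  "card (rcosets\<^bsub>sdp triv\<^esub> L) = lat_index L"
proof -
  have "L #>\<^bsub>sdp triv\<^esub> g = (+) g ` L" for g
  proof -
    have "h \<otimes>\<^bsub>sdp triv\<^esub> g = g + h" for h :: "eis" by (cases g; cases h) (simp add: triv_simp)
    then show ?thesis by (auto simp: r_coset_def)
  qed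
  then show ?thesis by (simp add: triv.rcosets_sdp lat_index_def cosets_def)
qed

lemma lat_index_eq: "sublat L \<Longrightarrow> lat_index L = lev L * lat_index (base L)" for L :: "eis set"
  using triv.card_rcosets_eq[of L] by (simp add: subgroup_triv_iff card_rcosets_triv)

lemma sublat_dvd: "additive f \<Longrightarrow> sublat {v. (k::int) dvd f v}"
  by (auto simp: sublat_def additive.zero[of f] additive.diff[of f])

text \<open>The residue of \<open>f v\<close> modulo \<open>k\<close> is a complete invariant of the
  coset. For \<open>k = 0\<close> there are infinitely many residues, in accordance with the index
  convention.\<close>

lemma lat_index_dvd:
  fixes f :: "'a::ab_group_add \<Rightarrow> int"
  assumes "additive f" "surj f"
  shows "lat_index {v. int k dvd f v} = k"
proof -
  have "lat_index {v. int k dvd f v} = card (range (\<lambda>v. f v mod int k))"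
    unfolding lat_index_def cosets_def
    by (rule card_image_cong)
      (simp only: coset_eq_iff[OF sublat_dvd[OF assms(1)]] additive.diff[OF assms(1)] mod_eq_dvd_iff
        mem_Collect_eq)
  also have "range (\<lambda>v. f v mod int k) = (\<lambda>x. x mod int k) ` range f"
    by (simp only: image_image)
  also have "\<dots> = range (\<lambda>x. x mod int k)" by (simp only: assms(2))
  also have "card \<dots> = k"
  proof (cases "k = 0")
    case True
    then show ?thesis by (simp add: infinite_UNIV_int)
  next
    case False
    moreover have "y \<in> range (\<lambda>x. x mod int k)" if "y \<in> {0..<int k}" for y
      using that by (intro image_eqI[of _ _ y]) auto
    ultimately have *: "range (\<lambda>x. x mod int k) = {0..<int k}" by auto
    show ?thesis unfolding * by simp
  qed
  finally show ?thesis .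
qed

lemma lat_index_multiples: "lat_index {x. int k dvd x} = k"
  by (rule lat_index_dvd) (auto simp: additive_def)

lemma sublat_multiples: "sublat {x. (k::int) dvd x}"
  by (auto simp: sublat_def)

lemma sublat_int_index:
  assumes "sublat (A :: int set)"
  shows "A = {x. int (lat_index A) dvd x}"
proof -
  define k where "k = nat (Gcd A)"
  have A: "A = {x. int k dvd x}"
    using sublat_int_eq_multiples[OF assms] by (simp add: k_def)
  then have "lat_index A = k" using lat_index_multiples[of k] by simp
  then show ?thesis using A by simp
qed

definition Lat :: "nat \<Rightarrow> eis set set"
  where "Lat m = {L. sublat L \<and> lat_index L = m}"

text \<open>A lattice of index \<open>m\<close> with level \<open>d\<close> has base generated by
  \<open>m div d\<close>, and its fibre is one of the \<open>m div d\<close> cosets of that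
  base.\<close>

lemma Lat_card:
  assumes "m > 0"
  shows "finite (Lat m) \<and> card (Lat m) = (\<Sum>d | d dvd m. d)"
proof -
  define B where "B d = {L \<in> Lat m. lev L = d}" for d
  have B: "finite (B d) \<and> card (B d) = m div d" if d: "d dvd m" for d
  proof -
    have d0: "d > 0" using d assms by (auto intro: ccontr)
    let ?A = "{x. int (m div d) dvd x}"
    have "bij_betw (\<lambda>S. (base S, fibre S)) (B d)
      {(A, C). sublat A \<and> triv (int d) ` A = A \<and> d * lat_index A = m \<and> C \<in> cosets A}"
      using triv.bij_betw_subgroups[OF d0, of m]
      by (simp add: subgroup_triv_iff card_rcosets_triv B_def Lat_def)
    also have "{(A, C). sublat A \<and> triv (int d) ` A = A \<and> d * lat_index A = m \<and> C \<in> cosets A} = {?A} \<times> cosets ?A"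
    proof -
      have "A = ?A" if "sublat A" "d * lat_index A = m" for A
        using sublat_int_index[OF that(1)] that(2) d0 by (metis nonzero_mult_div_cancel_left not_less0)
      then show ?thesis using d by (auto simp: triv_simp sublat_multiples lat_index_multiples simp del: of_nat_div zdiv_int)
    qed
    finally have bij: "bij_betw (\<lambda>S. (base S, fibre S)) (B d) ({?A} \<times> cosets ?A)" .
    have "card (cosets ?A) = m div d" using lat_index_multiples[of "m div d"] by (simp only: lat_index_def)
    moreover have "m div d > 0" using d assms by (auto elim!: dvdE)
    ultimately have "finite (cosets ?A)" by (metis card.infinite not_less0)
    then show ?thesis
      using bij_betw_same_card[OF bij] bij_betw_finite[OF bij] \<open>card (cosets ?A) = m div d\<close>
      by (simp only: card_cartesian_product finite_cartesian_product_iff) simp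
  qed
  have Lat: "Lat m = (\<Union>d\<in>{d. d dvd m}. B d)"
    using lat_index_eq by (auto simp: B_def Lat_def)
  have fin: "finite {d. d dvd m}" using assms by simp
  have "card (Lat m) = (\<Sum>d | d dvd m. card (B d))"
    unfolding Lat by (rule card_UN_disjoint) (use B fin in \<open>auto simp: B_def\<close>)
  also have "\<dots> = (\<Sum>d | d dvd m. m div d)" by (rule sum.cong) (use B in auto)
  also have "\<dots> = (\<Sum>d | d dvd m. d)"
    by (rule sum.reindex_bij_witness[of _ "\<lambda>d. m div d" "\<lambda>d. m div d"]) (use assms in auto)
  finally show ?thesis unfolding Lat using B fin by auto
qed

section \<open>Rotations that preserve a lattice\<close>

lemma rot_uminus: "rot 3 v = - v"
  by (cases v) (simp add: rot_simps)

lemma rot_image_3dvd: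
  assumes L: "sublat L" and "3 dvd j"
  shows "rot j ` L = L"
proof -
  obtain i where j: "j = 3 * i" using assms(2) by blast
  have "v \<in> rot 3 ` L" if "v \<in> L" for v
    using sublat_uminus[OF L that] by (intro image_eqI[of _ _ "- v"]) (simp_all add: rot_uminus)
  then have "rot 3 ` L = L" using sublat_uminus[OF L] by (auto simp: rot_uminus)
  then show ?thesis unfolding j by (rule rot.act_mult_image)
qed

lemma rot_image_ideal: "rot 1 ` L = L \<Longrightarrow> rot j ` L = L"
  using rot.act_mult_image[of 1 L j] by simp

text \<open>Since \<zeta> has finite order, its inverse is the positive power \<open>rot 5\<close>,
  so one inclusion suffices.\<close>

lemma ideal_if_closed:
  assumes "\<And>v. v \<in> L \<Longrightarrow> rot 1 v \<in> L"
  shows "rot 1 ` L = L"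
proof -
  have "rot 5 v = rot 1 (rot 1 (rot 1 (rot 1 (rot 1 v))))" "v = rot 1 (rot 5 v)" for v
    by (cases v, simp add: rot_simps)+
  then have "v \<in> rot 1 ` L" if "v \<in> L" for v using that assms by (metis image_eqI)
  then show ?thesis using assms by auto
qed

text \<open>Every lattice is stable under \<open>-1 = \<zeta>\<^sup>3\<close>, hence stability under
  \<open>\<zeta>\<^sup>4 = - \<zeta>\<close> is stability under \<zeta>. A suitable multiple of
  \<open>j\<close> is congruent to 1 or 4 modulo 6.\<close>

lemma rot_image_not_3dvd:
  assumes L: "sublat L" and j: "\<not> 3 dvd j"
  shows "rot j ` L = L \<longleftrightarrow> rot 1 ` L = L"
proof
  assume rj: "rot j ` L = L"
  have r4: "rot 1 ` L = L" if "rot 4 ` L = L"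
  proof (rule ideal_if_closed)
    fix v assume "v \<in> L"
    then have "- rot 4 v \<in> L" using that sublat_uminus[OF L] by blast
    then show "rot 1 v \<in> L" by (cases v) (simp add: rot_simps)
  qed
  show "rot 1 ` L = L"
  proof (cases j rule: mod6_cases)
    case 1 then have "3 dvd j" by presburger
    then show ?thesis using j by simp
  next
    case 2 then show ?thesis using rj rot_cong[of j 1] by simp
  next
    case 3
    then have "(j * 2) mod 6 = 4" by presburger
    then show ?thesis using rot.act_mult_image[OF rj, of 2] rot_cong[of "j * 2" 4] r4 by simp
  next
    case 4 then have "3 dvd j" by presburger
    then show ?thesis using j by simp
  next
    case 5 then show ?thesis using rj rot_cong[of j 4] r4 by simp
  next
    case 6
    then have "(j * 5) mod 6 = 1" by presburger
    then show ?thesis using rot.act_mult_image[OF rj, of 5] rot_cong[of "j * 5" 1] by simp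
  qed
qed (rule rot_image_ideal)

text \<open>Stability under \<zeta> makes a lattice an ideal because 1 and \<zeta> generate
  \<open>E\<close> additively.\<close>

definition Ideals :: "nat \<Rightarrow> eis set set"
  where "Ideals m = {L \<in> Lat m. rot 1 ` L = L}"

definition rho :: "nat \<Rightarrow> nat"
  where "rho a = card {b \<in> {0..<int a}. int a dvd b * b - b + 1}"

text \<open>When \<open>b\<close> is a root of \<open>X\<^sup>2 - X + 1\<close> modulo
  \<open>a\<close>, the number \<open>- b\<close> is a root of \<open>X\<^sup>2 + X + 1\<close>, and
  this is \<open>d\<close> times the kernel of the ring homomorphism from \<open>E\<close> to the
  integers modulo \<open>a\<close> that maps \<omega> to \<open>- b\<close>.\<close>

definition ideal_lat :: "int \<Rightarrow> int \<Rightarrow> int \<Rightarrow> eis set"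
  where "ideal_lat d a b = {(d * x, d * y) | x y. a dvd x - b * y}"

lemma mem_ideal_lat: "d \<noteq> 0 \<Longrightarrow> (d * x, d * y) \<in> ideal_lat d a b \<longleftrightarrow> a dvd x - b * y"
  by (auto simp: ideal_lat_def)

lemma sublat_pair_scale:
  assumes "sublat L" "(x, y) \<in> L"
  shows "(k * x, k * y) \<in> (L :: eis set)"
proof -
  have "sublat ((\<lambda>k. (k * x, k * y)) -` L)"
    by (rule sublat_vimage) (auto simp: assms additive_def algebra_simps)
  then have "k * 1 \<in> (\<lambda>k. (k * x, k * y)) -` L" by (rule sublat_int_mult) (simp add: assms)
  then show ?thesis by simp
qed

lemma ideal_lat:
  assumes d: "d > 0" and b: "int a dvd b * b - b + 1"
  defines "L \<equiv> ideal_lat (int d) (int a) b"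
  shows "sublat L" "lev L = d" "lat_index L = d\<^sup>2 * a" "rot 1 ` L = L"
proof -
  have diff: "(int d * x - int d * x', int d * y - int d * y') \<in> L"
    if "int a dvd x - b * y" "int a dvd x' - b * y'" for x y x' y'
  proof -
    have "x - x' - b * (y - y') = (x - b * y) - (x' - b * y')" by (simp add: algebra_simps)
    then have "int a dvd x - x' - b * (y - y')" using that by (metis dvd_diff)
    then show ?thesis using d by (simp add: L_def mem_ideal_lat flip: right_diff_distrib)
  qed
  have "(int d * 0, int d * 0) \<in> L" using d unfolding L_def by (subst mem_ideal_lat) auto
  then show L: "sublat L"
    using diff by (auto simp: sublat_def zero_prod_def L_def ideal_lat_def)
  show lev: "lev L = d"
  proof (rule triv.lev_eqI)
    have "int d * y \<in> snd ` L" for y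
    proof -
      have "(int d * (b * y), int d * y) \<in> L" using d unfolding L_def by (subst mem_ideal_lat) auto
      then show ?thesis by (rule rev_image_eqI) simp
    qed
    then show "snd ` L = {x. int d dvd x}" by (auto simp: L_def ideal_lat_def)
  qed
  have "base L = {x. int (d * a) dvd x}"
  proof (intro equalityI subsetI)
    fix x assume "x \<in> {x. int (d * a) dvd x}"
    then obtain t where "x = int (d * a) * t" by blast
    then have "x = int d * (int a * t)" by (simp add: mult.assoc)
    then have "(x, int d * 0) \<in> L" using d unfolding L_def by (simp only: mem_ideal_lat) simp
    then show "x \<in> base L" by (simp add: base_def)
  qed (use d in \<open>auto simp: base_def L_def ideal_lat_def\<close>)
  then have "lat_index L = d * (d * a)"
    unfolding lat_index_eq[OF L] lev by (simp only: lat_index_multiples)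
  then show "lat_index L = d\<^sup>2 * a" by (simp add: power2_eq_square)
  show "rot 1 ` L = L"
  proof (rule ideal_if_closed)
    fix v assume "v \<in> L"
    then obtain x y where v: "v = (int d * x, int d * y)" "int a dvd x - b * y"
      by (auto simp: L_def ideal_lat_def)
    \<comment> \<open>Multiplication by \<open>\<zeta> = 1 + \<omega>\<close> becomes multiplication
      by \<open>1 - b\<close> in the quotient, up to a multiple of the polynomial value.\<close>
    have "(x - y) - b * x = (1 - b) * (x - b * y) - y * (b * b - b + 1)" by (simp add: algebra_simps)
    then have "int a dvd (x - y) - b * x" using v(2) b by simp
    then show "rot 1 v \<in> L"
      using d by (simp add: v(1) rot_simps L_def mem_ideal_lat flip: right_diff_distrib)
  qed
qed

text \<open>The Hermite basis: \<open>(a, 0)\<close> generates the base and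
  \<open>(b, lev L)\<close> lies over the level.\<close>

lemma lattice_basis:
  fixes L :: "eis set"
  assumes L: "sublat L" and pos: "lat_index L > 0"
  obtains a b where "a > 0" "lat_index L = lev L * a" "base L = {x. int a dvd x}"
    "(b, int (lev L)) \<in> L" "lev L > 0"
    "\<forall>x y. (x, y) \<in> L \<longleftrightarrow> (\<exists>q. y = int (lev L) * q \<and> int a dvd x - b * q)"
proof -
  have S: "subgroup L (sdp triv)" using L by (simp add: subgroup_triv_iff)
  obtain b where b: "b \<in> fibre L" using triv.fibre_nonempty[OF S] by blast
  define a where "a = lat_index (base L)"
  have ba: "base L = {x. int a dvd x}"
    unfolding a_def by (rule sublat_int_index[OF triv.sublat_base[OF S]])
  have bL: "(b, int (lev L)) \<in> L" using b by (simp add: fibre_def)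
  have "(x, y) \<in> L \<longleftrightarrow> (\<exists>q. y = int (lev L) * q \<and> int a dvd x - b * q)" for x y
  proof -
    have *: "(x, int (lev L) * q) \<in> L \<longleftrightarrow> int a dvd x - b * q" for q
      using triv.slice[OF S, of "b * q" "int (lev L) * q" x] sublat_pair_scale[OF L bL, of q]
      by (simp add: ba mult.commute)
    moreover have "int (lev L) dvd y" if "(x, y) \<in> L"
    proof -
      have "y \<in> snd ` L" using that by (rule rev_image_eqI) simp
      then show ?thesis by (simp add: triv.snd_subgroup[OF S])
    qed
    ultimately show ?thesis by (metis dvd_def)
  qed
  moreover have "lat_index L = lev L * a" by (simp add: a_def lat_index_eq[OF L])
  ultimately show ?thesis using that[of a b] bL ba pos by simp
qed

text \<open>The largest integer \<open>d\<close> dividing an ideal is its level, and removing it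
  leaves an ideal with cyclic quotient, that is, a root modulo the remaining factor of the
  index.\<close>

lemma card_Ideals:
  assumes m: "m > 0"
  shows "finite (Ideals m) \<and> card (Ideals m) = (\<Sum>d | d\<^sup>2 dvd m. rho (m div d\<^sup>2))"
proof -
  let ?R = "\<lambda>d. {b \<in> {0..<int (m div d\<^sup>2)}. int (m div d\<^sup>2) dvd b * b - b + 1}"
  let ?D = "{d. d\<^sup>2 dvd m}"
  let ?f = "\<lambda>(d, b). ideal_lat (int d) (int (m div d\<^sup>2)) b"
  have D: "finite ?D"
    by (rule finite_subset[of _ "{d. d dvd m}"]) (use m in \<open>auto simp: power2_eq_square dvd_mult_left\<close>)
  have d0: "d > 0" if "d\<^sup>2 dvd m" for d using that m by (cases "d = 0") auto
  have bij: "bij_betw ?f (Sigma ?D ?R) (Ideals m)"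
    unfolding bij_betw_def
  proof (intro conjI equalityI subsetI)
    show "inj_on ?f (Sigma ?D ?R)"
    proof (rule inj_onI)
      fix p q assume p: "p \<in> Sigma ?D ?R" and q: "q \<in> Sigma ?D ?R" and eq: "?f p = ?f q"
      obtain d b d' b' where pq: "p = (d, b)" "q = (d', b')" by force
      \<comment> \<open>The level recovers the integer factor; the vector over the level then
        recovers the root modulo \<open>m div d\<^sup>2\<close>.\<close>
      have dd: "d' = d"
        using ideal_lat(2)[of d "m div d\<^sup>2" b] ideal_lat(2)[of d' "m div d'\<^sup>2" b'] p q eq d0
        by (simp add: pq)
      have d: "int d \<noteq> 0" using p d0[of d] by (auto simp: pq)
      have "(int d * b, int d * 1) \<in> ideal_lat (int d) (int (m div d\<^sup>2)) b"
        by (simp only: mem_ideal_lat[OF d]) simp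
      then have "(int d * b, int d * 1) \<in> ideal_lat (int d) (int (m div d\<^sup>2)) b'"
        using eq unfolding pq prod.case dd by (simp only:)
      then have "int (m div d\<^sup>2) dvd b - b'" by (simp only: mem_ideal_lat[OF d]) simp
      then have "b mod int (m div d\<^sup>2) = b' mod int (m div d\<^sup>2)" by (simp only: mod_eq_dvd_iff)
      then have "b = b'" using p q unfolding pq dd by auto
      then show "p = q" by (simp add: pq dd)
    qed
  next
    fix L assume "L \<in> ?f ` Sigma ?D ?R"
    then obtain d b where *: "L = ideal_lat (int d) (int (m div d\<^sup>2)) b" "d\<^sup>2 dvd m"
      "int (m div d\<^sup>2) dvd b * b - b + 1" by auto
    show "L \<in> Ideals m"
      using ideal_lat[OF d0[OF *(2)] *(3)] *(2) unfolding *(1) by (simp add: Ideals_def Lat_def)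
  next
    fix L assume "L \<in> Ideals m"
    then have L: "sublat L" "lat_index L = m" and r1: "rot 1 ` L = L" by (auto simp: Ideals_def Lat_def)
    obtain a b where a: "a > 0" "lat_index L = lev L * a" "base L = {x. int a dvd x}"
      and b: "(b, int (lev L)) \<in> L" and lev0: "lev L > 0"
      and mem: "\<forall>x y. (x, y) \<in> L \<longleftrightarrow> (\<exists>q. y = int (lev L) * q \<and> int a dvd x - b * q)"
      by (rule lattice_basis[OF L(1)]) (use L(2) m in simp)
    define d where "d = lev L"
    have d: "d > 0" using lev0 by (simp add: d_def)
    have "int a \<in> base L" by (simp add: a(3))
    then have "(int a, 0) \<in> L" by (simp add: base_def)
    \<comment> \<open>This vector is \<open>(a, a)\<close>, and second coordinates in
      \<open>L\<close> are multiples of \<open>d\<close>; hence \<open>d\<close> divides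
      \<open>a\<close>.\<close>
    then have "rot 1 (int a, 0) \<in> L" using r1 by blast
    then have "\<exists>q. int a = int d * q" by (auto simp: rot_simps mem d_def)
    then have "int d dvd int a" by (simp only: dvd_def)
    then obtain a' where a': "a = d * a'" by auto
    have m_eq: "m = d\<^sup>2 * a'" using a(2) L(2) by (simp add: a' d_def power2_eq_square)
    \<comment> \<open>The rotated basis vector is \<open>(b - d, b)\<close>. Its second coordinate
      shows that \<open>d\<close> divides \<open>b\<close>, and its first one that
      \<open>c = b / d\<close> is a root modulo \<open>a'\<close>.\<close>
    have "rot 1 (b, int d) \<in> L" using r1 b by (auto simp: d_def)
    then obtain c where c: "b = int d * c" "int a dvd b - int d - b * c"
      using d by (auto simp: rot_simps mem d_def)
    have "b - int d - b * c = int d * - (c * c - c + 1)" by (simp add: c(1) algebra_simps)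
    then have "int a' dvd - (c * c - c + 1)"
      using c(2) d by (simp only: a' of_nat_mult dvd_mult_cancel_left) simp
    then have c2: "int a' dvd c * c - c + 1" by (simp only: dvd_minus_iff)
    \<comment> \<open>The basis determines the root only modulo \<open>a'\<close>; the reduced
      residue is the one counted by \<open>rho\<close>.\<close>
    define e where "e = c mod int a'"
    have a'0: "a' > 0" using a(1) by (auto simp: a')
    have e1: "int a' dvd c - e" by (simp add: e_def minus_mod_eq_mult_div)
    have "e * e - e + 1 = (c * c - c + 1) - (c - e) * (c + e - 1)" by (simp add: algebra_simps)
    then have e2: "int a' dvd e * e - e + 1" using c2 e1 by (metis dvd_diff dvd_mult2)
    have "L = ideal_lat (int d) (int a') e"
    proof -
      have "(x, y) \<in> L \<longleftrightarrow> (x, y) \<in> ideal_lat (int d) (int a') e" for x y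
      proof (cases "int d dvd x \<and> int d dvd y")
        case True
        then obtain u v where uv: "x = int d * u" "y = int d * v" by blast
        have "u - e * v = (u - c * v) + (c - e) * v" by (simp add: algebra_simps)
        then have "int a' dvd u - e * v \<longleftrightarrow> int a' dvd u - c * v"
          using e1 by (metis dvd_add_left_iff dvd_mult2)
        moreover have "int d * u - b * v = int d * (u - c * v)" by (simp add: c(1) algebra_simps)
        ultimately show ?thesis
          using d by (simp add: uv mem mem_ideal_lat a' flip: d_def)
      next
        case False
        have "int d dvd x" if "int a dvd x - b * q" for q
        proof -
          have "int d dvd x - b * q" using that by (simp add: a' dvd_mult_left)
          moreover have "int d dvd b * q" by (simp add: c(1))
          ultimately show ?thesis by (metis diff_add_cancel dvd_add)
        qed
        then have "(x, y) \<notin> L" using False by (auto simp: mem d_def)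
        moreover have "(x, y) \<notin> ideal_lat (int d) (int a') e" using False by (auto simp: ideal_lat_def)
        ultimately show ?thesis by simp
      qed
      then show ?thesis by auto
    qed
    moreover have "m div d\<^sup>2 = a'" using d by (simp add: m_eq)
    ultimately have "L = ?f (d, e)" by simp
    moreover have "(d, e) \<in> Sigma ?D ?R"
      using a'0 e2 \<open>m div d\<^sup>2 = a'\<close> by (simp add: m_eq e_def)
    ultimately show "L \<in> ?f ` Sigma ?D ?R" by blast
  qed
  have fin: "finite (?R d)" for d
    by (rule finite_subset[OF _ finite_atLeastLessThan_int]) blast
  have "finite (Ideals m)"
    by (rule iffD1[OF bij_betw_finite[OF bij]], rule finite_SigmaI[OF D], rule fin)
  moreover have "card (Ideals m) = card (Sigma ?D ?R)"
    by (rule bij_betw_same_card[OF bij, symmetric])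
  moreover have "card (Sigma ?D ?R) = (\<Sum>d\<in>?D. card (?R d))"
    by (rule card_SigmaI) (use D fin in blast)+
  ultimately show ?thesis by (simp add: rho_def)
qed

text \<open>Only the additive structure is respected, which is enough when the acting powers of
  \<zeta> are signs.\<close>

lemma lattice_iso:
  fixes L :: "eis set"
  assumes L: "sublat L" and pos: "lat_index L > 0"
  obtains \<phi> :: "eis \<Rightarrow> eis" where "additive \<phi>" "inj \<phi>" "range \<phi> = L"
proof -
  obtain a b where a: "a > 0" "lat_index L = lev L * a" "base L = {x. int a dvd x}"
    and b: "(b, int (lev L)) \<in> L" and l: "lev L > 0"
    and mem: "\<forall>x y. (x, y) \<in> L \<longleftrightarrow> (\<exists>q. y = int (lev L) * q \<and> int a dvd x - b * q)"
    by (rule lattice_basis[OF assms])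
  define \<phi> where "\<phi> = (\<lambda>(x, y). (int a * x + b * y, int (lev L) * y))"
  have "additive \<phi>" by (auto simp: additive_def \<phi>_def algebra_simps)
  moreover have "inj \<phi>" using a l by (auto simp: inj_def \<phi>_def)
  moreover have "range \<phi> = L"
  proof -
    have "(x, y) \<in> range \<phi> \<longleftrightarrow> (x, y) \<in> L" for x y
    proof -
      have "(x, y) \<in> range \<phi> \<longleftrightarrow> (\<exists>p q. x = int a * p + b * q \<and> y = int (lev L) * q)"
        by (auto simp: \<phi>_def image_iff)
      also have "\<dots> \<longleftrightarrow> (x, y) \<in> L"
        by (auto simp: mem dvd_def algebra_simps)
      finally show ?thesis .
    qed
    then show ?thesis by auto
  qed
  ultimately show ?thesis by (rule that)
qed

section \<open>Euclidean division of Eisenstein integers\<close>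

text \<open>Here \<open>\<omega>\<^sup>2 = - 1 - \<omega>\<close>, and \<open>cnorm\<close> is the squared absolute value.\<close>

definition cmul :: "eis \<Rightarrow> eis \<Rightarrow> eis"
  where "cmul = (\<lambda>(a, b) (c, d). (a * c - b * d, a * d + b * c - b * d))"

definition cnorm :: "eis \<Rightarrow> int"
  where "cnorm = (\<lambda>(a, b). a * a - a * b + b * b)"

lemma cnorm_cmul: "cnorm (cmul u v) = cnorm u * cnorm v"
  by (cases u; cases v) (simp add: cnorm_def cmul_def algebra_simps)

lemma cnorm_4: "4 * cnorm (a, b) = (2 * a - b)\<^sup>2 + 3 * b\<^sup>2"
  by (simp add: cnorm_def power2_eq_square algebra_simps)

lemma cnorm_pos: "v \<noteq> 0 \<Longrightarrow> cnorm v > 0"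
proof (cases v)
  case (Pair a b)
  assume "v \<noteq> 0"
  then have "(2 * a - b)\<^sup>2 + 3 * b\<^sup>2 > 0"
    by (cases "b = 0") (auto simp: Pair zero_prod_def add_nonneg_pos)
  then show ?thesis using cnorm_4[of a b] by (simp add: Pair)
qed

lemma additive_cmul: "additive (cmul u)"
  by (auto simp: additive_def cmul_def case_prod_unfold algebra_simps)

text \<open>The norm is multiplicative and positive away from 0, so there are no zero
  divisors.\<close>

lemma inj_cmul:
  assumes "u \<noteq> 0"
  shows "inj (cmul u)"
proof (rule injI)
  fix v w assume "cmul u v = cmul u w"
  then have "cmul u (v - w) = 0" by (simp add: additive.diff[OF additive_cmul])
  then have "cnorm u * cnorm (v - w) = cnorm 0" by (simp flip: cnorm_cmul)
  then have "cnorm u * cnorm (v - w) = 0" by (simp add: cnorm_def zero_prod_def)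
  then show "v = w" using cnorm_pos[OF assms] cnorm_pos[of "v - w"] by auto
qed

lemma cmul_rot: "cmul u (rot k v) = rot k (cmul u v)"
  by (cases u; cases v; cases k rule: mod6_cases) (simp_all add: rot_simps cmul_def algebra_simps)

text \<open>Rounding \<open>s / n\<close> to the nearest integer: adding one half before the floor
  gives the quotient by \<open>2 * n\<close>.\<close>

lemma nearest_quotient:
  fixes s n :: int
  assumes "n > 0"
  obtains x where "2 * \<bar>s - n * x\<bar> \<le> n"
proof -
  define x where "x = (2 * s + n) div (2 * n)"
  define M where "M = n * x"
  define A where "A = (2 * s + n) mod (2 * n)"
  have "A = 2 * s + n - 2 * M"
    by (simp only: minus_mult_div_eq_mod[symmetric] mult.assoc A_def M_def x_def)
  moreover have "0 \<le> A" "A < 2 * n" using assms by (auto simp: A_def)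
  ultimately have "2 * \<bar>s - M\<bar> \<le> n" by (cases "s \<le> M") auto
  then show ?thesis unfolding M_def by (rule that)
qed

text \<open>Multiplication by the conjugate of \<open>u\<close> turns division by \<open>u\<close>
  into division of both coordinates by the integer \<open>n\<close>. Rounding leaves coordinates of
  size at most \<open>n / 2\<close>, whose norm is at most three quarters of
  \<open>n * n\<close>.\<close>

lemma cmul_division:
  assumes u: "u \<noteq> 0"
  obtains q where "cnorm (v - cmul u q) < cnorm u"
proof -
  obtain a b where ab: "u = (a, b)" by force
  define n where "n = cnorm u"
  have n: "n > 0" using cnorm_pos[OF u] by (simp add: n_def)
  \<comment> \<open>The complex conjugate of \<open>a + b \<omega>\<close>, using
    \<open>\<omega>\<^sup>2 = - 1 - \<omega>\<close>.\<close>
  let ?cj = "(a - b, - b)"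
  obtain s t where st: "cmul ?cj v = (s, t)" by force
  obtain x where x: "2 * \<bar>s - n * x\<bar> \<le> n" using nearest_quotient[OF n] .
  obtain y where y: "2 * \<bar>t - n * y\<bar> \<le> n" using nearest_quotient[OF n] .
  define e f where ef: "e = s - n * x" "f = t - n * y"
  have cj: "cnorm ?cj = n" by (simp add: cnorm_def n_def ab algebra_simps)
  have "cmul ?cj (cmul u (x, y)) = (n * x, n * y)"
    by (simp add: cmul_def ab n_def cnorm_def algebra_simps)
  then have "cmul ?cj (v - cmul u (x, y)) = (e, f)"
    by (simp add: additive.diff[OF additive_cmul] st ef)
  then have "n * cnorm (v - cmul u (x, y)) = cnorm (e, f)"
    by (metis cnorm_cmul cj)
  also have "\<dots> < n * n"
  proof -
    have e: "\<bar>2 * e\<bar> \<le> n" and f: "\<bar>2 * f\<bar> \<le> n"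
      using x y unfolding ef[symmetric] by linarith+
    then have "(2 * e)\<^sup>2 \<le> n\<^sup>2" "(2 * f)\<^sup>2 \<le> n\<^sup>2"
      using abs_le_square_iff[of "2 * e" n] abs_le_square_iff[of "2 * f" n] n by auto
    \<comment> \<open>Writing eight times the norm as a sum of three squares, the cross term is
      bounded by \<open>n * n\<close>, so the total is at most \<open>6 * (n * n)\<close>.\<close>
    moreover have "(2 * e - 2 * f)\<^sup>2 + (2 * e)\<^sup>2 + (2 * f)\<^sup>2 = 8 * cnorm (e, f)"
      by (simp add: cnorm_def power2_eq_square algebra_simps)
    moreover have "\<bar>- (2 * e * (2 * f))\<bar> \<le> n * n"
      using mult_mono[OF e f] n by (simp add: abs_mult)
    moreover have "(2 * e - 2 * f)\<^sup>2 = (2 * e)\<^sup>2 + (2 * f)\<^sup>2 + 2 * - (2 * e * (2 * f))"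
      by (simp add: power2_eq_square algebra_simps)
    ultimately have "4 * (2 * cnorm (e, f)) \<le> 6 * (n * n)"
      unfolding power2_eq_square by linarith
    moreover have "n * n > 0" using n by simp
    ultimately show ?thesis by linarith
  qed
  finally show ?thesis using n that[of "(x, y)"] by (simp add: n_def)
qed

text \<open>The usual Euclidean argument: a nonzero element of least norm divides every other
  element.\<close>

lemma ideal_principal:
  assumes L: "sublat L" "lat_index L > 0" and r1: "rot 1 ` L = L"
  obtains u where "u \<noteq> 0" "range (cmul u) = L"
proof -
  have cl: "cmul v q \<in> L" if "v \<in> L" for v q
  proof -
    obtain a b where q: "q = (a, b)" by force
    have s: "(k * fst w, k * snd w) \<in> L" if "w \<in> L" for w k
      using sublat_pair_scale[OF L(1), of "fst w" "snd w"] that by simp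
    \<comment> \<open>Here \<open>rot 2\<close> is multiplication by \<omega>, so closure under all
      products follows from closure under \<omega> and integer combinations.\<close>
    have "rot 2 v \<in> L" using rot_image_ideal[OF r1, of 2] that by blast
    then have "(a * fst v, a * snd v) + (b * fst (rot 2 v), b * snd (rot 2 v)) \<in> L"
      using s that sublat_add[OF L(1)] by blast
    then show ?thesis by (cases v) (simp add: q rot_simps cmul_def algebra_simps)
  qed
  obtain a b where a: "a > 0" "lat_index L = lev L * a" "base L = {x. int a dvd x}"
    and b: "(b, int (lev L)) \<in> L" and l: "lev L > 0"
    and mem: "\<forall>x y. (x, y) \<in> L \<longleftrightarrow> (\<exists>q. y = int (lev L) * q \<and> int a dvd x - b * q)"
    by (rule lattice_basis[OF L])
  have "int a \<in> base L" by (simp add: a(3))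
  then have "(int a, 0) \<in> L \<and> (int a, 0) \<noteq> (0 :: eis)"
    using a(1) by (simp add: base_def zero_prod_def)
  then obtain u where u: "u \<in> L \<and> u \<noteq> 0"
    and least: "\<And>w. w \<in> L \<and> w \<noteq> 0 \<Longrightarrow> nat (cnorm u) \<le> nat (cnorm w)"
    using ex_has_least_nat[of "\<lambda>w. w \<in> L \<and> w \<noteq> 0" "(int a, 0)" "\<lambda>w. nat (cnorm w)"] by blast
  have "L \<subseteq> range (cmul u)"
  proof
    fix v assume v: "v \<in> L"
    obtain q where q: "cnorm (v - cmul u q) < cnorm u" using cmul_division u by blast
    have "v - cmul u q \<in> L" using sublat_diff[OF L(1) v] cl u by blast
    then have "v - cmul u q = 0" using least[of "v - cmul u q"] q cnorm_pos[of u] u by force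
    then show "v \<in> range (cmul u)" by auto
  qed
  then show ?thesis using that[of u] u cl by blast
qed

section \<open>Counting ideals\<close>

definition mult_fun :: "(nat \<Rightarrow> int) \<Rightarrow> bool"
  where "mult_fun f \<longleftrightarrow> f 1 = 1 \<and>
    (\<forall>a b. a > 0 \<longrightarrow> b > 0 \<longrightarrow> coprime a b \<longrightarrow> f (a * b) = f a * f b)"

definition dconv :: "(nat \<Rightarrow> int) \<Rightarrow> (nat \<Rightarrow> int) \<Rightarrow> nat \<Rightarrow> int"
  where "dconv f g n = (\<Sum>d | d dvd n. f d * g (n div d))"

lemma mult_funD:
  assumes "mult_fun f"
  shows "f 1 = 1" "a > 0 \<Longrightarrow> b > 0 \<Longrightarrow> coprime a b \<Longrightarrow> f (a * b) = f a * f b"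
  using assms by (auto simp: mult_fun_def)

text \<open>Strong induction: splitting off the full power of one prime divisor leaves a smaller
  coprime cofactor.\<close>

lemma mult_fun_eqI:
  assumes f: "mult_fun f" and g: "mult_fun g"
    and pp: "\<And>p k. Factorial_Ring.prime p \<Longrightarrow> f (p ^ k) = g (p ^ k)" and n: "n > 0"
  shows "f n = g n"
  using n
proof (induction n rule: less_induct)
  case (less n)
  show ?case
  proof (cases "n = 1")
    case True
    then show ?thesis using mult_funD(1)[OF f] mult_funD(1)[OF g] by simp
  next
    case False
    then obtain p where p: "Factorial_Ring.prime p" "p dvd n" using prime_factor_nat by blast
    obtain m where m: "n = p ^ multiplicity p n * m" "\<not> p dvd m"
      using multiplicity_decompose'[of n p] less.prems p(1) by (auto simp: prime_nat_iff)
    have m0: "m > 0" using m less.prems by (auto intro: ccontr)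
    have pk: "p ^ multiplicity p n > 1"
    proof -
    have "multiplicity p n \<noteq> 0" using m p(2) by (metis mult_1 power_0)
    then show ?thesis using prime_gt_1_nat[OF p(1)] by (intro one_less_power) auto
  qed
    have co: "coprime (p ^ multiplicity p n) m"
      using p(1) m(2) by (simp add: coprime_power_left_iff prime_imp_coprime)
    have "p ^ multiplicity p n * m > 1 * m" using pk m0 by (intro mult_strict_right_mono) auto
    then have "m < n" using m(1) by simp
    then have "f m = g m" using less.IH m0 by blast
    then show ?thesis
      using mult_funD(2)[OF f _ m0 co] mult_funD(2)[OF g _ m0 co] pp[OF p(1)] pk m(1) by (metis less_trans zero_less_one)
  qed
qed

text \<open>The factors of a divisor are recovered as its greatest common divisors with
  \<open>a\<close> and \<open>b\<close>.\<close>

lemma bij_betw_divisors_coprime: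
  assumes "coprime a b" "a > 0" "b > (0::nat)"
  shows "bij_betw (\<lambda>(x, y). x * y) ({d. d dvd a} \<times> {d. d dvd b}) {d. d dvd a * b}"
  unfolding bij_betw_def
proof
  have "gcd (x * y) a = x \<and> gcd (x * y) b = y" if "x dvd a" "y dvd b" for x y
  proof -
    have "coprime a y" "coprime b x"
      using coprime_divisors[OF dvd_refl that(2) assms(1)] coprime_divisors[OF that(1) dvd_refl assms(1)]
      by (simp_all add: coprime_commute)
    then show ?thesis
      using that by (simp add: gcd_mult_left_right_cancel gcd_mult_left_left_cancel gcd_nat.absorb1)
  qed
  then show "inj_on (\<lambda>(x, y). x * y) ({d. d dvd a} \<times> {d. d dvd b})"
    by (intro inj_on_inverseI[of _ "\<lambda>d. (gcd d a, gcd d b)"]) auto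
  show "(\<lambda>(x, y). x * y) ` ({d. d dvd a} \<times> {d. d dvd b}) = {d. d dvd a * b}"
  proof (intro equalityI subsetI)
    fix d assume "d \<in> {d. d dvd a * b}"
    then obtain x y where "d = x * y" "x dvd a" "y dvd b" using division_decomp by blast
    then show "d \<in> (\<lambda>(x, y). x * y) ` ({d. d dvd a} \<times> {d. d dvd b})"
      by (intro image_eqI[of _ _ "(x, y)"]) auto
  qed (auto intro: mult_dvd_mono)
qed

lemma mult_fun_dconv:
  assumes f: "mult_fun f" and g: "mult_fun g"
  shows "mult_fun (dconv f g)"
proof -
  have "dconv f g (a * b) = dconv f g a * dconv f g b" if ab: "a > 0" "b > 0" "coprime a b" for a b
  proof -
    have "dconv f g (a * b) = (\<Sum>p\<in>{d. d dvd a} \<times> {d. d dvd b}.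
        f (fst p * snd p) * g (a * b div (fst p * snd p)))"
      unfolding dconv_def sum.reindex_bij_betw[OF bij_betw_divisors_coprime[OF ab(3,1,2)], symmetric]
      by (simp add: case_prod_unfold)
    also have "\<dots> = (\<Sum>p\<in>{d. d dvd a} \<times> {d. d dvd b}.
        (f (fst p) * g (a div fst p)) * (f (snd p) * g (b div snd p)))"
    proof (rule sum.cong)
      fix p assume "p \<in> {d. d dvd a} \<times> {d. d dvd b}"
      then obtain x y u v where p: "p = (x, y)" and xu: "a = x * u" "b = y * v" by (auto elim!: dvdE)
      have pos: "x > 0" "y > 0" "u > 0" "v > 0" using ab xu by auto
      have co: "coprime x y" "coprime u v" using ab(3) by (auto simp: xu)
      have "a * b div (x * y) = u * v" "a div x = u" "b div y = v" using pos by (auto simp: xu)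
      then show "f (fst p * snd p) * g (a * b div (fst p * snd p)) =
        f (fst p) * g (a div fst p) * (f (snd p) * g (b div snd p))"
        using mult_funD(2)[OF f _ _ co(1)] mult_funD(2)[OF g _ _ co(2)] pos by (simp add: p)
    qed simp
    also have "\<dots> = dconv f g a * dconv f g b"
      by (simp add: dconv_def sum_product sum.cartesian_product case_prod_unfold)
    finally show ?thesis .
  qed
  moreover have "dconv f g 1 = 1"
    using mult_funD(1)[OF f] mult_funD(1)[OF g] by (simp add: dconv_def)
  ultimately show ?thesis by (simp add: mult_fun_def)
qed

lemma dconv_prime_power:
  assumes "Factorial_Ring.prime p"
  shows "dconv f g (p ^ k) = (\<Sum>i\<le>k. f (p ^ i) * g (p ^ (k - i)))"
proof -
  have p: "p > 1" using prime_gt_1_nat[OF assms] .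
  have "{d. d dvd p ^ k} = (\<lambda>i. p ^ i) ` {..k}"
    using divides_primepow_nat[OF assms] by auto
  moreover have "inj_on (\<lambda>i. p ^ i) {..k}" using p by (auto simp: inj_on_def)
  ultimately show ?thesis
    using p by (simp add: dconv_def sum.reindex power_diff)
qed

text \<open>The nontrivial Dirichlet character modulo 3, which describes how primes split in
  \<open>E\<close>.\<close>

definition chi :: "nat \<Rightarrow> int"
  where "chi k = Legendre (int k) 3"

lemma chi_eq: "chi k = (if k mod 3 = 0 then 0 else if k mod 3 = 1 then 1 else -1)"
proof -
  have "[int k = 0] (mod 3) \<longleftrightarrow> k mod 3 = 0"
    by (simp add: cong_def) presburger
  moreover have "QuadRes 3 (int k)" if "k mod 3 = 1"
  proof -
    have "int k mod 3 = 1" using that by presburger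
    then show ?thesis by (auto simp: QuadRes_def cong_def intro!: exI[of _ 1])
  qed
  moreover have "\<not> QuadRes 3 (int k)" if "k mod 3 = 2"
  proof
    assume "QuadRes 3 (int k)"
    then obtain y :: int where "y\<^sup>2 mod 3 = int k mod 3" by (auto simp: QuadRes_def cong_def)
    moreover have "int k mod 3 = 2" using that by presburger
    moreover have "y\<^sup>2 mod 3 = (y mod 3)\<^sup>2 mod 3" by (simp add: power_mod)
    moreover have "y mod 3 = 0 \<or> y mod 3 = 1 \<or> y mod 3 = 2" by presburger
    ultimately show False by auto
  qed
  moreover have "k mod 3 = 0 \<or> k mod 3 = 1 \<or> k mod 3 = 2" by presburger
  ultimately show ?thesis by (auto simp: chi_def Legendre_def)
qed

lemma chi_mult: "chi (a * b) = chi a * chi b"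
proof -
  have "a mod 3 = 0 \<or> a mod 3 = 1 \<or> a mod 3 = 2" "b mod 3 = 0 \<or> b mod 3 = 1 \<or> b mod 3 = 2"
    by presburger+
  moreover have *: "(a * b) mod 3 = ((a mod 3) * (b mod 3)) mod 3" by (simp add: mod_mult_eq)
  ultimately show ?thesis unfolding chi_eq * by (elim disjE) (simp_all only:, simp_all)
qed

lemma chi_power: "chi (p ^ k) = chi p ^ k"
  by (induction k) (simp_all add: chi_mult, simp add: chi_eq)

lemma mult_fun_chi: "mult_fun chi"
  by (simp add: mult_fun_def chi_mult) (simp add: chi_eq)

section \<open>Roots of X^2 - X + 1 modulo prime powers\<close>

lemma root_cong:
  fixes a x y :: int
  assumes "a dvd x - y"
  shows "a dvd x * x - x + 1 \<longleftrightarrow> a dvd y * y - y + 1"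
proof -
  have "x * x - x + 1 = (y * y - y + 1) + (x - y) * (x + y - 1)" by (simp add: algebra_simps)
  then show ?thesis using assms by (metis dvd_add_left_iff dvd_mult2)
qed

lemma dvd_mod_diff: "a dvd x mod a - (x :: int)" "a dvd x - x mod a"
  using mod_eq_dvd_iff[of "x mod a" a x] mod_eq_dvd_iff[of x a "x mod a"] by auto

lemma rho_1: "rho 1 = 1"
proof -
  have "{b \<in> {0..<int 1}. int 1 dvd b * b - b + 1} = {0}" by auto
  then show ?thesis by (simp only: rho_def) simp
qed

text \<open>The Chinese remainder theorem, applied to roots reduced modulo each factor.\<close>

lemma rho_mult:
  assumes co: "coprime m n" and pos: "m > 0" "n > 0"
  shows "rho (m * n) = rho m * rho n"
proof -
  let ?R = "\<lambda>a. {b \<in> {0..<int a}. int a dvd b * b - b + 1}"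
  let ?f = "\<lambda>x. (x mod int m, x mod int n)"
  have co': "coprime (int m) (int n)" using co by simp
  have bij: "bij_betw ?f (?R (m * n)) (?R m \<times> ?R n)"
    unfolding bij_betw_def
  proof (intro conjI equalityI subsetI)
    show "inj_on ?f (?R (m * n))"
    proof (rule inj_onI)
      fix x y assume x: "x \<in> ?R (m * n)" and y: "y \<in> ?R (m * n)" and "?f x = ?f y"
      then have "int m dvd x - y" "int n dvd x - y" by (auto simp: mod_eq_dvd_iff)
      then have "int m * int n dvd x - y" using co' by (rule divides_mult)
      then have "x mod (int m * int n) = y mod (int m * int n)" by (simp only: mod_eq_dvd_iff)
      then show "x = y" using x y by simp
    qed
  next
    fix p assume "p \<in> ?f ` ?R (m * n)"
    then obtain x where x: "p = ?f x" "int m * int n dvd x * x - x + 1" by auto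
    then have "int m dvd x * x - x + 1" "int n dvd x * x - x + 1"
      by (auto dest: dvd_mult_left dvd_mult_right)
    then show "p \<in> ?R m \<times> ?R n"
      using pos root_cong[OF dvd_mod_diff(1)] by (auto simp: x)
  next
    fix p assume p: "p \<in> ?R m \<times> ?R n"
    obtain u v where uv: "p = (u, v)" by force
    obtain x where x: "[x = u] (mod int m)" "[x = v] (mod int n)"
      using binary_chinese_remainder_int[OF co'] by blast
    let ?x = "x mod (int m * int n)"
    have d: "int m dvd x - u" "int n dvd x - v" using x by (auto simp: cong_iff_dvd_diff)
    have "int m dvd x * x - x + 1" "int n dvd x * x - x + 1"
      using p root_cong[OF d(1)] root_cong[OF d(2)] by (auto simp: uv)
    then have "int m * int n dvd x * x - x + 1" using co' by (rule divides_mult)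
    then have "int m * int n dvd ?x * ?x - ?x + 1" using root_cong[OF dvd_mod_diff(1)] by blast
    then have "?x \<in> ?R (m * n)" using pos by simp
    moreover have "p = ?f ?x"
      using p x by (auto simp: uv cong_def mod_mod_cancel)
    ultimately show "p \<in> ?f ` ?R (m * n)" by blast
  qed
  show ?thesis unfolding rho_def bij_betw_same_card[OF bij] by (rule card_cartesian_product)
qed

lemma mult_fun_rho: "mult_fun (\<lambda>n. int (rho n))"
  using rho_mult rho_1 by (simp add: mult_fun_def)

text \<open>The derivative \<open>2 * r - 1\<close> does not vanish at a root, because four times
  the polynomial minus the square of the derivative is 3, the negative of the discriminant.\<close>

lemma prime_root_not_both:
  fixes r :: int
  assumes p: "Factorial_Ring.prime (p::nat)" "p \<noteq> 3" and r: "int p dvd r * r - r + 1"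
  shows "\<not> int p dvd 2 * r - 1"
proof
  assume "int p dvd 2 * r - 1"
  then have "int p dvd 4 * (r * r - r + 1) - (2 * r - 1) * (2 * r - 1)"
    by (rule dvd_diff[OF dvd_mult[OF r] dvd_mult])
  also have "4 * (r * r - r + 1) - (2 * r - 1) * (2 * r - 1) = int 3" by (simp add: algebra_simps)
  finally have "p dvd 3" by (simp only: int_dvd_int_iff)
  moreover have "Factorial_Ring.prime (3::nat)" by simp
  ultimately show False using p primes_dvd_imp_eq by blast
qed

text \<open>Hensel lifting: away from 3 the derivative at a root is invertible modulo
  \<open>p\<close>.\<close>

lemma root_lift:
  assumes p: "Factorial_Ring.prime (p::nat)" "p \<noteq> 3" and r: "int (p ^ Suc k) dvd r * r - r + 1"
  shows "\<exists>s. int (p ^ Suc (Suc k)) dvd s * s - s + 1"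
proof -
  have "int p dvd r * r - r + 1" using r by (auto dest: dvd_mult_left)
  then have "\<not> int p dvd 2 * r - 1" by (rule prime_root_not_both[OF p])
  then have "coprime (2 * r - 1) (int p)"
    using p(1) by (metis coprime_commute prime_imp_coprime prime_nat_int_transfer)
  then obtain x where "[(2 * r - 1) * x = 1] (mod int p)" using cong_solve_coprime_int by blast
  then have x: "int p dvd 1 - (2 * r - 1) * x" by (metis cong_iff_dvd_diff cong_sym)
  obtain c where c: "r * r - r + 1 = int (p ^ Suc k) * c" using r by blast
  define P where "P = int (p ^ Suc k)"
  \<comment> \<open>The Newton step: \<open>c * P\<close> is the value at \<open>r\<close> and
    \<open>x\<close> inverts the derivative modulo \<open>p\<close>.\<close>
  let ?s = "r - c * x * P"
  have "?s * ?s - ?s + 1 = (r * r - r + 1) - (2 * r - 1) * x * c * P + c * x * c * x * P * P"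
    by (simp add: algebra_simps)
  also have "\<dots> = P * (c * (1 - (2 * r - 1) * x) + c * x * c * x * P)"
    unfolding c P_def[symmetric] by (simp add: algebra_simps)
  finally have *: "?s * ?s - ?s + 1 = P * (c * (1 - (2 * r - 1) * x) + c * x * c * x * P)" .
  have "int p dvd P" by (simp add: P_def)
  then have "int p dvd c * (1 - (2 * r - 1) * x) + c * x * c * x * P" using x by simp
  then have "P * int p dvd ?s * ?s - ?s + 1" unfolding * by (rule mult_dvd_mono[OF dvd_refl])
  then show ?thesis by (intro exI[of _ ?s]) (simp add: P_def mult.commute)
qed

text \<open>If 3 divides \<open>p - 1\<close>, there is a residue \<open>x\<close> of order 3. It is
  a root of \<open>X\<^sup>2 + X + 1\<close>, so \<open>- x\<close> is the required root.\<close>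

lemma prime_root_exists:
  assumes p: "Factorial_Ring.prime (p::nat)" "p mod 3 = 1"
  shows "\<exists>r. int p dvd r * r - r + 1"
proof -
  have "3 dvd p - 1" using p(2) by presburger
  then have "card {x \<in> totatives p. ord p x = 3} = totient 3"
    using prime_card_elements_with_ord_eq_totient[OF prime_gt_1_nat[OF p(1)] p(1), of 3] by simp
  moreover have "totient 3 \<noteq> (0::nat)" by simp
  ultimately have "{x \<in> totatives p. ord p x = 3} \<noteq> {}" by (metis card.empty)
  then obtain x where x: "ord p x = 3" by blast
  have "[x ^ 3 = 1] (mod p)" using x ord_divides[of x 3 p] by simp
  then have "[int x ^ 3 = 1] (mod int p)" by (metis cong_int_iff of_nat_power of_nat_1)
  then have "int p dvd int x ^ 3 - 1" by (simp add: cong_iff_dvd_diff)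
  also have "int x ^ 3 - 1 = (int x - 1) * (int x * int x + int x + 1)"
    by (simp add: algebra_simps power3_eq_cube)
  finally have "int p dvd (int x - 1) \<or> int p dvd (int x * int x + int x + 1)"
    using p(1) by (simp add: prime_dvd_mult_iff)
  moreover have "\<not> int p dvd int x - 1"
  proof
    assume "int p dvd int x - 1"
    then have "[int x = int 1] (mod int p)" by (simp add: cong_iff_dvd_diff)
    then have "[x ^ 1 = 1] (mod p)" by (simp only: cong_int_iff power_one_right)
    then have "ord p x dvd 1" by (simp only: ord_divides)
    then show False using x by simp
  qed
  ultimately show ?thesis by (intro exI[of _ "- int x"]) simp
qed

text \<open>The negative \<open>x\<close> of a root would satisfy \<open>x\<^sup>3 = 1\<close>. As
  \<open>p - 1\<close> is 1 modulo 3, Fermat's theorem forces \<open>x = 1\<close>, and then the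
  polynomial value is 3, which \<open>p\<close> does not divide.\<close>

lemma prime_root_not_exists:
  assumes p: "Factorial_Ring.prime (p::nat)" "p mod 3 = 2"
  shows "\<not> int p dvd r * r - r + 1"
proof
  assume r: "int p dvd r * r - r + 1"
  define x where "x = nat ((- r) mod int p)"
  have p0: "p > 0" using p(1) by (simp add: prime_gt_0_nat)
  have "[int x = - r] (mod int p)" using p0 by (simp add: x_def cong_def)
  then have xr: "int p dvd r - - int x" by (simp add: cong_iff_dvd_diff add.commute)
  then have root: "int p dvd (- int x) * (- int x) - (- int x) + 1" using r root_cong by blast
  have "int p dvd (int x - 1) * ((- int x) * (- int x) - (- int x) + 1)" using root by simp
  also have "(int x - 1) * ((- int x) * (- int x) - (- int x) + 1) = int x ^ 3 - 1"
    by (simp add: algebra_simps power3_eq_cube)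
  finally have "[int x ^ 3 = 1] (mod int p)" by (simp add: cong_iff_dvd_diff)
  then have x3: "[x ^ 3 = 1] (mod p)" by (metis cong_int_iff of_nat_power of_nat_1)
  have "\<not> p dvd x"
  proof
    assume "p dvd x"
    then have "int p dvd (- int x) * (- int x) - (- int x)" by simp
    then have "int p dvd 1" using root by (metis dvd_add_right_iff)
    then show False using p(1) by auto
  qed
  then have f: "[x ^ (p - 1) = 1] (mod p)" using fermat_theorem[OF p(1)] by blast
  have "p - 1 = 3 * (p div 3) + 1" using p(2) by presburger
  then have "x ^ (p - 1) = (x ^ 3) ^ (p div 3) * x" by (simp add: power_mult power_add)
  moreover have "[(x ^ 3) ^ (p div 3) * x = 1 ^ (p div 3) * x] (mod p)"
    by (intro cong_mult cong_pow x3 cong_refl)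
  ultimately have "[x = 1] (mod p)" using f by (simp add: cong_def)
  then have "[int x = int 1] (mod int p)" by (simp only: cong_int_iff)
  then have "int p dvd int x - 1" by (simp add: cong_iff_dvd_diff)
  then have "int p dvd (int x - 1) * (int x + 2)" by simp
  then have "int p dvd ((- int x) * (- int x) - (- int x) + 1) - (int x - 1) * (int x + 2)"
    using root by (rule dvd_diff[rotated])
  also have "((- int x) * (- int x) - (- int x) + 1) - (int x - 1) * (int x + 2) = int 3"
    by (simp add: algebra_simps)
  finally have "p dvd 3" by (simp only: int_dvd_int_iff)
  moreover have "Factorial_Ring.prime (3::nat)" by simp
  ultimately have "p = 3" using p(1) primes_dvd_imp_eq by blast
  then show False using p(2) by simp
qed

text \<open>The roots are a lifted root \<open>r\<close> and its companion \<open>1 - r\<close>.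
  They differ modulo \<open>p\<close>, so for any root \<open>s\<close> only one of the factors
  \<open>s - r\<close> and \<open>s - (1 - r)\<close> can be divisible by \<open>p\<close> and it
  absorbs the whole prime power.\<close>

lemma rho_split:
  assumes p: "Factorial_Ring.prime p" "p mod 3 = 1"
  shows "rho (p ^ Suc k) = 2"
proof -
  have p3: "p \<noteq> 3" using p(2) by auto
  let ?q = "int (p ^ Suc k)"
  have "\<exists>r. ?q dvd r * r - r + 1"
  proof (induction k)
    case 0
    then show ?case using prime_root_exists[OF p] by simp
  next
    case (Suc k)
    then show ?case using root_lift[OF p(1) p3] by blast
  qed
  then obtain r where r: "?q dvd r * r - r + 1" by blast
  have pq: "int p dvd ?q" by simp
  have q0: "?q > 0" using p(1) by (simp add: prime_gt_0_nat)
  have pr: "int p dvd r * r - r + 1" using pq r dvd_trans by blast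
  have "{b \<in> {0..<?q}. ?q dvd b * b - b + 1} = {r mod ?q, (1 - r) mod ?q}"
  proof (intro equalityI subsetI)
    fix s assume s: "s \<in> {b \<in> {0..<?q}. ?q dvd b * b - b + 1}"
    have "(s * s - s + 1) - (r * r - r + 1) = (s - r) * (s - (1 - r))" by (simp add: algebra_simps)
    then have d: "?q dvd (s - r) * (s - (1 - r))" using s r by (metis (no_types, lifting) dvd_diff mem_Collect_eq)
    have "?q dvd s - r \<or> ?q dvd s - (1 - r)"
    proof (cases "int p dvd s - r")
      case True
      have "\<not> int p dvd s - (1 - r)"
      proof
        assume "int p dvd s - (1 - r)"
        then have "int p dvd (s - (1 - r)) - (s - r)" using True by (rule dvd_diff)
        then show False using prime_root_not_both[OF p(1) p3 pr] by simp
      qed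
      then have "coprime ?q (s - (1 - r))"
        using p(1) by (simp add: coprime_power_left_iff prime_imp_coprime)
      then show ?thesis using d by (metis coprime_dvd_mult_left_iff)
    next
      case False
      then have "coprime ?q (s - r)"
        using p(1) by (simp add: coprime_power_left_iff prime_imp_coprime)
      then show ?thesis using d by (metis coprime_dvd_mult_right_iff)
    qed
    then have "s mod ?q = r mod ?q \<or> s mod ?q = (1 - r) mod ?q" by (simp only: mod_eq_dvd_iff)
    moreover have "s mod ?q = s" using s by simp
    ultimately show "s \<in> {r mod ?q, (1 - r) mod ?q}" by auto
  next
    fix s assume "s \<in> {r mod ?q, (1 - r) mod ?q}"
    moreover have "?q dvd (1 - r) * (1 - r) - (1 - r) + 1" using r by (simp add: algebra_simps)
    ultimately have "?q dvd s * s - s + 1" using r root_cong[OF dvd_mod_diff(1)] by blast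
    moreover have "s \<in> {0..<?q}" using \<open>s \<in> _\<close> pos_mod_bound[OF q0] pos_mod_sign[OF q0] by auto
    ultimately show "s \<in> {b \<in> {0..<?q}. ?q dvd b * b - b + 1}" by blast
  qed
  moreover have "r mod ?q \<noteq> (1 - r) mod ?q"
  proof
    assume "r mod ?q = (1 - r) mod ?q"
    then have "?q dvd r - (1 - r)" by (simp only: mod_eq_dvd_iff)
    then have "int p dvd r - (1 - r)" using pq dvd_trans by blast
    then show False using prime_root_not_both[OF p(1) p3 pr] by simp
  qed
  ultimately show ?thesis unfolding rho_def by (simp only: card_2_iff) blast
qed

lemma rho_inert:
  assumes p: "Factorial_Ring.prime p" "p mod 3 = 2"
  shows "rho (p ^ Suc k) = 0"
proof -
  have "\<not> int (p ^ Suc k) dvd b * b - b + 1" for b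
    using prime_root_not_exists[OF p, of b] by (auto dest: dvd_mult_left)
  then show ?thesis unfolding rho_def by (metis (no_types, lifting) card.empty empty_Collect_eq)
qed

lemma rho_3: "rho 3 = 1"
proof -
  have "{b \<in> {0..<int 3}. int 3 dvd b * b - b + 1} = {2}"
  proof (intro equalityI subsetI)
    fix b assume b: "b \<in> {b \<in> {0..<int 3}. int 3 dvd b * b - b + 1}"
    then have "b = 0 \<or> b = 1 \<or> b = 2" by auto
    then show "b \<in> {2}" using b by auto
  qed auto
  then show ?thesis by (simp only: rho_def) simp
qed

text \<open>The ramified prime: the root 2 modulo 3 does not lift to modulus 9, as the nine residues
  show.\<close>

lemma rho_9_power: "rho (3 ^ Suc (Suc k)) = 0"
proof -
  have "\<not> 9 dvd b * b - b + 1" for b :: int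
  proof
    assume "9 dvd b * b - b + 1"
    then have *: "9 dvd (b mod 9) * (b mod 9) - b mod 9 + 1" using root_cong[OF dvd_mod_diff(1), of 9 b] by blast
    have "b mod 9 \<in> {0..<9}" by simp
    then have "b mod 9 \<in> {0, 1, 2, 3, 4, 5, 6, 7, 8}" by auto
    then show False using * by auto
  qed
  moreover have "9 dvd int (3 ^ Suc (Suc k))" by simp
  ultimately have "\<not> int (3 ^ Suc (Suc k)) dvd b * b - b + 1" for b using dvd_trans by blast
  then show ?thesis unfolding rho_def by (metis (no_types, lifting) card.empty empty_Collect_eq)
qed

text \<open>Turns the sum over \<open>d\<close> with \<open>d\<^sup>2\<close> dividing
  \<open>m\<close> into a Dirichlet convolution, so that multiplicativity reduces it to prime
  powers.\<close>

definition ind_square :: "nat \<Rightarrow> int"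
  where "ind_square e = of_bool (is_nth_power 2 e)"

lemma mult_fun_ind_square: "mult_fun ind_square"
  by (auto simp: mult_fun_def ind_square_def is_nth_power_mult_coprime_nat_iff)

lemma ind_square_prime_power: "Factorial_Ring.prime p \<Longrightarrow> ind_square (p ^ i) = of_bool (even i)"
  by (simp add: ind_square_def is_nth_power_prime_power_nat_iff)

text \<open>Both sides are multiplicative. At the \<open>k\<close>-th power of a prime they are 1
  for the prime 3, \<open>k + 1\<close> for a split prime, and 1 or 0 for an inert prime according
  as \<open>k\<close> is even or odd.\<close>

lemma sum_rho_eq_sum_chi:
  assumes m: "m > 0"
  shows "(\<Sum>d | d\<^sup>2 dvd m. int (rho (m div d\<^sup>2))) = (\<Sum>k | k dvd m. chi k)"
proof -
  let ?r = "\<lambda>n. int (rho n)"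
  have "dconv ind_square ?r m = dconv chi (\<lambda>_. 1) m"
  proof (rule mult_fun_eqI)
    show "mult_fun (dconv ind_square ?r)" "mult_fun (dconv chi (\<lambda>_. 1))"
      by (rule mult_fun_dconv; simp add: mult_fun_ind_square mult_fun_rho mult_fun_chi mult_fun_def[of "\<lambda>_. 1"])+
  next
    fix p k :: nat assume p: "Factorial_Ring.prime p"
    \<comment> \<open>The term \<open>i = k\<close> is separated because \<open>rho 1 = 1\<close>
      whatever the prime, while the other values depend on its splitting behaviour.\<close>
    have lhs: "dconv ind_square ?r (p ^ k) = (\<Sum>i<k. of_bool (even i) * ?r (p ^ (k - i))) + of_bool (even k)"
      using rho_1 by (simp add: dconv_prime_power[OF p] ind_square_prime_power[OF p] lessThan_Suc_atMost[symmetric])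
    have rhs: "dconv chi (\<lambda>_. 1) (p ^ k) = (\<Sum>i\<le>k. chi p ^ i)"
      by (simp add: dconv_prime_power[OF p] chi_power)
    have "p mod 3 = 0 \<or> p mod 3 = 1 \<or> p mod 3 = 2" by presburger
    moreover have "p = 3" if "p mod 3 = 0"
    proof -
      have "3 dvd p" using that by presburger
      moreover have "Factorial_Ring.prime (3::nat)" by simp
      ultimately show ?thesis using p primes_dvd_imp_eq by blast
    qed
    ultimately consider "p = 3" | "p mod 3 = 1" | "p mod 3 = 2" by metis
    then show "dconv ind_square ?r (p ^ k) = dconv chi (\<lambda>_. 1) (p ^ k)"
    proof cases
      case 1
      have "(\<Sum>i\<le>k. chi p ^ i) = 1"
        by (induction k) (simp_all add: 1 chi_eq)
      moreover have "(\<Sum>i<k. of_bool (even i) * ?r (p ^ (k - i))) = of_bool (odd k)"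
      proof (cases k)
        case (Suc j)
        \<comment> \<open>For the prime 3 only exponent difference 1 contributes, that is
          \<open>i = k - 1\<close>, which is even exactly for odd \<open>k\<close>.\<close>
        have "(\<Sum>i<j. of_bool (even i) * ?r (p ^ (k - i))) = 0"
        proof (rule sum.neutral, rule ballI)
          fix i assume "i \<in> {..<j}"
          then obtain e where "k - i = Suc (Suc e)" using Suc by (metis Suc_diff_Suc Suc_diff_le lessThan_iff less_imp_le_nat)
          then show "of_bool (even i) * ?r (p ^ (k - i)) = 0" using rho_9_power[of e] 1 by simp
        qed
        then show ?thesis using rho_3 1 by (simp add: Suc)
      qed simp
      ultimately show ?thesis by (simp add: lhs rhs)
    next
      case 2
      have "(\<Sum>i<k. of_bool (even i) * ?r (p ^ (k - i))) = (\<Sum>i<k. of_bool (even i) * 2)"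
      proof (rule sum.cong)
        fix i assume "i \<in> {..<k}"
        then obtain e where "k - i = Suc e" by (metis Suc_diff_Suc lessThan_iff)
        then show "of_bool (even i) * ?r (p ^ (k - i)) = of_bool (even i) * 2"
          using rho_split[OF p 2, of e] by simp
      qed simp
      moreover have "(\<Sum>i<k. of_bool (even i) * 2) = int k + of_bool (odd k)"
        by (induction k) auto
      moreover have "(\<Sum>i\<le>k. chi p ^ i) = int k + 1"
        using 2 by (simp add: chi_eq)
      ultimately show ?thesis by (simp add: lhs rhs)
    next
      case 3
      have "(\<Sum>i<k. of_bool (even i) * ?r (p ^ (k - i))) = 0"
      proof (rule sum.neutral, rule ballI)
        fix i assume "i \<in> {..<k}"
        then obtain e where "k - i = Suc e" by (metis Suc_diff_Suc lessThan_iff)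
        then show "of_bool (even i) * ?r (p ^ (k - i)) = 0"
          using rho_inert[OF p 3, of e] by simp
      qed
      moreover have "(\<Sum>i\<le>k. chi p ^ i) = of_bool (even k)"
        using 3 by (induction k) (auto simp: chi_eq)
      ultimately show ?thesis by (simp add: lhs rhs)
    qed
  qed (rule m)
  moreover have "dconv ind_square ?r m = (\<Sum>d | d\<^sup>2 dvd m. int (rho (m div d\<^sup>2)))"
  proof -
    have "dconv ind_square ?r m = (\<Sum>e\<in>{e. e dvd m \<and> is_nth_power 2 e}. ?r (m div e))"
      unfolding dconv_def using m
      by (intro sum.mono_neutral_cong_right) (auto simp: ind_square_def)
    also have "\<dots> = (\<Sum>d | d\<^sup>2 dvd m. ?r (m div d\<^sup>2))"
      by (rule sum.reindex_bij_betw[of "\<lambda>d. d\<^sup>2", symmetric])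
        (auto simp: bij_betw_def inj_on_def is_nth_power_def)
    finally show ?thesis .
  qed
  ultimately show ?thesis by (simp add: dconv_def)
qed

section \<open>Normal forms in the fundamental groups\<close>

context group
begin

lemma int_pow_commute:
  assumes "x \<in> carrier G" "y \<in> carrier G" "x \<otimes> y = y \<otimes> x"
  shows "x [^] (i::int) \<otimes> y [^] (j::int) = y [^] j \<otimes> x [^] i"
proof -
  have *: "u [^] i \<otimes> v = v \<otimes> u [^] i" if "u \<in> carrier G" "v \<in> carrier G" "u \<otimes> v = v \<otimes> u" for u v and i :: int
  proof (induction i rule: int_induct[of _ 0])
    case base
    then show ?case using that by simp
  next
    case (step1 i)
    have "u [^] (i + 1) \<otimes> v = u [^] i \<otimes> (u \<otimes> v)" using that by (simp add: int_pow_mult m_assoc)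
    also have "\<dots> = (u [^] i \<otimes> v) \<otimes> u" using that by (simp add: m_assoc)
    also have "\<dots> = v \<otimes> u [^] (i + 1)" using that step1 by (simp add: int_pow_mult m_assoc)
    finally show ?case .
  next
    case (step2 i)
    have iv: "inv u \<otimes> v = v \<otimes> inv u"
      using that by (metis inv_closed inv_solve_left' inv_solve_right m_assoc m_closed)
    have p: "u [^] (i - 1) = u [^] i \<otimes> inv u"
      using int_pow_mult[OF that(1), of i "-1"] that by (simp add: int_pow_neg)
    have "u [^] (i - 1) \<otimes> v = (u [^] i \<otimes> v) \<otimes> inv u" using that iv by (simp add: p m_assoc)
    also have "\<dots> = v \<otimes> u [^] (i - 1)" using that step2 by (simp add: p m_assoc)
    finally show ?case .
  qed
  show ?thesis using *[of y "x [^] i" j] *[of x y i] assms by simp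
qed

text \<open>The relations let \<open>z\<close> be moved past \<open>x\<close> and \<open>y\<close>;
  this determines how \<open>z\<close> acts on all products of powers, hence how its powers act. No
  presentation enters, only three elements of a group that satisfy the relations.\<close>

lemma sdp_hom:
  fixes t :: int
  assumes x: "x \<in> carrier G" and y: "y \<in> carrier G" and z: "z \<in> carrier G"
    and xy: "x \<otimes> y = y \<otimes> x"
    and zx: "z \<otimes> x = x [^] fst (rot t (1, 0)) \<otimes> y [^] snd (rot t (1, 0)) \<otimes> z"
    and zy: "z \<otimes> y = x [^] fst (rot t (0, 1)) \<otimes> y [^] snd (rot t (0, 1)) \<otimes> z"
  shows "(\<lambda>((a, b), k). x [^] a \<otimes> y [^] b \<otimes> z [^] k) \<in> hom (sdp (\<lambda>k. rot (t * k))) G"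
proof -
  define h where "h v = x [^] fst v \<otimes> y [^] snd v" for v :: "eis"
  have h_carr [simp]: "h v \<in> carrier G" for v using x y by (simp add: h_def)
  have h_add: "h (v + w) = h v \<otimes> h w" for v w
  proof -
    have "x [^] fst w \<otimes> y [^] snd v = y [^] snd v \<otimes> x [^] fst w" by (rule int_pow_commute[OF x y xy])
    then have "h v \<otimes> h w = x [^] fst v \<otimes> (x [^] fst w \<otimes> y [^] snd v) \<otimes> y [^] snd w"
      using x y by (simp add: h_def m_assoc)
    then show ?thesis using x y by (simp add: h_def m_assoc int_pow_mult)
  qed
  have h_0: "h 0 = \<one>" by (simp add: h_def)
  have h_minus: "h (- v) = inv (h v)" for v
    using h_add[of "- v" v] h_0 by (intro inv_equality[symmetric]) auto
  \<comment> \<open>The vectors on which conjugation by \<open>z\<close> agrees with the rotation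
    form a subgroup, so it is enough to check the two basis vectors.\<close>
  define P where "P v \<longleftrightarrow> z \<otimes> h v = h (rot t v) \<otimes> z" for v
  have P_add: "P (v + w)" if "P v" "P w" for v w
  proof -
    have "z \<otimes> h (v + w) = (z \<otimes> h v) \<otimes> h w" using z by (simp add: h_add m_assoc)
    also have "\<dots> = h (rot t v) \<otimes> (z \<otimes> h w)" using that z by (simp add: P_def m_assoc)
    also have "\<dots> = h (rot t (v + w)) \<otimes> z" using that z by (simp add: P_def m_assoc rot_plus h_add)
    finally show ?thesis by (simp add: P_def)
  qed
  have P_minus: "P (- v)" if "P v" for v
  proof -
    have "z \<otimes> h v = h (rot t v) \<otimes> z" using that by (simp add: P_def)
    then have "inv (h (rot t v)) \<otimes> z = z \<otimes> inv (h v)"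
      using z by (metis h_carr inv_closed inv_solve_left' inv_solve_right m_assoc m_closed)
    then show ?thesis by (simp add: P_def h_minus rot.act_minus)
  qed
  have P_0: "P 0" using z by (simp add: P_def h_0)
  have h10: "h (1, 0) = x" and h01: "h (0, 1) = y"
    using x y by (simp_all add: h_def)
  have P1: "P (1, 0)" and P2: "P (0, 1)" unfolding P_def h10 h01 unfolding h_def by (fact zx, fact zy)
  have Pm: "P (k * fst v, k * snd v)" if v: "P v" for k :: int and v
  proof (induction k rule: int_induct[of _ 0])
    case base
    then show ?case using P_0 by (simp add: zero_prod_def)
  next
    case (step1 k)
    then show ?case using P_add[OF _ v] by (cases v) (force simp: distrib_right)
  next
    case (step2 k)
    then show ?case using P_add[OF _ P_minus[OF v]] by (cases v) (force simp: left_diff_distrib)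
  qed
  have P: "P v" for v
    using P_add[OF Pm[OF P1, of "fst v"] Pm[OF P2, of "snd v"]] by simp
  have zk: "z [^] k \<otimes> h v = h (rot (t * k) v) \<otimes> z [^] k" for k v
  proof (induction k arbitrary: v rule: int_induct[of _ 0])
    case base
    then show ?case by simp
  next
    case (step1 k)
    have "z [^] (k + 1) \<otimes> h v = z [^] k \<otimes> (z \<otimes> h v)" using z by (simp add: int_pow_mult m_assoc)
    also have "\<dots> = (z [^] k \<otimes> h (rot t v)) \<otimes> z" using P[of v] z by (simp add: P_def m_assoc)
    also have "\<dots> = h (rot (t * (k + 1)) v) \<otimes> z [^] (k + 1)"
      using z step1 by (simp add: m_assoc int_pow_mult distrib_left rot_add)
    finally show ?case .
  next
    case (step2 k)
    have p: "z [^] (k - 1) = z [^] k \<otimes> inv z"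
      using int_pow_mult[OF z, of k "-1"] z by (simp add: int_pow_neg)
    have "z \<otimes> h (rot (- t) v) = h v \<otimes> z" using P[of "rot (- t) v"] by (simp add: P_def)
    then have iz: "inv z \<otimes> h v = h (rot (- t) v) \<otimes> inv z"
      using z by (metis h_carr inv_closed inv_solve_left' inv_solve_right m_assoc m_closed)
    have "z [^] (k - 1) \<otimes> h v = (z [^] k \<otimes> h (rot (- t) v)) \<otimes> inv z"
      using z by (simp add: p m_assoc iz)
    also have "\<dots> = h (rot (t * k) (rot (- t) v)) \<otimes> z [^] (k - 1)"
      using z step2 by (simp add: p m_assoc)
    also have "rot (t * k) (rot (- t) v) = rot (t * (k - 1)) v"
      by (simp add: right_diff_distrib flip: rot_add)
    finally show ?case .
  qed
  have f: "(\<lambda>((a, b), k). x [^] a \<otimes> y [^] b \<otimes> z [^] k) = (\<lambda>(v, k). h v \<otimes> z [^] k)"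
    by (auto simp: h_def)
  show ?thesis
    unfolding f
  proof (rule homI)
    fix g g' :: "eis \<times> int"
    obtain v k w j where g: "g = (v, k)" "g' = (w, j)" by (metis surj_pair)
    have "(h v \<otimes> z [^] k) \<otimes> (h w \<otimes> z [^] j) = h v \<otimes> (z [^] k \<otimes> h w) \<otimes> z [^] j"
      using z by (simp add: m_assoc)
    also have "\<dots> = h (v + rot (t * k) w) \<otimes> z [^] (k + j)"
      using z by (simp add: zk m_assoc h_add int_pow_mult)
    finally show "(case g \<otimes>\<^bsub>sdp (\<lambda>k. rot (t * k))\<^esub> g' of (v, k) \<Rightarrow> h v \<otimes> z [^] k) =
      (case g of (v, k) \<Rightarrow> h v \<otimes> z [^] k) \<otimes> (case g' of (v, k) \<Rightarrow> h v \<otimes> z [^] k)"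
      by (simp add: g)
  qed (use z in auto)
qed

end

section \<open>Evaluation of words and the presented groups\<close>

fun word_eval :: "('b, 'c) monoid_scheme \<Rightarrow> ('a \<Rightarrow> 'b) \<Rightarrow> 'a word \<Rightarrow> 'b"
  where "word_eval G g [] = \<one>\<^bsub>G\<^esub>"
  | "word_eval G g ((a, s) # w) = (if s then g a else inv\<^bsub>G\<^esub> g a) \<otimes>\<^bsub>G\<^esub> word_eval G g w"

lemma (in group) word_eval_closed:
  "(\<And>a. g a \<in> carrier G) \<Longrightarrow> word_eval G g w \<in> carrier G"
  by (induction w) auto

lemma (in group) word_eval_append:
  "(\<And>a. g a \<in> carrier G) \<Longrightarrow> word_eval G g (v @ w) = word_eval G g v \<otimes> word_eval G g w"
  by (induction v) (auto simp: word_eval_closed m_assoc)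

text \<open>Von Dyck's principle: if the relations hold for chosen images of the generators,
  evaluation is well defined on word classes.\<close>

lemma (in group) word_eval_eq:
  assumes g: "\<And>a. g a \<in> carrier G"
    and R: "\<And>u v. (u, v) \<in> R \<Longrightarrow> word_eval G g u = word_eval G g v"
    and "word_eq R u v"
  shows "word_eval G g u = word_eval G g v"
  using assms(3) by induction (auto simp: R g word_eval_append)

lemma rot_pw:
  "int_action.pw (\<lambda>k. rot (t * k)) (1, 0) 0 a = (a, 0)"
  "int_action.pw (\<lambda>k. rot (t * k)) (0, 1) 0 a = (0, a)"
  "int_action.pw (\<lambda>k. rot (t * k)) 0 1 a = 0"
proof -
  interpret H: int_action "\<lambda>k. rot (t * k)" by (rule rot_power)
  show "H.pw (1, 0) 0 a = (a, 0)"
    by (induction a rule: int_induct[of _ 0]) (use H.pw_add[of "(1, 0)" 0 _ 1] H.pw_add[of "(1, 0)" 0 _ "-1"] in \<open>auto simp: zero_prod_def H.pw_minus\<close>)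
  show "H.pw (0, 1) 0 a = (0, a)"
    by (induction a rule: int_induct[of _ 0]) (use H.pw_add[of "(0, 1)" 0 _ 1] H.pw_add[of "(0, 1)" 0 _ "-1"] in \<open>auto simp: zero_prod_def H.pw_minus\<close>)
  show "H.pw 0 1 a = 0"
    by (induction a rule: int_induct[of _ 0]) (use H.pw_add[of 0 1 _ 1] H.pw_add[of 0 1 _ "-1"] in \<open>auto simp: H.pw_minus\<close>)
qed

text \<open>Normal forms give a homomorphism from the semidirect product onto the presented group,
  as its range contains the generators. Evaluating words in the semidirect product undoes it, so no
  normal form collapses. The right-hand sides \<open>U\<close> and \<open>V\<close> stay parameters
  to serve all three groups.\<close>

lemma presented_group_iso_sdp:
  fixes t :: int and U V :: "gen word"
  defines "R \<equiv> {(x\<^sub>w @ y\<^sub>w @ word_inv x\<^sub>w @ word_inv y\<^sub>w, []), (z\<^sub>w @ x\<^sub>w @ word_inv z\<^sub>w, U), (z\<^sub>w @ y\<^sub>w @ word_inv z\<^sub>w, V)}"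
  defines "P \<equiv> presented_group R"
  defines "cx \<equiv> Collect (word_eq R x\<^sub>w)" and "cy \<equiv> Collect (word_eq R y\<^sub>w)"
  assumes U: "Collect (word_eq R U) = cx [^]\<^bsub>P\<^esub> fst (rot t (1, 0)) \<otimes>\<^bsub>P\<^esub> cy [^]\<^bsub>P\<^esub> snd (rot t (1, 0))"
    and V: "Collect (word_eq R V) = cx [^]\<^bsub>P\<^esub> fst (rot t (0, 1)) \<otimes>\<^bsub>P\<^esub> cy [^]\<^bsub>P\<^esub> snd (rot t (0, 1))"
    and eval_U: "word_eval (sdp (\<lambda>k. rot (t * k))) (case_gen ((1, 0), 0) ((0, 1), 0) ((0, 0), 1)) U = (rot t (1, 0), 0)"
    and eval_V: "word_eval (sdp (\<lambda>k. rot (t * k))) (case_gen ((1, 0), 0) ((0, 1), 0) ((0, 0), 1)) V = (rot t (0, 1), 0)"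
  shows "P \<cong> sdp (\<lambda>k. rot (t * k))"
proof -
  interpret P: group P unfolding P_def by (rule group_presented_group)
  interpret H: int_action "\<lambda>k. rot (t * k)" by (rule rot_power)
  let ?H = "sdp (\<lambda>k. rot (t * k))"
  let ?g = "case_gen ((1, 0), 0) ((0, 1), 0) ((0, 0), 1) :: gen \<Rightarrow> eis \<times> int"
  define c where "c = (\<lambda>w. Collect (word_eq R w))"
  define cz where "cz = c z\<^sub>w"
  have c_carr [simp]: "c w \<in> carrier P" for w unfolding P_def c_def presented_group_carrier by blast
  have c_mult: "c u \<otimes>\<^bsub>P\<^esub> c v = c (u @ v)" for u v by (simp add: P_def c_def presented_group_mult)
  have c_one: "\<one>\<^bsub>P\<^esub> = c []" by (simp add: P_def c_def presented_group_one)
  have c_inv: "inv\<^bsub>P\<^esub> c w = c (word_inv w)" for w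
  proof (rule P.inv_equality)
    show "c (word_inv w) \<otimes>\<^bsub>P\<^esub> c w = \<one>\<^bsub>P\<^esub>"
      unfolding c_mult c_one unfolding c_def word_class_eq_iff by (rule word_eq_inv_left)
  qed simp_all
  have c_rel: "c u = c v" if "(u, v) \<in> R" for u v
    unfolding c_def word_class_eq_iff using that by (rule word_eq.rel)
  have cxy: "cx = c x\<^sub>w" "cy = c y\<^sub>w" by (simp_all add: cx_def cy_def c_def)
  have "cx \<otimes>\<^bsub>P\<^esub> cy \<otimes>\<^bsub>P\<^esub> (inv\<^bsub>P\<^esub> cx \<otimes>\<^bsub>P\<^esub> inv\<^bsub>P\<^esub> cy) = \<one>\<^bsub>P\<^esub>"
    unfolding cxy c_inv c_mult c_one by (rule c_rel) (simp add: R_def)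
  then have xy: "cx \<otimes>\<^bsub>P\<^esub> cy = cy \<otimes>\<^bsub>P\<^esub> cx"
    by (metis P.inv_closed P.inv_mult_group P.inv_unique' P.inv_inv P.m_closed cxy c_carr P.inv_equality)
  have "cz \<otimes>\<^bsub>P\<^esub> cx \<otimes>\<^bsub>P\<^esub> inv\<^bsub>P\<^esub> cz = c U" "cz \<otimes>\<^bsub>P\<^esub> cy \<otimes>\<^bsub>P\<^esub> inv\<^bsub>P\<^esub> cz = c V"
    unfolding cxy cz_def c_inv c_mult append_assoc by (rule c_rel; simp add: R_def)+
  then have "cz \<otimes>\<^bsub>P\<^esub> cx = c U \<otimes>\<^bsub>P\<^esub> cz" "cz \<otimes>\<^bsub>P\<^esub> cy = c V \<otimes>\<^bsub>P\<^esub> cz"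
    by (metis P.inv_solve_right P.m_closed cxy cz_def c_carr)+
  then have zx: "cz \<otimes>\<^bsub>P\<^esub> cx = cx [^]\<^bsub>P\<^esub> fst (rot t (1, 0)) \<otimes>\<^bsub>P\<^esub> cy [^]\<^bsub>P\<^esub> snd (rot t (1, 0)) \<otimes>\<^bsub>P\<^esub> cz"
    and zy: "cz \<otimes>\<^bsub>P\<^esub> cy = cx [^]\<^bsub>P\<^esub> fst (rot t (0, 1)) \<otimes>\<^bsub>P\<^esub> cy [^]\<^bsub>P\<^esub> snd (rot t (0, 1)) \<otimes>\<^bsub>P\<^esub> cz"
    unfolding U[symmetric] V[symmetric] by (simp_all only: c_def)
  let ?f = "\<lambda>((a :: int, b :: int), k :: int). cx [^]\<^bsub>P\<^esub> a \<otimes>\<^bsub>P\<^esub> cy [^]\<^bsub>P\<^esub> b \<otimes>\<^bsub>P\<^esub> cz [^]\<^bsub>P\<^esub> k"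
  have carr: "cx \<in> carrier P" "cy \<in> carrier P" "cz \<in> carrier P" by (simp_all add: cxy cz_def)
  have f: "?f \<in> hom ?H P" by (rule P.sdp_hom[OF carr xy zx zy])
  then interpret f: group_hom ?H P ?f by unfold_locales
  have inv_gen: "inv\<^bsub>?H\<^esub> ?g a \<in> carrier ?H" "?g a \<in> carrier ?H" for a by simp_all
  have eval: "word_eval ?H ?g u = word_eval ?H ?g v" if "word_eq R u v" for u v
  proof (rule H.sdp.word_eval_eq[OF inv_gen(2) _ that])
    fix u v assume "(u, v) \<in> R"
    then show "word_eval ?H ?g u = word_eval ?H ?g v"
      unfolding R_def using eval_U eval_V
      by (auto simp: word_inv_def zero_prod_def rot.act_minus rot_uminus rot_simps)
  qed
  \<comment> \<open>A representative word is chosen from the class; \<open>eval\<close> makes the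
    value independent of the choice.\<close>
  define g where "g A = word_eval ?H ?g (SOME w. w \<in> A)" for A
  have g_c: "g (c w) = word_eval ?H ?g w" for w
  proof -
    have "(SOME u. u \<in> c w) \<in> c w" by (rule someI[of _ w]) (simp add: c_def word_eq.refl)
    then have "word_eq R w (SOME u. u \<in> c w)" by (simp add: c_def)
    then show ?thesis unfolding g_def by (rule eval[symmetric])
  qed
  have c_surj: "\<exists>w. A = c w" if "A \<in> carrier P" for A
    using that unfolding P_def presented_group_carrier c_def .
  have "g \<in> hom P ?H"
  proof (rule homI)
    fix A B assume "A \<in> carrier P" "B \<in> carrier P"
    then obtain u v where "A = c u" "B = c v" using c_surj by blast
    then show "g (A \<otimes>\<^bsub>P\<^esub> B) = g A \<otimes>\<^bsub>?H\<^esub> g B"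
      by (simp only: c_mult g_c H.sdp.word_eval_append[OF inv_gen(2)])
  qed simp
  then interpret g: group_hom P ?H g by unfold_locales
  have g_gen: "g cx = ((1, 0), 0)" "g cy = ((0, 1), 0)" "g cz = ((0, 0), 1)"
    by (simp_all add: cxy cz_def g_c)
  have gf: "g (?f p) = p" for p
  proof -
    obtain a b k where p: "p = ((a, b), k)" by (metis prod.exhaust)
    show ?thesis
      using carr by (simp add: p g.hom_int_pow g_gen H.int_pow_eq rot_pw rot_pw(3)[unfolded zero_prod_def])
  qed
  have img: "subgroup (range ?f) P"
    using f.subgroup_img_is_subgroup[OF H.sdp.subgroup_self] by (simp only: carrier_sdp)
  have surj: "A \<in> range ?f" if "A \<in> carrier P" for A
  proof -
    have fgen: "c [(a, s)] \<in> range ?f" for a s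
    proof -
      have t: "c [(a, True)] \<in> range ?f"
      proof (cases a)
        case Gen_x
        then show ?thesis using carr by (intro image_eqI[of _ _ "((1, 0), 0)"]) (simp_all add: cxy)
      next
        case Gen_y
        then show ?thesis using carr by (intro image_eqI[of _ _ "((0, 1), 0)"]) (simp_all add: cxy)
      next
        case Gen_z
        then show ?thesis using carr by (intro image_eqI[of _ _ "((0, 0), 1)"]) (simp_all add: cz_def)
      qed
      have "c [(a, False)] = inv\<^bsub>P\<^esub> c [(a, True)]" by (simp add: c_inv word_inv_def)
      moreover have "inv\<^bsub>P\<^esub> c [(a, True)] \<in> range ?f"
        by (rule subgroup.m_inv_closed[OF img t])
      ultimately show ?thesis using t by (cases s) simp_all
    qed
    have "c w \<in> range ?f" for w
    proof (induction w)
      case Nil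
      show ?case unfolding c_one[symmetric] by (rule subgroup.one_closed[OF img])
    next
      case (Cons l w)
      then show ?case using subgroup.m_closed[OF img fgen[of "fst l" "snd l"] Cons] by (simp add: c_mult)
    qed
    then show ?thesis using c_surj[OF that] by blast
  qed
  have "inj ?f" using gf by (rule inj_on_inverseI)
  moreover have "range ?f = carrier P"
    using subgroup.subset[OF img] surj by (rule equalityI[OF _ subsetI])
  ultimately have "bij_betw ?f (carrier ?H) (carrier P)" by (simp only: bij_betw_def carrier_sdp)
  then have "?f \<in> iso ?H P" using f by (simp only: iso_def mem_Collect_eq)
  then show ?thesis by (metis H.sdp.iso_sym is_isoI)
qed

interpretation presented: group "presented_group R" for R :: "('a word \<times> 'a word) set"
  by (rule group_presented_group)

lemma word_class_inv: "Collect (word_eq R (word_inv w)) = inv\<^bsub>presented_group R\<^esub> Collect (word_eq R w)"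
proof -
  have "Collect (word_eq R (word_inv w)) \<otimes>\<^bsub>presented_group R\<^esub> Collect (word_eq R w) = \<one>\<^bsub>presented_group R\<^esub>"
    by (simp add: presented_group_mult presented_group_one word_class_eq_iff word_eq_inv_left)
  then show ?thesis
    using presented_group_carrier by (metis presented.inv_equality)
qed

lemma word_class_carrier: "Collect (word_eq R w) \<in> carrier (presented_group R)"
  unfolding presented_group_carrier by blast

text \<open>The generators \<open>x\<close> and \<open>y\<close> become 1 and \<omega>, and
  \<open>z\<close> acts by \<open>\<zeta> = 1 + \<omega>\<close>, which maps \<omega> to
  \<open>- 1\<close>. The other two groups use \<open>\<zeta>\<^sup>2 = \<omega>\<close> and
  \<open>\<zeta>\<^sup>3 = - 1\<close>.\<close>

lemma pi1_G5_iso: "pi1_G5 \<cong> sdp (\<lambda>k. rot (1 * k))"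
  unfolding pi1_G5_def
proof (rule presented_group_iso_sdp, goal_cases)
  case 1
  show ?case by (simp add: rot_simps word_class_carrier presented_group_mult)
next
  case 2
  show ?case by (simp add: rot_simps word_class_carrier word_class_inv presented.int_pow_neg)
qed (simp_all add: int_action.inv_sdp[OF rot_power] rot_simps word_inv_def)

lemma pi1_G3_iso: "pi1_G3 \<cong> sdp (\<lambda>k. rot (2 * k))"
  unfolding pi1_G3_def
proof (rule presented_group_iso_sdp, goal_cases)
  case 1
  show ?case by (simp add: rot_simps word_class_carrier)
next
  case 2
  let ?R = "{(x\<^sub>w @ y\<^sub>w @ word_inv x\<^sub>w @ word_inv y\<^sub>w, []), (z\<^sub>w @ x\<^sub>w @ word_inv z\<^sub>w, y\<^sub>w),
    (z\<^sub>w @ y\<^sub>w @ word_inv z\<^sub>w, word_inv (x\<^sub>w @ y\<^sub>w))}"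
  let ?cx = "Collect (word_eq ?R x\<^sub>w)" and ?cy = "Collect (word_eq ?R y\<^sub>w)"
  let ?P = "presented_group ?R"
  \<comment> \<open>The relation gives the inverse of \<open>x y\<close> with the factors in reverse
    order; commutativity is needed to bring it to normal form.\<close>
  have "word_eq ?R (x\<^sub>w @ y\<^sub>w @ word_inv x\<^sub>w @ word_inv y\<^sub>w) []" by (rule word_eq.rel) simp
  then have "?cx \<otimes>\<^bsub>?P\<^esub> (?cy \<otimes>\<^bsub>?P\<^esub> (inv\<^bsub>?P\<^esub> ?cx \<otimes>\<^bsub>?P\<^esub> inv\<^bsub>?P\<^esub> ?cy)) = \<one>\<^bsub>?P\<^esub>"
    unfolding word_class_inv[symmetric] presented_group_mult presented_group_one word_class_eq_iff by simp
  then have *: "?cx \<otimes>\<^bsub>?P\<^esub> ?cy \<otimes>\<^bsub>?P\<^esub> (inv\<^bsub>?P\<^esub> ?cx \<otimes>\<^bsub>?P\<^esub> inv\<^bsub>?P\<^esub> ?cy) = \<one>\<^bsub>?P\<^esub>"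
    by (simp only: presented.m_assoc word_class_carrier presented.inv_closed presented.m_closed)
  have "inv\<^bsub>?P\<^esub> (?cx \<otimes>\<^bsub>?P\<^esub> ?cy) = inv\<^bsub>?P\<^esub> ?cx \<otimes>\<^bsub>?P\<^esub> inv\<^bsub>?P\<^esub> ?cy"
    by (rule presented.inv_equality[OF presented.inv_comm[OF *]])
      (intro presented.m_closed presented.inv_closed word_class_carrier)+
  then show ?case
    by (simp only: word_class_inv presented_group_mult[symmetric] rot_simps)
      (simp add: rot_simps word_class_carrier presented.int_pow_neg)
qed (simp_all add: int_action.inv_sdp[OF rot_power] rot_simps word_inv_def)

lemma pi1_G2_iso: "pi1_G2 \<cong> sdp (\<lambda>k. rot (3 * k))"
  unfolding pi1_G2_def
proof (rule presented_group_iso_sdp, goal_cases)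
  case 1
  show ?case by (simp add: rot_simps word_class_carrier word_class_inv presented.int_pow_neg)
next
  case 2
  show ?case by (simp add: rot_simps word_class_carrier word_class_inv presented.int_pow_neg)
qed (simp_all add: int_action.inv_sdp[OF rot_power] rot_simps word_inv_def)

lemma Z3_group_iso: "Z3_group \<cong> sdp (\<lambda>k. rot (0 * k))"
proof -
  have "(\<lambda>(a, b, c). ((a, b), c)) \<in> iso Z3_group (sdp (\<lambda>k. rot (0 * k)))"
    unfolding iso_def
  proof (intro CollectI conjI)
    show "(\<lambda>(a, b, c). ((a, b), c)) \<in> hom Z3_group (sdp (\<lambda>k. rot (0 * k)))"
      by (rule homI) (auto simp: Z3_group_def integer_group_def rot_simps)
    show "bij_betw (\<lambda>(a, b, c). ((a, b), c)) (carrier Z3_group) (carrier (sdp (\<lambda>k. rot (0 * k))))"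
      by (rule bij_betwI[of _ _ _ "\<lambda>((a, b), c). (a, b, c)"])
        (auto simp: Z3_group_def integer_group_def)
  qed
  then show ?thesis by (rule is_isoI)
qed

section \<open>Isomorphism invariance of the count\<close>

lemma is_iso_trans_eq:
  assumes "group A" "group B" "group H" "A \<cong> B"
  shows "A \<cong> H \<longleftrightarrow> B \<cong> H"
  using assms by (meson group.iso_sym iso_trans)

lemma conj_classes_count_iso_left:
  assumes G: "group G" and "group H" "group H'" "H \<cong> H'"
  shows "conj_classes_count H G n = conj_classes_count H' G n"
proof -
  have "G\<lparr>carrier := S\<rparr> \<cong> H \<longleftrightarrow> G\<lparr>carrier := S\<rparr> \<cong> H'" if "subgroup S G" for S
    using assms by (meson group.iso_sym iso_trans)
  then show ?thesis unfolding conj_classes_count_def by (metis (no_types, lifting) Collect_cong)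
qed

text \<open>Taking images under the isomorphism preserves subgroups, indices, isomorphism types and
  conjugation, hence maps orbits bijectively to orbits.\<close>

lemma conj_classes_count_iso_right:
  assumes G: "group G" and G': "group G'" and H: "group H" and iso: "G \<cong> G'"
  shows "conj_classes_count H G n = conj_classes_count H G' n"
proof -
  obtain f where f: "f \<in> iso G G'" using iso by (auto simp: is_iso_def)
  then have hom: "f \<in> hom G G'" and bij: "bij_betw f (carrier G) (carrier G')" by (auto simp: iso_def)
  interpret f: group_hom G G' f using G G' hom by (simp add: group_hom_def group_hom_axioms_def)
  have inj: "inj_on f (carrier G)" and surj: "f ` carrier G = carrier G'" using bij by (auto simp: bij_betw_def)
  let ?X = "{S. subgroup S G \<and> card (rcosets\<^bsub>G\<^esub> S) = n \<and> G\<lparr>carrier := S\<rparr> \<cong> H}"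
  let ?X' = "{S. subgroup S G' \<and> card (rcosets\<^bsub>G'\<^esub> S) = n \<and> G'\<lparr>carrier := S\<rparr> \<cong> H}"
  let ?a = "\<lambda>g S. g <#\<^bsub>G\<^esub> S #>\<^bsub>G\<^esub> inv\<^bsub>G\<^esub> g" and ?a' = "\<lambda>g S. g <#\<^bsub>G'\<^esub> S #>\<^bsub>G'\<^esub> inv\<^bsub>G'\<^esub> g"
  have sub: "subgroup (f ` S) G'" if "subgroup S G" for S
    using f.subgroup_img_is_subgroup[OF that] .
  have rc: "f ` (S #>\<^bsub>G\<^esub> g) = f ` S #>\<^bsub>G'\<^esub> f g" if "S \<subseteq> carrier G" "g \<in> carrier G" for S g
    using that unfolding r_coset_def by (auto simp: image_iff subset_eq)
  have lc: "f ` (g <#\<^bsub>G\<^esub> S) = f g <#\<^bsub>G'\<^esub> f ` S" if "S \<subseteq> carrier G" "g \<in> carrier G" for S g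
    using that unfolding l_coset_def by (auto simp: image_iff subset_eq)
  have rsub: "S #>\<^bsub>G\<^esub> g \<subseteq> carrier G" if "S \<subseteq> carrier G" "g \<in> carrier G" for S g
    using that by (rule f.G.r_coset_subset_G)
  have inj_img: "inj_on ((`) f) (Pow (carrier G))" using inj by (rule inj_on_image_Pow)
  have card_rc: "card (rcosets\<^bsub>G'\<^esub> (f ` S)) = card (rcosets\<^bsub>G\<^esub> S)" if S: "subgroup S G" for S
  proof -
    have SG: "S \<subseteq> carrier G" using subgroup.subset[OF S] .
    have "rcosets\<^bsub>G'\<^esub> (f ` S) = (`) f ` (rcosets\<^bsub>G\<^esub> S)"
      unfolding RCOSETS_def surj[symmetric] using rc[OF SG] by auto
    moreover have "inj_on ((`) f) (rcosets\<^bsub>G\<^esub> S)"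
      by (rule inj_on_subset[OF inj_img]) (use rsub[OF SG] in \<open>auto simp: RCOSETS_def\<close>)
    ultimately show ?thesis by (simp add: card_image)
  qed
  have iso_S: "G'\<lparr>carrier := f ` S\<rparr> \<cong> H \<longleftrightarrow> G\<lparr>carrier := S\<rparr> \<cong> H" if S: "subgroup S G" for S
  proof -
    have "f \<in> iso (G\<lparr>carrier := S\<rparr>) (G'\<lparr>carrier := f ` S\<rparr>)"
      using subgroup.subset[OF S] inj f.hom_mult
      by (auto simp: iso_def hom_def bij_betw_def subset_eq intro: inj_on_subset)
    then have "G\<lparr>carrier := S\<rparr> \<cong> G'\<lparr>carrier := f ` S\<rparr>" by (rule is_isoI)
    moreover have "group (G\<lparr>carrier := S\<rparr>)" "group (G'\<lparr>carrier := f ` S\<rparr>)"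
      using subgroup.subgroup_is_group S sub[OF S] G G' by blast+
    ultimately show ?thesis using is_iso_trans_eq[OF _ _ H] by blast
  qed
  have X': "?X' = (`) f ` ?X"
  proof (intro equalityI subsetI)
    fix S' assume S': "S' \<in> ?X'"
    define S where "S = carrier G \<inter> f -` S'"
    have S: "subgroup S G"
    proof (rule f.G.subgroupI)
      show "S \<noteq> {}" using subgroup.one_closed[of S' G'] S' f.hom_one by (auto simp: S_def)
    qed (use S' in \<open>auto simp: S_def subgroup.m_closed subgroup.m_inv_closed\<close>)
    have "S' \<subseteq> f ` carrier G" unfolding surj using S' subgroup.subset by blast
    then have fS: "f ` S = S'" unfolding S_def by blast
    have "S \<in> ?X" using S S' card_rc[OF S] iso_S[OF S] unfolding fS by simp
    then show "S' \<in> (`) f ` ?X" by (rule rev_image_eqI) (rule fS[symmetric])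
  qed (use sub card_rc iso_S in auto)
  have act: "f ` ?a g S = ?a' (f g) (f ` S)" if "subgroup S G" "g \<in> carrier G" for S g
  proof -
    have SG: "S \<subseteq> carrier G" using subgroup.subset[OF that(1)] .
    then have "g <#\<^bsub>G\<^esub> S \<subseteq> carrier G" using that(2) by (rule f.G.l_coset_subset_G)
    then show ?thesis using rc lc SG that(2) by simp
  qed
  have orb: "orbit G' ?a' (f ` S) = (`) f ` orbit G ?a S" if "subgroup S G" for S
    using act[OF that] unfolding orbit_def surj[symmetric] by (auto simp: image_iff)
  have "orbits G' ?X' ?a' = (\<lambda>Q. (`) f ` Q) ` orbits G ?X ?a"
  proof -
    have o: "orbits K E \<phi> = orbit K \<phi> ` E" for K :: "('x, 'y) monoid_scheme" and E :: "'z set" and \<phi>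
      by (auto simp: orbits_def)
    show ?thesis unfolding X' o image_image by (rule image_cong) (use orb in blast)+
  qed
  moreover have "inj_on (\<lambda>Q. (`) f ` Q) (orbits G ?X ?a)"
  proof (rule inj_on_subset[OF inj_on_image_Pow[OF inj_img]])
    have "?a g S \<subseteq> carrier G" if "subgroup S G" "g \<in> carrier G" for S g
      using that subgroup.subset by (metis f.G.inv_closed f.G.l_coset_subset_G rsub)
    then show "orbits G ?X ?a \<subseteq> Pow (Pow (carrier G))"
      unfolding orbits_def orbit_def by blast
  qed
  ultimately show ?thesis unfolding conj_classes_count_def by (simp add: card_image)
qed

section \<open>Isomorphism types of subgroups\<close>

text \<open>An isomorphism invariant that detects the order of the acting rotation and so separates
  the four model groups.\<close>

definition pow_commute :: "('a, 'b) monoid_scheme \<Rightarrow> nat \<Rightarrow> bool"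
  where "pow_commute G k \<longleftrightarrow> (\<forall>a\<in>carrier G. \<forall>b\<in>carrier G.
    a [^]\<^bsub>G\<^esub> k \<otimes>\<^bsub>G\<^esub> b [^]\<^bsub>G\<^esub> k = b [^]\<^bsub>G\<^esub> k \<otimes>\<^bsub>G\<^esub> a [^]\<^bsub>G\<^esub> k)"

lemma pow_commute_iso:
  assumes "group G" "group H" "G \<cong> H" "pow_commute G k"
  shows "pow_commute H k"
proof -
  obtain f where f: "f \<in> hom G H" "f ` carrier G = carrier H"
    using assms(3) by (auto simp: is_iso_def iso_def bij_betw_def)
  interpret f: group_hom G H f using assms f by (simp add: group_hom_def group_hom_axioms_def)
  show ?thesis
    using assms(4) unfolding pow_commute_def f(2)[symmetric]
    by (auto simp flip: f.hom_nat_pow f.hom_mult)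
qed

lemma rot_fixes_iff: "m \<noteq> 0 \<Longrightarrow> rot k (m, 0) = (m, 0) \<longleftrightarrow> 6 dvd k"
  by (cases k rule: mod6_cases) (auto simp: rot_simps dvd_eq_mod_eq_0)

text \<open>The height of a \<open>k\<close>-th power is a multiple of \<open>k\<close>, so it acts
  trivially if 6 divides \<open>t * k\<close>. Conversely, the powers of a unit translation and of
  the generator \<open>(0, 1)\<close> commute only if the rotation fixes a nonzero vector.\<close>

lemma pow_commute_sdp:
  assumes "k > 0"
  shows "pow_commute (sdp (\<lambda>j. rot (t * j))) k \<longleftrightarrow> 6 dvd t * int k"
proof -
  interpret H: int_action "\<lambda>j. rot (t * j)" by (rule rot_power)
  have pow: "(v, i) [^]\<^bsub>sdp (\<lambda>j. rot (t * j))\<^esub> k = (H.pw v i (int k), i * int k)" for v i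
    using H.int_pow_eq[of v i "int k"] by (simp only: int_pow_int)
  show ?thesis
  proof
    assume "6 dvd t * int k"
    then have "(t * (i * int k)) mod 6 = 0" for i
      by (metis dvd_eq_mod_eq_0 dvd_mult mult.left_commute)
    then have "rot (t * (i * int k)) v = v" for i v by (cases v) (simp add: rot_simps)
    then show "pow_commute (sdp (\<lambda>j. rot (t * j))) k"
      by (auto simp: pow_commute_def pow add.commute)
  next
    assume c: "pow_commute (sdp (\<lambda>j. rot (t * j))) k"
    have "rot (t * int k) (int k, 0) = (int k, 0)"
      using c[unfolded pow_commute_def, rule_format, of "((1, 0), 0)" "(0, 1)"] by (simp add: pow rot_pw)
    then show "6 dvd t * int k" using assms by (simp add: rot_fixes_iff)
  qed
qed

lemma group_sdp_rot: "group (sdp (\<lambda>j. rot (c * j)))"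
proof -
  interpret int_action "\<lambda>j. rot (c * j)" by (rule rot_power)
  show ?thesis by (rule sdp.is_group)
qed

lemma sdp_rot_iso_imp_eq:
  assumes "s \<in> {0, 1, 2, 3}" "t \<in> {0, 1, 2, 3}" "sdp (\<lambda>j. rot (int s * j)) \<cong> sdp (\<lambda>j. rot (int t * j))"
  shows "s = t"
proof -
  have g: "group (sdp (\<lambda>j. rot (c * j)))" for c
    by (rule group_sdp_rot)
  have "6 dvd int s * int k \<longleftrightarrow> 6 dvd int t * int k" if "k > 0" for k
    using pow_commute_iso[OF g g] assms(3) group.iso_sym[OF g] pow_commute_sdp[OF that] by metis
  \<comment> \<open>Among the exponents 1, 2, 3 the invariant holds for all if \<open>t = 0\<close>,
    for none if \<open>t = 1\<close>, only for 3 if \<open>t = 2\<close>, and only for 2 if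
    \<open>t = 3\<close>.\<close>
  from this[of 1] this[of 2] this[of 3] show ?thesis using assms(1,2) by auto
qed

text \<open>Every level is congruent to plus or minus exactly one of 0, 1, 2, 3 modulo 6. The
  subgroup is isomorphic to the corresponding model, and different models are not
  isomorphic.\<close>

lemma subgroup_iso_iff:
  assumes S: "subgroup S (sdp rot)" and pos: "card (rcosets\<^bsub>sdp rot\<^esub> S) > 0" and t: "t \<in> {0, 1, 2, 3}"
  shows "sdp rot\<lparr>carrier := S\<rparr> \<cong> sdp (\<lambda>j. rot (int t * j)) \<longleftrightarrow> lev S mod 6 = t \<or> (lev S + t) mod 6 = 0"
proof -
  have l: "lev S > 0" and idx: "lat_index (base S) > 0"
    using pos rot.card_rcosets_eq[OF S] by auto
  have L: "sublat (base S)" by (rule rot.sublat_base[OF S])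
  have iso: "sdp (\<lambda>j. rot (int s * j)) \<cong> sdp rot\<lparr>carrier := S\<rparr>"
    if s: "s \<in> {0, 1, 2, 3}" and ls: "lev S mod 6 = s \<or> (lev S + s) mod 6 = 0" for s
  proof -
    \<comment> \<open>The sign makes \<open>e\<close> congruent to \<open>s\<close> modulo 6, so the
      chosen generator acts exactly as in the model group.\<close>
    define e where "e = (if lev S mod 6 = s then int (lev S) else - int (lev S))"
    have e1: "\<bar>e\<bar> = int (lev S)" by (simp add: e_def)
    have "(e - int s) mod 6 = 0" using ls unfolding e_def by presburger
    then have "6 dvd (e - int s) * j" for j by auto
    then have "(e * j) mod 6 = (int s * j) mod 6" for j
      by (simp add: mod_eq_dvd_iff left_diff_distrib)
    then have e2: "rot (e * j) = rot (int s * j)" for j by (rule rot_cong)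
    show ?thesis
    proof (cases "s = 1 \<or> s = 2")
      \<comment> \<open>The level is prime to 3, so the base is an ideal; multiplication by a
        generator commutes with all rotations.\<close>
      case True
      then have nd: "\<not> 3 dvd int (lev S)" using ls by presburger
      obtain v where v: "(v, int (lev S)) \<in> S"
        using rot.fibre_nonempty[OF S] by (auto simp: fibre_def)
      have "rot 1 ` base S = base S"
        using rot.base_act[OF S v] unfolding rot_image_not_3dvd[OF L nd] .
      then obtain u where u: "u \<noteq> 0" "range (cmul u) = base S"
        by (rule ideal_principal[OF L idx])
      show ?thesis
        by (rule rot.sdp_iso_subgroup[OF S l e1 additive_cmul inj_cmul[OF u(1)] u(2)])
          (simp add: cmul_rot e2)
    next
      case False
      \<comment> \<open>All rotations involved are now signs, with which every additive map
        commutes.\<close>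
      then have s3: "3 dvd int s * j" for j using s by auto
      obtain \<phi> :: "eis \<Rightarrow> eis"
        where phi: "additive \<phi>" "inj \<phi>" "range \<phi> = base S"
        by (rule lattice_iso[OF L idx])
      have "\<phi> (rot (int s * j) u) = rot (int s * j) (\<phi> u)" for j u
      proof -
        have "(int s * j) mod 6 = 0 \<or> (int s * j) mod 6 = 3" using s3[of j] by presburger
        then have "(\<forall>v. rot (int s * j) v = v) \<or> (\<forall>v. rot (int s * j) v = - v)"
          by (auto simp: rot_simps)
        then show ?thesis 
          by (elim disjE) (simp_all add: additive.minus[OF phi(1)] del: split_paired_All)
      qed
      then show ?thesis
        by (intro rot.sdp_iso_subgroup[OF S l e1 phi]) (simp add: e2)
    qed
  qed
  have g: "group (sdp (\<lambda>j. rot (c * j)))" for c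
    by (rule group_sdp_rot)
  have gS: "group (sdp rot\<lparr>carrier := S\<rparr>)"
    using subgroup.subgroup_is_group[OF S rot.sdp.is_group] .
  show ?thesis
  proof
    assume a: "sdp rot\<lparr>carrier := S\<rparr> \<cong> sdp (\<lambda>j. rot (int t * j))"
    obtain s where s: "s \<in> {0, 1, 2, 3}" "lev S mod 6 = s \<or> (lev S + s) mod 6 = 0"
    proof -
      have "lev S mod 6 < 6" by simp
      then consider "lev S mod 6 = 0" | "lev S mod 6 = 1" | "lev S mod 6 = 2" | "lev S mod 6 = 3"
        | "lev S mod 6 = 4" | "lev S mod 6 = 5" by linarith
      then show ?thesis
      proof cases
        case 5
        then have "(lev S + 2) mod 6 = 0" by presburger
        then show ?thesis using that[of 2] by simp
      next
        case 6
        then have "(lev S + 1) mod 6 = 0" by presburger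
        then show ?thesis using that[of 1] by simp
      qed (use that[of 0] that[of 1] that[of 2] that[of 3] in simp_all)
    qed
    have "s = t" using sdp_rot_iso_imp_eq[OF s(1) t] iso_trans[OF iso[OF s] a] by blast
    then show "lev S mod 6 = t \<or> (lev S + t) mod 6 = 0" using s(2) by simp
  next
    assume "lev S mod 6 = t \<or> (lev S + t) mod 6 = 0"
    then show "sdp rot\<lparr>carrier := S\<rparr> \<cong> sdp (\<lambda>j. rot (int t * j))"
      by (rule group.iso_sym[OF g iso[OF t]])
  qed
qed

section \<open>Lattice indices\<close>

text \<open>Multiplication by \<open>1 - \<zeta>\<^sup>k\<close>: up to sign the displacement caused
  by a rotation, and the shift of the fibre under conjugation by a translation.\<close>

definition delta :: "int \<Rightarrow> eis \<Rightarrow> eis"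
  where "delta k w = w - rot k w"

lemma additive_delta: "additive (delta k)"
  by (simp add: additive_def delta_def rot_plus)

lemma delta_add: "delta (i + j) w = delta i (rot j w) + delta j w"
  by (simp add: delta_def rot_add)

lemma delta_minus: "delta (- j) w = - delta j (rot (- j) w)"
  by (simp add: delta_def)

lemma delta_rot: "delta i (rot j w) = rot j (delta i w)"
  by (simp add: delta_def rot.act_diff add.commute flip: rot_add)

lemma sublat_diff_closedI:
  assumes "A \<noteq> {}" "\<And>u v. u \<in> A \<Longrightarrow> v \<in> A \<Longrightarrow> u - v \<in> A"
  shows "sublat A"
proof -
  obtain a where "a \<in> A" using assms(1) by blast
  then have "a - a \<in> A" by (intro assms(2))
  then show ?thesis using assms(2) by (simp add: sublat_def)
qed

text \<open>The exponents \<open>j\<close> with \<open>(1 - \<zeta>\<^sup>j) E\<close> inside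
  \<open>M\<close> form a subgroup of the integers. Together with the corresponding fact on
  stabilizers this is what reduces conditions on two exponents to their greatest common
  divisor.\<close>

lemma sublat_delta_range:
  assumes "sublat M"
  shows "sublat {j. \<forall>w. delta j w \<in> M}"
proof (rule sublat_diff_closedI)
  show "{j. \<forall>w. delta j w \<in> M} \<noteq> {}"
    using sublat_zero[OF assms] by (auto simp: delta_def intro!: exI[of _ 0])
  fix i j assume ij: "i \<in> {j. \<forall>w. delta j w \<in> M}" "j \<in> {j. \<forall>w. delta j w \<in> M}"
  have "delta (i - j) w \<in> M" for w
  proof -
    have "delta i (rot (- j) w) - delta j (rot (- j) w) \<in> M"
      by (rule sublat_diff[OF assms]) (use ij in blast)+
    then show ?thesis using delta_add[of i "- j" w] delta_minus[of j w] by simp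
  qed
  then show "i - j \<in> {j. \<forall>w. delta j w \<in> M}" by blast
qed

lemma sublat_rot_invariance: "sublat {j. rot j ` L = L}"
proof (rule sublat_diff_closedI)
  show "{j. rot j ` L = L} \<noteq> {}" by (auto intro!: exI[of _ 0])
  fix i j assume ij: "i \<in> {j. rot j ` L = L}" "j \<in> {j. rot j ` L = L}"
  have "rot (i - j) ` L = rot i ` (rot (- j) ` L)"
    using rot_add[of i "- j"] by (simp add: image_image)
  also have "rot (- j) ` L = L"
    using rot.act_mult_image[of j L "- 1"] ij by simp
  finally show "i - j \<in> {j. rot j ` L = L}" using ij by simp
qed

lemma sublat_int_gcd:
  assumes A: "sublat (A :: int set)"
  shows "i \<in> A \<and> j \<in> A \<longleftrightarrow> gcd i j \<in> A"
  by (subst (1 2 3) sublat_int_eq_multiples[OF A]) simp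

lemma delta_6: "delta 6 w = 0"
  by (cases w) (simp add: delta_def rot_simps)

lemma rot_6_image: "rot 6 ` L = L"
proof -
  have "rot 6 v = v" for v by (cases v) (simp add: rot_simps)
  then show ?thesis by simp
qed

lemma rot_invariance_gcd:
  "rot i ` L = L \<and> rot j ` L = L \<longleftrightarrow> rot (gcd (gcd i j) 6) ` L = L"
  using sublat_int_gcd[OF sublat_rot_invariance[of L], of i j]
    sublat_int_gcd[OF sublat_rot_invariance[of L], of "gcd i j" 6] rot_6_image[of L] by simp

lemma lat_ext_least:
  assumes "sublat M" "L \<subseteq> M" "\<And>w. f w \<in> M"
  shows "lat_ext f L \<subseteq> M"
proof
  fix u assume "u \<in> lat_ext f L"
  then obtain w where "u - f w \<in> M" using assms(2) by (auto simp: lat_ext_def)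
  then show "u \<in> M" using sublat_add[OF assms(1), of "u - f w" "f w"] assms(3) by simp
qed

lemma range_subset_lat_ext: "sublat L \<Longrightarrow> f w \<in> lat_ext f L"
  by (auto simp: lat_ext_def sublat_zero intro!: exI[of _ w])

text \<open>A lattice above \<open>L\<close> contains the displacements for \<open>i\<close> and
  \<open>j\<close> exactly when it contains those for the greatest common divisor with 6, as 6
  always qualifies. Both sides are the least such lattice.\<close>

lemma lat_ext_gcd:
  assumes L: "sublat L"
  shows "lat_ext (delta j) (lat_ext (delta i) L) = lat_ext (delta (gcd (gcd i j) 6)) L"
proof -
  let ?g = "gcd (gcd i j) 6"
  let ?M1 = "lat_ext (delta i) L" and ?M = "lat_ext (delta ?g) L"
  let ?M2 = "lat_ext (delta j) ?M1"
  have M1: "sublat ?M1" and M: "sublat ?M" by (rule sublat_lat_ext[OF L additive_delta])+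
  have M2: "sublat ?M2" by (rule sublat_lat_ext[OF M1 additive_delta])
  have J: "i \<in> {j. \<forall>w. delta j w \<in> N} \<and> j \<in> {j. \<forall>w. delta j w \<in> N} \<longleftrightarrow> ?g \<in> {j. \<forall>w. delta j w \<in> N}"
    if N: "sublat N" for N
    using sublat_int_gcd[OF sublat_delta_range[OF N], of i j]
      sublat_int_gcd[OF sublat_delta_range[OF N], of "gcd i j" 6]
    by (simp add: delta_6 sublat_zero[OF N])
  have "?M \<subseteq> ?M2"
  proof (rule lat_ext_least[OF M2])
    show "L \<subseteq> ?M2" using subset_lat_ext[OF additive_delta] by blast
    show "delta ?g w \<in> ?M2" for w
      using J[OF M2] range_subset_lat_ext[OF L, of "delta i"] range_subset_lat_ext[OF M1, of "delta j"]
        subset_lat_ext[OF additive_delta, of ?M1 j] by blast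
  qed
  moreover have "?M2 \<subseteq> ?M"
  proof (rule lat_ext_least[OF M])
    have g: "delta i w \<in> ?M" "delta j w \<in> ?M" for w
      using J[OF M] range_subset_lat_ext[OF L, of "delta ?g"] by blast+
    then show "delta j w \<in> ?M" for w by blast
    show "?M1 \<subseteq> ?M" by (rule lat_ext_least[OF M subset_lat_ext[OF additive_delta] g(1)])
  qed
  ultimately show ?thesis by blast
qed

lemma lat_index_lat_ext_pos:
  assumes "sublat L" "lat_index L > 0" "additive f"
  shows "lat_index (lat_ext f L) > 0"
  using lat_index_tower[OF assms(1) sublat_lat_ext[OF assms(1,3)] subset_lat_ext[OF assms(3)]] assms(2)
  by (auto intro: ccontr)

definition sum_index :: "int \<Rightarrow> nat \<Rightarrow> nat"
  where "sum_index g m = (\<Sum>L | L \<in> Lat m \<and> rot g ` L = L. lat_index (lat_ext (delta g) L))"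

text \<open>Here \<open>1 - \<zeta>\<close> is a unit, with inverse \<zeta>, so every extended
  lattice is all of \<open>E\<close>.\<close>

lemma sum_index_1: "sum_index 1 m = card (Ideals m)"
proof -
  have "lat_index (lat_ext (delta 1) L) = 1" if "L \<in> Lat m" for L
  proof -
    have "sublat L" using that by (simp add: Lat_def)
    have "delta 1 (rot 1 w) = w" for w by (cases w) (simp add: delta_def rot_simps)
    then have "\<exists>w. u - delta 1 w \<in> L" for u
      using sublat_zero[OF \<open>sublat L\<close>] by (metis diff_self)
    then have "lat_ext (delta 1) L = UNIV" by (auto simp: lat_ext_def)
    then show ?thesis by (simp add: lat_index_UNIV)
  qed
  then show ?thesis by (simp add: sum_index_def Ideals_def)
qed

lemma sum_index_6: "sum_index 6 m = m * card (Lat m)"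
proof -
  have "lat_ext (delta 6) L = L" for L by (simp add: lat_ext_def delta_6)
  then have "sum_index 6 m = (\<Sum>L | L \<in> Lat m. lat_index L)"
    by (simp add: sum_index_def rot_6_image)
  also have "\<dots> = (\<Sum>L | L \<in> Lat m. m)" by (rule sum.cong) (auto simp: Lat_def)
  finally show ?thesis by (simp add: mult.commute)
qed

text \<open>The lattices inside \<open>range f\<close> are the \<open>f\<close>-images of the
  lattices of index \<open>m div c\<close>; a property invariant under \<open>f\<close> can be
  carried along.\<close>

lemma card_Lat_subset:
  assumes f: "additive f" "inj f" and c: "lat_index (range f) = c" "c > 0"
    and P: "\<And>L. P (f ` L) \<longleftrightarrow> P L"
  shows "card {L \<in> Lat m. P L \<and> L \<subseteq> range f} = (if c dvd m then card {L \<in> Lat (m div c). P L} else 0)"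
proof (cases "c dvd m")
  case True
  have bij: "bij_betw ((`) f) (Lat (m div c)) {L. sublat L \<and> L \<subseteq> range f \<and> lat_index L = m}"
    using bij_betw_image_lattices[OF f, of "m div c"] c True by (simp add: Lat_def)
  have "bij_betw ((`) f) {L \<in> Lat (m div c). P L} {L \<in> Lat m. P L \<and> L \<subseteq> range f}"
  proof (rule bij_betw_subset[OF bij])
    show "(`) f ` {L \<in> Lat (m div c). P L} = {L \<in> Lat m. P L \<and> L \<subseteq> range f}"
    proof (intro equalityI subsetI)
      fix K assume K: "K \<in> {L \<in> Lat m. P L \<and> L \<subseteq> range f}"
      then have "K \<in> (`) f ` Lat (m div c)" using bij by (auto simp: bij_betw_def Lat_def)
      then obtain L where "L \<in> Lat (m div c)" "K = f ` L" by blast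
      then show "K \<in> (`) f ` {L \<in> Lat (m div c). P L}" using K P by blast
    next
      fix K assume "K \<in> (`) f ` {L \<in> Lat (m div c). P L}"
      then obtain L where L: "L \<in> Lat (m div c)" "K = f ` L" "P L" by blast
      then have "K \<in> {L. sublat L \<and> L \<subseteq> range f \<and> lat_index L = m}" using bij by (auto simp: bij_betw_def)
      then show "K \<in> {L \<in> Lat m. P L \<and> L \<subseteq> range f}" using L P by (simp add: Lat_def)
    qed
  qed blast
  then show ?thesis using True by (simp add: bij_betw_same_card)
next
  case False
  have "\<not> L \<subseteq> range f" if "L \<in> Lat m" for L
  proof
    assume "L \<subseteq> range f"
    then have "m = c * card ((\<lambda>v. (+) v ` L) ` range f)"
      using that lat_index_tower[of L "range f"] sublat_image[OF f(1) sublat_UNIV] c by (auto simp: Lat_def)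
    then show False using False by simp
  qed
  then have "{L \<in> Lat m. P L \<and> L \<subseteq> range f} = {}" by blast
  then show ?thesis using False by (simp only: if_False card.empty)
qed

lemma sum_of_bool: "finite A \<Longrightarrow> (\<Sum>x\<in>A. c * of_bool (P x)) = c * card {x \<in> A. P x}" for c :: nat
  by (simp add: sum_distrib_left[symmetric] sum_of_bool_eq Int_def)

text \<open>The element \<open>1 - \<zeta>\<^sup>2 = 1 - \<omega>\<close> generates the prime
  \<open>Q\<close> of index 3. So \<open>L + Q\<close> is \<open>Q\<close> or \<open>E\<close>, and
  the ideals inside \<open>Q\<close> are the multiples by \<open>1 - \<omega>\<close> of the ideals
  of index \<open>m div 3\<close>.\<close>

lemma sum_index_2:
  assumes m: "m > 0"
  shows "sum_index 2 m = card (Ideals m) + 2 * (if 3 dvd m then card (Ideals (m div 3)) else 0)"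
proof -
  define Q :: "eis set" where "Q = {v. int 3 dvd fst v + snd v}"
  have addQ: "additive (\<lambda>v :: eis. fst v + snd v)" by (simp add: additive_def)
  have Q: "sublat Q" unfolding Q_def by (rule sublat_dvd[OF addQ])
  have "surj (\<lambda>v :: eis. fst v + snd v)"
    by (rule surjI[of _ "\<lambda>x. (x, 0)"]) simp
  then have Q3: "lat_index Q = 3" unfolding Q_def by (rule lat_index_dvd[OF addQ])
  have rQ: "range (delta 2) = Q"
  proof (intro equalityI subsetI)
    fix v assume "v \<in> range (delta 2)"
    then obtain a b where "v = delta 2 (a, b)" by auto
    then have "fst v + snd v = 3 * b" by (simp add: delta_def rot_simps)
    then show "v \<in> Q" by (simp add: Q_def)
  next
    fix v assume "v \<in> Q"
    then obtain b where b: "fst v + snd v = 3 * b" by (auto simp: Q_def)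
    have "v = delta 2 (fst v - b, b)" using b by (simp add: delta_def rot_simps prod_eq_iff)
    then show "v \<in> range (delta 2)" by blast
  qed
  have inj: "inj (delta 2)"
  proof (rule injI)
    fix v w assume "delta 2 v = delta 2 w"
    then show "v = w" by (cases v; cases w) (auto simp: delta_def rot_simps)
  qed
  have idx: "lat_index (lat_ext (delta 2) L) = 1 + 2 * of_bool (L \<subseteq> Q)" if L: "sublat L" for L
  proof (cases "L \<subseteq> Q")
    case True
    have "lat_ext (delta 2) L = Q"
    proof
      show "lat_ext (delta 2) L \<subseteq> Q" using rQ by (intro lat_ext_least[OF Q True]) blast
      show "Q \<subseteq> lat_ext (delta 2) L" using range_subset_lat_ext[OF L, of "delta 2"] rQ by blast
    qed
    then show ?thesis using Q3 True by simp
  next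
    case False
    then obtain u where u: "u \<in> L" "\<not> 3 dvd fst u + snd u" by (auto simp: Q_def)
    have "v \<in> lat_ext (delta 2) L" for v
    proof -
      \<comment> \<open>An integer prime to 3 is its own inverse modulo 3, so subtracting
        \<open>c\<close> times \<open>u\<close> moves \<open>v\<close> into
        \<open>Q\<close>.\<close>
      define c where "c = (fst v + snd v) * (fst u + snd u)"
      let ?s = "fst u + snd u"
      have "?s mod 3 = 1 \<or> ?s mod 3 = 2" using u(2) by presburger
      then have "(?s * ?s) mod 3 = 1" using mod_mult_eq[of ?s 3 ?s] by auto
      then have "3 dvd 1 - ?s * ?s" by presburger
      moreover have "fst v - c * fst u + (snd v - c * snd u) = (fst v + snd v) * (1 - ?s * ?s)"
        by (simp add: c_def algebra_simps)
      ultimately have "(fst v - c * fst u, snd v - c * snd u) \<in> Q" by (simp add: Q_def)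
      then obtain w where "(fst v - c * fst u, snd v - c * snd u) = delta 2 w" using rQ by blast
      then have "v - delta 2 w = (c * fst u, c * snd u)" by (simp add: prod_eq_iff)
      moreover have "(c * fst u, c * snd u) \<in> L" using sublat_pair_scale[OF L, of "fst u" "snd u"] u(1) by simp
      ultimately have "v - delta 2 w \<in> L" by simp
      then show ?thesis unfolding lat_ext_def by blast
    qed
    then have "lat_ext (delta 2) L = UNIV" by blast
    then show ?thesis using False by (simp add: lat_index_UNIV)
  qed
  have r2: "rot 2 ` L = L \<longleftrightarrow> rot 1 ` L = L" if "L \<in> Lat m" for L
    using that by (intro rot_image_not_3dvd) (auto simp: Lat_def)
  have fin: "finite (Ideals m)" using card_Ideals[OF m] by blast
  have "sum_index 2 m = (\<Sum>L\<in>Ideals m. 1 + 2 * of_bool (L \<subseteq> Q))"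
    unfolding sum_index_def
  proof (rule sum.cong)
    show "{L. L \<in> Lat m \<and> rot 2 ` L = L} = Ideals m" unfolding Ideals_def using r2 by blast
  qed (simp add: idx Ideals_def Lat_def)
  also have "\<dots> = card (Ideals m) + 2 * card {L \<in> Ideals m. L \<subseteq> Q}"
    using fin by (simp only: sum.distrib sum_of_bool) simp
  also have "{L \<in> Ideals m. L \<subseteq> Q} = {L \<in> Lat m. rot 1 ` L = L \<and> L \<subseteq> range (delta 2)}"
    by (auto simp: Ideals_def rQ)
  also have "card \<dots> = (if 3 dvd m then card (Ideals (m div 3)) else 0)"
    unfolding Ideals_def
  proof (rule card_Lat_subset[OF additive_delta inj])
    fix L
    have "rot 1 ` delta 2 ` L = delta 2 ` rot 1 ` L" by (simp add: image_image delta_rot)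
    then show "rot 1 ` delta 2 ` L = delta 2 ` L \<longleftrightarrow> rot 1 ` L = L"
      by (simp add: inj_image_eq_iff[OF inj])
  qed (simp_all add: rQ Q3)
  finally show ?thesis .
qed

text \<open>The four arguments stand for the classes of \<open>E\<close> modulo 2, and
  \<open>P\<close>, \<open>Q\<close>, \<open>R\<close> say which nonzero class becomes trivial;
  equality of two classes depends only on their difference.\<close>

lemma card_four:
  assumes "a = b \<longleftrightarrow> P" "a = c \<longleftrightarrow> Q" "a = d \<longleftrightarrow> R" "b = c \<longleftrightarrow> R" "b = d \<longleftrightarrow> Q" "c = d \<longleftrightarrow> P"
  shows "card {a, b, c, d} = 1 + of_bool (\<not> P \<and> \<not> R) + of_bool (\<not> Q \<and> \<not> R) + of_bool (\<not> P \<and> \<not> Q)"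
proof (cases P)
  case True
  then show ?thesis using assms by (cases Q) (auto simp: card_insert_if)
next
  case False
  then show ?thesis using assms by (cases Q; cases R) (auto simp: card_insert_if)
qed

text \<open>The quotient by \<open>M\<close> is a vector space over the field with two elements and
  has as many elements as its dual. The dual consists of the linear forms modulo 2 that vanish on
  \<open>M\<close>: the zero form and those among the three nonzero ones.\<close>

lemma lat_index_even:
  assumes M: "sublat (M :: eis set)" and even: "\<And>v. v + v \<in> M"
  shows "lat_index M = 1 + of_bool (\<forall>v\<in>M. even (fst v)) + of_bool (\<forall>v\<in>M. even (snd v))
    + of_bool (\<forall>v\<in>M. even (fst v + snd v))"
proof -
  let ?e1 = "(1, 0) :: eis" and ?e2 = "(0, 1) :: eis" and ?e3 = "(1, 1) :: eis"
  have dec: "v - (fst v mod 2, snd v mod 2) \<in> M" for v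
  proof -
    define w where "w = (fst v div 2, snd v div 2)"
    have "v - (fst v mod 2, snd v mod 2) = w + w"
      by (simp add: w_def prod_eq_iff minus_mod_eq_mult_div)
    then show ?thesis using even[of w] by simp
  qed
  have red: "v \<in> M \<longleftrightarrow> (fst v mod 2, snd v mod 2) \<in> M" for v
    using sublat_add_cancel[OF M dec[of v], of "(fst v mod 2, snd v mod 2)"] by simp
  have zero: "(0, 0) \<in> M" using sublat_zero[OF M] by (simp add: zero_prod_def)
  have par: "x mod 2 = 0 \<or> x mod 2 = 1" for x :: int by presburger
  have A1: "(\<forall>v\<in>M. even (fst v)) \<longleftrightarrow> ?e1 \<notin> M \<and> ?e3 \<notin> M"
    and A2: "(\<forall>v\<in>M. even (snd v)) \<longleftrightarrow> ?e2 \<notin> M \<and> ?e3 \<notin> M"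
    and A3: "(\<forall>v\<in>M. even (fst v + snd v)) \<longleftrightarrow> ?e1 \<notin> M \<and> ?e2 \<notin> M"
  proof -
    have all: "(\<forall>v\<in>M. R (fst v mod 2) (snd v mod 2)) \<longleftrightarrow>
      (\<forall>a\<in>{0, 1}. \<forall>b\<in>{0, 1}. (a, b) \<in> M \<longrightarrow> R a b)" (is "?l \<longleftrightarrow> ?r") for R :: "int \<Rightarrow> int \<Rightarrow> bool"
    proof
      assume l: ?l
      show ?r
      proof (intro ballI impI)
        fix a b :: int assume ab: "a \<in> {0, 1}" "b \<in> {0, 1}" "(a, b) \<in> M"
        then have "R (a mod 2) (b mod 2)" using l by fastforce
        moreover have "a mod 2 = a" "b mod 2 = b" using ab by auto
        ultimately show "R a b" by simp
      qed
    next
      assume r: ?r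
      show ?l
      proof
        fix v assume "v \<in> M"
        then have "(fst v mod 2, snd v mod 2) \<in> M" by (simp only: red[symmetric])
        moreover have "fst v mod 2 \<in> {0, 1}" "snd v mod 2 \<in> {0, 1}" using par by blast+
        ultimately show "R (fst v mod 2) (snd v mod 2)" by (intro r[rule_format])
      qed
    qed
    have e3: "even (x + y) \<longleftrightarrow> x mod 2 = y mod 2" for x y :: int by presburger
    note e = even_iff_mod_2_eq_zero[of "fst v" for v :: "eis"]
      even_iff_mod_2_eq_zero[of "snd v" for v :: "eis"] e3
    show "(\<forall>v\<in>M. even (fst v)) \<longleftrightarrow> ?e1 \<notin> M \<and> ?e3 \<notin> M"
      unfolding e by (subst all[of "\<lambda>a b. a = 0"]) simp
    show "(\<forall>v\<in>M. even (snd v)) \<longleftrightarrow> ?e2 \<notin> M \<and> ?e3 \<notin> M"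
      unfolding e by (subst all[of "\<lambda>a b. b = 0"]) simp
    show "(\<forall>v\<in>M. even (fst v + snd v)) \<longleftrightarrow> ?e1 \<notin> M \<and> ?e2 \<notin> M"
      unfolding e by (subst all[of "\<lambda>a b. a = b"]) auto
  qed
  let ?c = "\<lambda>v. (+) v ` M"
  have sub: "?c v \<in> ?c ` {(0, 0), ?e1, ?e2, ?e3}" for v
  proof -
    have "(fst v mod 2, snd v mod 2) \<in> {(0, 0), ?e1, ?e2, ?e3}" using par[of "fst v"] par[of "snd v"] by auto
    then have "?c (fst v mod 2, snd v mod 2) \<in> ?c ` {(0, 0), ?e1, ?e2, ?e3}" by (rule imageI)
    moreover have "?c v = ?c (fst v mod 2, snd v mod 2)"
      using dec[of v] by (simp only: coset_eq_iff[OF M])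
    ultimately show ?thesis by (simp only:)
  qed
  have cs: "cosets M = {?c (0, 0), ?c ?e1, ?c ?e2, ?c ?e3}"
  proof -
    have "range ?c = ?c ` {(0, 0), ?e1, ?e2, ?e3}"
      using sub by (intro equalityI image_subsetI image_mono subset_UNIV)
    then show ?thesis by (simp only: cosets_def image_insert image_empty)
  qed
  have eqs: "?c (0, 0) = ?c ?e1 \<longleftrightarrow> ?e1 \<in> M" "?c (0, 0) = ?c ?e2 \<longleftrightarrow> ?e2 \<in> M" "?c (0, 0) = ?c ?e3 \<longleftrightarrow> ?e3 \<in> M"
    "?c ?e1 = ?c ?e2 \<longleftrightarrow> ?e3 \<in> M" "?c ?e1 = ?c ?e3 \<longleftrightarrow> ?e2 \<in> M" "?c ?e2 = ?c ?e3 \<longleftrightarrow> ?e1 \<in> M"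
    using red[of "(- 1, 0)"] red[of "(0, - 1)"] red[of "(- 1, - 1)"] red[of "(1, - 1)"]
    by (simp_all add: coset_eq_iff[OF M])
  show ?thesis
    unfolding lat_index_def cs A1 A2 A3 by (rule card_four[OF eqs])
qed

text \<open>Each nonzero linear form modulo 2 has a kernel of index 2, which is an injective
  additive image of \<open>E\<close>.\<close>

lemma card_Lat_even:
  "card {L \<in> Lat m. \<forall>v\<in>L. even (fst v)} = (if 2 dvd m then card (Lat (m div 2)) else 0)" (is "_ = ?r")
  "card {L \<in> Lat m. \<forall>v\<in>L. even (snd v)} = (if 2 dvd m then card (Lat (m div 2)) else 0)"
  "card {L \<in> Lat m. \<forall>v\<in>L. even (fst v + snd v)} = (if 2 dvd m then card (Lat (m div 2)) else 0)"
proof -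
  have *: "card {L \<in> Lat m. \<forall>v\<in>L. even (p v)} = ?r"
    if f: "additive f" "inj f" "range f = {v. even (p v)}" and p: "additive p" "surj p"
    for f :: "eis \<Rightarrow> eis" and p :: "eis \<Rightarrow> int"
  proof -
    have "lat_index (range f) = 2" using lat_index_dvd[OF p, of 2] f(3) by simp
    then have "card {L \<in> Lat m. True \<and> L \<subseteq> range f} = (if 2 dvd m then card {L \<in> Lat (m div 2). True} else 0)"
      using card_Lat_subset[OF f(1,2), of 2 "\<lambda>_. True" m] by simp
    moreover have "{L \<in> Lat m. \<forall>v\<in>L. even (p v)} = {L \<in> Lat m. True \<and> L \<subseteq> range f}" by (auto simp: f(3))
    ultimately show ?thesis by simp
  qed
  show "card {L \<in> Lat m. \<forall>v\<in>L. even (fst v)} = ?r"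
  proof (rule *[of "\<lambda>v. (2 * fst v, snd v)" fst])
    show "range (\<lambda>v. (2 * fst v, snd v)) = {v :: eis. even (fst v)}"
    proof (intro equalityI subsetI)
      fix v :: "eis" assume "v \<in> {v. even (fst v)}"
      then have "v = (2 * fst (fst v div 2, snd v), snd (fst v div 2, snd v))" by simp
      then show "v \<in> range (\<lambda>v. (2 * fst v, snd v))" by blast
    qed auto
    show "surj (fst :: eis \<Rightarrow> int)" by (rule surjI[of _ "\<lambda>x. (x, 0)"]) simp
  qed (auto simp: additive_def inj_def algebra_simps)
  show "card {L \<in> Lat m. \<forall>v\<in>L. even (snd v)} = ?r"
  proof (rule *[of "\<lambda>v. (fst v, 2 * snd v)" snd])
    show "range (\<lambda>v. (fst v, 2 * snd v)) = {v :: eis. even (snd v)}"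
    proof (intro equalityI subsetI)
      fix v :: "eis" assume "v \<in> {v. even (snd v)}"
      then have "v = (fst (fst v, snd v div 2), 2 * snd (fst v, snd v div 2))" by simp
      then show "v \<in> range (\<lambda>v. (fst v, 2 * snd v))" by blast
    qed auto
    show "surj (snd :: eis \<Rightarrow> int)" by (rule surjI[of _ "\<lambda>x. (0, x)"]) simp
  qed (auto simp: additive_def inj_def algebra_simps)
  show "card {L \<in> Lat m. \<forall>v\<in>L. even (fst v + snd v)} = ?r"
  proof (rule *[of "\<lambda>v. (2 * fst v + snd v, snd v)" "\<lambda>v. fst v + snd v"])
    show "range (\<lambda>v. (2 * fst v + snd v, snd v)) = {v :: eis. even (fst v + snd v)}"
    proof (intro equalityI subsetI)
      fix v :: "eis" assume "v \<in> {v. even (fst v + snd v)}"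
      then have "even (fst v - snd v)" by simp
      then have "v = (2 * fst ((fst v - snd v) div 2, snd v) + snd ((fst v - snd v) div 2, snd v),
        snd ((fst v - snd v) div 2, snd v))" by (simp add: prod_eq_iff)
      then show "v \<in> range (\<lambda>v. (2 * fst v + snd v, snd v))" by blast
    qed auto
    show "surj (\<lambda>v :: eis. fst v + snd v)" by (rule surjI[of _ "\<lambda>x. (x, 0)"]) simp
  qed (auto simp: additive_def inj_def algebra_simps)
qed

text \<open>As \<open>1 - \<zeta>\<^sup>3 = 2\<close>, the extended lattice is
  \<open>L + 2 E\<close>, and a linear form modulo 2 vanishes on it exactly when it vanishes on
  \<open>L\<close>. Each of the three nonzero forms contributes one count of lattices of half the
  index.\<close>

lemma sum_index_3:
  assumes m: "m > 0"
  shows "sum_index 3 m = card (Lat m) + 3 * (if 2 dvd m then card (Lat (m div 2)) else 0)"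
proof -
  have fin: "finite (Lat m)" using Lat_card[OF m] by blast
  have d3: "delta 3 w = w + w" for w by (simp add: delta_def rot_uminus)
  have mem: "(\<forall>v\<in>lat_ext (delta 3) L. even (p v)) \<longleftrightarrow> (\<forall>v\<in>L. even (p v))" if p: "additive p"
    for p :: "eis \<Rightarrow> int" and L
  proof
    assume L: "\<forall>v\<in>L. even (p v)"
    have "even (p v)" if "v - delta 3 w \<in> L" for v w
      using L that by (auto simp: d3 additive.diff[OF p] additive.add[OF p])
    then show "\<forall>v\<in>lat_ext (delta 3) L. even (p v)" by (auto simp: lat_ext_def)
  qed (use subset_lat_ext[OF additive_delta] in blast)
  have p: "additive (fst :: eis \<Rightarrow> int)" "additive (snd :: eis \<Rightarrow> int)"
    "additive (\<lambda>v :: eis. fst v + snd v)" by (simp_all add: additive_def)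
  have idx: "lat_index (lat_ext (delta 3) L) = 1 + 1 * of_bool (\<forall>v\<in>L. even (fst v)) + 1 * of_bool (\<forall>v\<in>L. even (snd v))
    + 1 * of_bool (\<forall>v\<in>L. even (fst v + snd v))" if "L \<in> Lat m" for L
  proof -
    have L: "sublat L" using that by (simp add: Lat_def)
    have "v + v \<in> lat_ext (delta 3) L" for v using range_subset_lat_ext[OF L, of "delta 3" v] by (simp only: d3)
    then show ?thesis
      using lat_index_even[OF sublat_lat_ext[OF L additive_delta], of 3] by (simp only: mem[OF p(1)] mem[OF p(2)] mem[OF p(3)])
  qed
  have inv: "{L. L \<in> Lat m \<and> rot 3 ` L = L} = Lat m"
    using rot_image_3dvd[of _ 3] by (auto simp: Lat_def)
  have "sum_index 3 m = (\<Sum>L\<in>Lat m. 1 + 1 * of_bool (\<forall>v\<in>L. even (fst v))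
    + 1 * of_bool (\<forall>v\<in>L. even (snd v)) + 1 * of_bool (\<forall>v\<in>L. even (fst v + snd v)))"
    unfolding sum_index_def inv by (rule sum.cong[OF HOL.refl idx])
  also have "\<dots> = card (Lat m) + 3 * (if 2 dvd m then card (Lat (m div 2)) else 0)"
    by (simp only: sum.distrib sum_of_bool[OF fin] card_Lat_even) simp
  finally show ?thesis .
qed

section \<open>Conjugacy classes of subgroups\<close>

lemma (in group_action) orbit_eq_iff:
  assumes "x \<in> E" "y \<in> E"
  shows "orbit G \<phi> x = orbit G \<phi> y \<longleftrightarrow> y \<in> orbit G \<phi> x"
proof
  show "y \<in> orbit G \<phi> x" if "orbit G \<phi> x = orbit G \<phi> y"
    using orbit_refl[OF assms(2)] that by simp
  assume yx: "y \<in> orbit G \<phi> x"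
  have xy: "x \<in> orbit G \<phi> y" by (rule orbit_sym[OF assms yx])
  have sub: "orbit G \<phi> u \<subseteq> E" if "u \<in> E" for u
    using that element_image by (auto simp: orbit_def)
  show "orbit G \<phi> x = orbit G \<phi> y"
  proof (intro equalityI subsetI)
    fix z assume z: "z \<in> orbit G \<phi> x"
    then have "z \<in> E" using sub[OF assms(1)] by blast
    then show "z \<in> orbit G \<phi> y" using orbit_trans[OF assms(2,1) _ xy z] by blast
  next
    fix z assume z: "z \<in> orbit G \<phi> y"
    then have "z \<in> E" using sub[OF assms(2)] by blast
    then show "z \<in> orbit G \<phi> x" using orbit_trans[OF assms(1,2) _ yx z] by blast
  qed
qed

lemma orbits_eq_image: "orbits G E \<phi> = orbit G \<phi> ` E"
  by (auto simp: orbits_def)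

abbreviation conj_rot :: "eis \<times> int \<Rightarrow> (eis \<times> int) set \<Rightarrow> (eis \<times> int) set"
  where "conj_rot \<equiv> \<lambda>g S. g <#\<^bsub>sdp rot\<^esub> S #>\<^bsub>sdp rot\<^esub> inv\<^bsub>sdp rot\<^esub> g"

definition Levels :: "nat \<Rightarrow> nat \<Rightarrow> nat set"
  where "Levels t n = {l. l dvd n \<and> (l mod 6 = t \<or> (l + t) mod 6 = 0)}"

definition Pairs :: "nat \<Rightarrow> nat \<Rightarrow> (eis set \<times> eis set) set"
  where "Pairs l m = (SIGMA L:{L \<in> Lat m. rot (int l) ` L = L}. cosets (lat_ext (delta (int l)) L))"

definition Triples :: "nat \<Rightarrow> nat \<Rightarrow> (nat \<times> eis set \<times> eis set) set"
  where "Triples t n = (SIGMA l:Levels t n. Pairs l (n div l))"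

text \<open>Conjugation by the translation lattice moves the coset \<open>fibre S\<close> by \<open>delta (lev S) w\<close>, so
  the extended coset recorded here is the invariant of \<open>S\<close> under this conjugation.\<close>

definition triple :: "(eis \<times> int) set \<Rightarrow> nat \<times> eis set \<times> eis set"
  where "triple S = (lev S, base S, lat_ext (delta (int (lev S))) (fibre S))"

definition rot_triple :: "int \<Rightarrow> nat \<times> eis set \<times> eis set \<Rightarrow> nat \<times> eis set \<times> eis set"
  where "rot_triple k = (\<lambda>(l, L, D). (l, rot k ` L, rot k ` D))"

lemma lat_ext_coset: "lat_ext f ((+) v ` L) = (+) v ` lat_ext f L"
proof (rule Set.set_eqI)
  fix u
  have "u - f w - v = u - v - f w" for w by (simp add: algebra_simps)
  then show "u \<in> lat_ext f ((+) v ` L) \<longleftrightarrow> u \<in> (+) v ` lat_ext f L"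
    unfolding lat_ext_def by (simp only: mem_coset_iff mem_Collect_eq)
qed

lemma lat_ext_rot: "lat_ext (delta l) (rot k ` L) = rot k ` lat_ext (delta l) L"
proof -
  have *: "u \<in> rot k ` A \<longleftrightarrow> rot (- k) u \<in> A" for u A
    by (auto simp: image_iff) (metis rot.act_inverse(2))
  have "(\<exists>w. rot (- k) (u - delta l w) \<in> L) \<longleftrightarrow> (\<exists>w. rot (- k) u - delta l w \<in> L)" for u
  proof -
    have "rot (- k) (u - delta l w) = rot (- k) u - delta l (rot (- k) w)" for w
      by (simp add: rot.act_diff delta_rot)
    moreover have "\<exists>w. z = rot (- k) w" for z by (intro exI[of _ "rot k z"]) simp
    ultimately show ?thesis by metis
  qed
  then show ?thesis by (simp add: set_eq_iff lat_ext_def *)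
qed

lemma rot_coset: "rot k ` (+) v ` L = (+) (rot k v) ` rot k ` L"
  by (simp add: image_image rot_plus)

lemma rot_triple_mem: "y \<in> Triples t n \<Longrightarrow> rot_triple k y \<in> Triples t n"
proof -
  assume "y \<in> Triples t n"
  then obtain l L v where y: "y = (l, L, (+) v ` lat_ext (delta (int l)) L)" "l \<in> Levels t n"
    "L \<in> Lat (n div l)" "rot (int l) ` L = L"
    by (auto simp: Triples_def Pairs_def cosets_def)
  have "rot k ` L \<in> Lat (n div l)"
    using y(3) by (auto simp: Lat_def sublat_image[OF rot.act_additive]
      lat_index_image_bij[OF rot.act_additive rot.bij_act])
  moreover have "rot (int l) ` rot k ` L = rot k ` L"
  proof -
    have "rot (int l) (rot k w) = rot k (rot (int l) w)" for w
      by (simp add: add.commute flip: rot_add)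
    then have "rot (int l) ` rot k ` L = rot k ` rot (int l) ` L" by (simp only: image_image)
    then show ?thesis by (simp only: y(4))
  qed
  ultimately show ?thesis
    using y(2) by (auto simp: y(1) rot_triple_def Triples_def Pairs_def cosets_def rot_coset lat_ext_rot)
qed

lemma rot_triple_add: "rot_triple (i + j) y = rot_triple i (rot_triple j y)"
  by (cases y) (simp add: rot_triple_def image_image rot_add)

lemma rot_triple_mod: "rot_triple (k mod 6) = rot_triple k"
  using rot_cong[of "k mod 6" k] by (simp add: rot_triple_def)

lemma rot_triple_0: "rot_triple 0 y = y"
  by (cases y) (simp add: rot_triple_def)

abbreviation rot_act :: "nat \<Rightarrow> nat \<Rightarrow> int \<Rightarrow> nat \<times> eis set \<times> eis set \<Rightarrow> nat \<times> eis set \<times> eis set"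
  where "rot_act t n \<equiv> \<lambda>k. \<lambda>y\<in>Triples t n. rot_triple k y"

text \<open>Rotations matter only modulo 6. The maps are restricted to \<open>Triples t n\<close>
  because a group action here takes values in extensional permutations.\<close>

lemma rot_triple_action:
  "group_action (integer_mod_group 6) (Triples t n) (rot_act t n)"
proof -
  let ?Y = "Triples t n" and ?\<phi> = "rot_act t n"
  have inv: "rot_triple (- k) (rot_triple k y) = y" "rot_triple k (rot_triple (- k) y) = y" for k y
    by (simp_all add: rot_triple_0 flip: rot_triple_add)
  have bij: "bij_betw (?\<phi> k) ?Y ?Y" for k
    by (rule bij_betwI[of _ _ _ "?\<phi> (- k)"]) (auto simp: rot_triple_mem inv)
  have Bij: "?\<phi> k \<in> Bij ?Y" for k using bij[of k] by (simp add: Bij_def)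
  have "?\<phi> \<in> hom (integer_mod_group 6) (BijGroup ?Y)"
  proof (rule homI)
    show "?\<phi> k \<in> carrier (BijGroup ?Y)" for k using Bij by (simp add: BijGroup_def)
    show "?\<phi> (i \<otimes>\<^bsub>integer_mod_group 6\<^esub> j) = ?\<phi> i \<otimes>\<^bsub>BijGroup ?Y\<^esub> ?\<phi> j" for i j
      using Bij by (auto simp: BijGroup_def compose_def rot_triple_mod rot_triple_add rot_triple_mem restrict_def)
  qed
  then show ?thesis
    by (simp add: group_action_def group_hom_def group_hom_axioms_def group_BijGroup)
qed

definition Subs :: "nat \<Rightarrow> nat \<Rightarrow> (eis \<times> int) set set"
  where "Subs t n = {S. subgroup S (sdp rot) \<and> card (rcosets\<^bsub>sdp rot\<^esub> S) = n \<and>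
    (lev S mod 6 = t \<or> (lev S + t) mod 6 = 0)}"

lemma triple_image:
  assumes n: "n > 0"
  shows "triple ` Subs t n = Triples t n"
proof (intro equalityI subsetI)
  fix y assume "y \<in> triple ` Subs t n"
  then obtain S where S: "subgroup S (sdp rot)" "card (rcosets\<^bsub>sdp rot\<^esub> S) = n"
    "lev S mod 6 = t \<or> (lev S + t) mod 6 = 0" and y: "y = triple S" by (auto simp: Subs_def)
  have n_eq: "n = lev S * lat_index (base S)" using rot.card_rcosets_eq[OF S(1)] S(2) by simp
  obtain v where v: "v \<in> fibre S" using rot.fibre_nonempty[OF S(1)] by blast
  have "rot (int (lev S)) ` base S = base S"
    using rot.base_act[OF S(1)] v by (simp add: fibre_def)
  then show "y \<in> Triples t n"
    using S n_eq n rot.sublat_base[OF S(1)]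
    by (auto simp: y triple_def Triples_def Levels_def Pairs_def Lat_def cosets_def
      rot.fibre_eq_coset[OF S(1) v] lat_ext_coset)
next
  fix y assume "y \<in> Triples t n"
  then obtain l L v where y: "y = (l, L, (+) v ` lat_ext (delta (int l)) L)" and l: "l \<in> Levels t n"
    and L: "L \<in> Lat (n div l)" "rot (int l) ` L = L"
    by (auto simp: Triples_def Pairs_def cosets_def)
  have l0: "l > 0" "l * (n div l) = n" using l n by (auto simp: Levels_def intro: ccontr)
  have sL: "sublat L" using L(1) by (simp add: Lat_def)
  note spl = rot.spl[OF sL L(2) l0(1), of v]
  have "rot.spl L v (int l) \<in> Subs t n"
    using spl rot.card_rcosets_eq[OF spl(1)] L(1) l l0 by (auto simp: Subs_def Levels_def Lat_def)
  moreover have "triple (rot.spl L v (int l)) = y"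
    by (simp add: triple_def spl y lat_ext_coset)
  ultimately show "y \<in> triple ` Subs t n" by blast
qed

text \<open>A translation \<open>w\<close> shifts the fibre by a displacement that the extended
  coset absorbs, so only the rotation part of a conjugation is visible. Conversely, equal extended
  cosets allow a translation that matches the fibres themselves.\<close>

lemma conj_iff_rot_triple:
  assumes S: "subgroup S (sdp rot)" and T: "subgroup T (sdp rot)"
  shows "(\<exists>g. T = conj_rot g S) \<longleftrightarrow> (\<exists>k. triple T = rot_triple k (triple S))"
proof
  assume "\<exists>g. T = conj_rot g S"
  then obtain w k where T_eq: "T = conj_rot (w, k) S" by auto
  note c = rot.conj_subgroup[OF S, of w k, folded T_eq]
  let ?l = "int (lev S)"
  have "fibre T = (+) (delta ?l w) ` rot k ` fibre S"
    by (simp add: c(5) image_image delta_def add.commute)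
  then have "lat_ext (delta ?l) (fibre T) = (+) (delta ?l w) ` rot k ` lat_ext (delta ?l) (fibre S)"
    by (simp add: lat_ext_coset lat_ext_rot)
  also have "\<dots> = rot k ` lat_ext (delta ?l) (fibre S)"
  proof -
    obtain v where v: "v \<in> fibre S" using rot.fibre_nonempty[OF S] by blast
    let ?M = "lat_ext (delta ?l) (base S)"
    have M: "sublat (rot k ` ?M)"
      by (intro sublat_image rot.act_additive sublat_lat_ext additive_delta rot.sublat_base[OF S])
    have "rot k ` lat_ext (delta ?l) (fibre S) = (+) (rot k v) ` rot k ` ?M"
      by (simp add: rot.fibre_eq_coset[OF S v] lat_ext_coset rot_coset)
    moreover have "(+) (delta ?l w) ` (+) (rot k v) ` rot k ` ?M = (+) (delta ?l w + rot k v) ` rot k ` ?M"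
      by (simp add: image_image add.assoc)
    moreover have "delta ?l w \<in> rot k ` ?M"
    proof (rule image_eqI)
      show "delta ?l w = rot k (delta ?l (rot (- k) w))" by (simp flip: delta_rot)
      show "delta ?l (rot (- k) w) \<in> ?M" by (rule range_subset_lat_ext[OF rot.sublat_base[OF S]])
    qed
    ultimately show ?thesis by (simp add: coset_eq_iff[OF M])
  qed
  finally have "triple T = rot_triple k (triple S)" by (simp add: triple_def rot_triple_def c(3,4))
  then show "\<exists>k. triple T = rot_triple k (triple S)" by blast
next
  assume "\<exists>k. triple T = rot_triple k (triple S)"
  then obtain k where lev: "lev T = lev S" and b: "base T = rot k ` base S"
    and D: "lat_ext (delta (int (lev S))) (fibre T) = rot k ` lat_ext (delta (int (lev S))) (fibre S)"
    by (auto simp: triple_def rot_triple_def)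
  let ?l = "int (lev S)"
  obtain v' where v': "v' \<in> fibre T" using rot.fibre_nonempty[OF T] by blast
  then have "v' \<in> lat_ext (delta ?l) (fibre T)" using subset_lat_ext[OF additive_delta] by blast
  then obtain d where d: "d \<in> lat_ext (delta ?l) (fibre S)" "v' = rot k d" unfolding D by blast
  then obtain w where u: "d - delta ?l w \<in> fibre S" by (auto simp: lat_ext_def)
  \<comment> \<open>Conjugation rotates the fibre first, so the correcting translation
    \<open>w\<close> has to be rotated by \<open>k\<close> as well.\<close>
  let ?C = "conj_rot (rot k w, k) S"
  note c = rot.conj_subgroup[OF S, of "rot k w" k]
  have "v' = rot k (d - delta ?l w) + delta ?l (rot k w)"
    by (simp add: d(2) rot.act_diff delta_rot)
  then have "v' \<in> fibre ?C" using u unfolding c(5) by (auto simp: delta_def)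
  then have "fibre T = fibre ?C"
    using rot.fibre_eq_coset[OF T v'] rot.fibre_eq_coset[OF c(2)] b c(4) by simp
  then have "T = ?C" using c(3,4) lev b by (intro rot.subgroup_eqI T c(2)) simp_all
  then show "\<exists>g. T = conj_rot g S" by blast
qed

lemma card_orbits_eq:
  assumes n: "n > 0"
  shows "card (orbits (sdp rot) (Subs t n) conj_rot) =
    card (orbits (integer_mod_group 6) (Triples t n) (rot_act t n))"
proof -
  let ?a = "conj_rot"
  let ?E = "{S. subgroup S (sdp rot)}"
  let ?b = "\<lambda>g. \<lambda>S\<in>?E. ?a g S"
  let ?\<phi> = "rot_act t n"
  interpret A: group_action "sdp rot" ?E ?b by (rule rot.sdp.action_by_conjugation_on_subgroups_set)
  interpret B: group_action "integer_mod_group 6" "Triples t n" ?\<phi> by (rule rot_triple_action)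
  have ab: "orbit (sdp rot) ?a S = orbit (sdp rot) ?b S" if "S \<in> ?E" for S
    using that by (simp add: orbit_def)
  have sub: "S \<in> ?E" "triple S \<in> Triples t n" if "S \<in> Subs t n" for S
    using that triple_image[OF n, of t] by (auto simp: Subs_def)
  have "card (orbit (sdp rot) ?a ` Subs t n) = card ((\<lambda>S. orbit (integer_mod_group 6) ?\<phi> (triple S)) ` Subs t n)"
  proof (rule card_image_cong)
    fix S T assume ST: "S \<in> Subs t n" "T \<in> Subs t n"
    have "orbit (sdp rot) ?a S = orbit (sdp rot) ?a T \<longleftrightarrow> T \<in> orbit (sdp rot) ?a S"
      using A.orbit_eq_iff[of S T] sub ST by (simp only: ab)
    also have "\<dots> \<longleftrightarrow> (\<exists>g. T = ?a g S)" by (simp add: orbit_def)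
    also have "\<dots> \<longleftrightarrow> (\<exists>k. triple T = rot_triple k (triple S))"
      using conj_iff_rot_triple sub ST by blast
    also have "\<dots> \<longleftrightarrow> (\<exists>k\<in>{0..<6}. triple T = rot_triple k (triple S))"
    proof
      assume "\<exists>k. triple T = rot_triple k (triple S)"
      then obtain k where "triple T = rot_triple (k mod 6) (triple S)" by (auto simp: rot_triple_mod)
      moreover have "k mod 6 \<in> {0..<6}" by simp
      ultimately show "\<exists>k\<in>{0..<6}. triple T = rot_triple k (triple S)" by blast
    qed blast
    also have "\<dots> \<longleftrightarrow> triple T \<in> orbit (integer_mod_group 6) ?\<phi> (triple S)"
      using sub(2)[OF ST(1)] by (auto simp: orbit_def carrier_integer_mod_group)
    also have "\<dots> \<longleftrightarrow> orbit (integer_mod_group 6) ?\<phi> (triple S) = orbit (integer_mod_group 6) ?\<phi> (triple T)"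
      using B.orbit_eq_iff[OF sub(2)[OF ST(1)] sub(2)[OF ST(2)]] by blast
    finally show "orbit (sdp rot) ?a S = orbit (sdp rot) ?a T \<longleftrightarrow>
      orbit (integer_mod_group 6) ?\<phi> (triple S) = orbit (integer_mod_group 6) ?\<phi> (triple T)" .
  qed
  then show ?thesis
    by (simp add: orbits_eq_image image_image flip: triple_image[OF n])
qed

text \<open>A coset of the extended lattice \<open>M\<close> through \<open>v\<close> is fixed
  exactly when \<open>(1 - \<zeta>\<^sup>k) v\<close> lies in \<open>M\<close>. Such cosets form the
  kernel of an endomorphism of \<open>E/M\<close>, whose cokernel has the order given by
  \<open>lat_ext_gcd\<close>.\<close>

lemma card_fixed_pairs:
  assumes m: "m > 0"
  shows "finite (Pairs l m)"
    "card {(L, D) \<in> Pairs l m. rot k ` L = L \<and> rot k ` D = D} = sum_index (gcd (gcd (int l) k) 6) m"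
proof -
  let ?g = "gcd (gcd (int l) k) 6"
  let ?M = "\<lambda>L. lat_ext (delta (int l)) L"
  have fin: "finite (Lat m)" using Lat_card[OF m] by blast
  have pos: "sublat L" "lat_index (?M L) > 0" if "L \<in> Lat m" for L
    using that m lat_index_lat_ext_pos[OF _ _ additive_delta] by (auto simp: Lat_def)
  have fc: "finite (cosets (?M L))" if "L \<in> Lat m" for L
    using pos(2)[OF that] by (auto simp: lat_index_def card_gt_0_iff)
  show "finite (Pairs l m)"
    unfolding Pairs_def using fin fc by (intro finite_SigmaI) auto
  let ?A = "{L. L \<in> Lat m \<and> rot ?g ` L = L}"
  have A: "L \<in> ?A \<longleftrightarrow> L \<in> Lat m \<and> rot (int l) ` L = L \<and> rot k ` L = L" for L
    using rot_invariance_gcd[of "int l" L k] by blast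
  have "{(L, D) \<in> Pairs l m. rot k ` L = L \<and> rot k ` D = D} = (SIGMA L:?A. {D \<in> cosets (?M L). rot k ` D = D})"
  proof (rule Set.set_eqI)
    fix p :: "eis set \<times> eis set"
    obtain L D where p: "p = (L, D)" by force
    show "p \<in> {(L, D) \<in> Pairs l m. rot k ` L = L \<and> rot k ` D = D} \<longleftrightarrow>
      p \<in> (SIGMA L:?A. {D \<in> cosets (?M L). rot k ` D = D})"
      unfolding p
      by (simp only: mem_Collect_eq prod.case Pairs_def mem_Sigma_iff rot_invariance_gcd[symmetric]) blast
  qed
  also have "card \<dots> = (\<Sum>L\<in>?A. card {D \<in> cosets (?M L). rot k ` D = D})"
    using fin fc by (intro card_SigmaI) auto
  also have "\<dots> = (\<Sum>L\<in>?A. lat_index (lat_ext (delta ?g) L))"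
  proof (rule sum.cong)
    fix L assume "L \<in> ?A"
    then have L: "L \<in> Lat m" "rot k ` L = L" using A by blast+
    have M: "sublat (?M L)" by (rule sublat_lat_ext[OF pos(1)[OF L(1)] additive_delta])
    have rM: "rot k ` ?M L = ?M L" using L(2) by (simp flip: lat_ext_rot)
    have "{D \<in> cosets (?M L). rot k ` D = D} = (\<lambda>v. (+) v ` ?M L) ` {v. delta k v \<in> ?M L}"
    proof -
      have "rot k ` (+) v ` ?M L = (+) v ` ?M L \<longleftrightarrow> delta k v \<in> ?M L" for v
        by (simp add: rot_coset rM coset_eq_iff[OF M] delta_def sublat_minus_commute[OF M, of v])
      moreover have "{D \<in> range c. P D} = c ` {v. P (c v)}" for c :: "eis \<Rightarrow> eis set" and P
        by blast
      ultimately show ?thesis by (simp only: cosets_def)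
    qed
    also have "card \<dots> = lat_index (lat_ext (delta k) (?M L))"
    proof (rule card_kernel_cosets[OF M additive_delta _ pos(2)[OF L(1)]])
      have "delta k v \<in> ?M L" if "v \<in> ?M L" for v
      proof -
        have "rot k v \<in> ?M L" using that rM by blast
        then have "v - rot k v \<in> ?M L" by (rule sublat_diff[OF M that])
        then show ?thesis by (simp only: delta_def[of k])
      qed
      then show "delta k ` ?M L \<subseteq> ?M L" by blast
    qed
    also have "lat_ext (delta k) (?M L) = lat_ext (delta ?g) L"
      by (rule lat_ext_gcd[OF pos(1)[OF L(1)]])
    finally show "card {D \<in> cosets (?M L). rot k ` D = D} = lat_index (lat_ext (delta ?g) L)" .
  qed simp
  finally show "card {(L, D) \<in> Pairs l m. rot k ` L = L \<and> rot k ` D = D} = sum_index ?g m"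
    by (simp only: sum_index_def)
qed

lemma count_eq_sum_index:
  assumes n: "n > 0" and t: "t \<in> {0, 1, 2, 3}" and H: "group H" "H \<cong> sdp (\<lambda>j. rot (int t * j))"
  shows "6 * conj_classes_count H pi1_G5 n =
    (\<Sum>l\<in>Levels t n. \<Sum>k\<in>{0..<6}. sum_index (gcd (gcd (int l) k) 6) (n div l))"
proof -
  have "sdp (\<lambda>k. rot (1 * k)) = sdp rot" by simp
  then have G: "pi1_G5 \<cong> sdp rot" using pi1_G5_iso by simp
  have "conj_classes_count H pi1_G5 n = conj_classes_count H (sdp rot) n"
    by (rule conj_classes_count_iso_right[OF _ rot.sdp.is_group H(1) G])
      (simp add: pi1_G5_def group_presented_group)
  also have "\<dots> = conj_classes_count (sdp (\<lambda>j. rot (int t * j))) (sdp rot) n"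
    by (rule conj_classes_count_iso_left[OF rot.sdp.is_group H(1) group_sdp_rot H(2)])
  also have "\<dots> = card (orbits (sdp rot) (Subs t n) conj_rot)"
  proof -
    have "{S. subgroup S (sdp rot) \<and> card (rcosets\<^bsub>sdp rot\<^esub> S) = n \<and>
        sdp rot\<lparr>carrier := S\<rparr> \<cong> sdp (\<lambda>j. rot (int t * j))} = Subs t n"
      unfolding Subs_def
    proof (rule Collect_cong)
      fix S :: "(eis \<times> int) set"
      show "(subgroup S (sdp rot) \<and> card (rcosets\<^bsub>sdp rot\<^esub> S) = n \<and>
          sdp rot\<lparr>carrier := S\<rparr> \<cong> sdp (\<lambda>j. rot (int t * j))) =
        (subgroup S (sdp rot) \<and> card (rcosets\<^bsub>sdp rot\<^esub> S) = n \<and>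
          (lev S mod 6 = t \<or> (lev S + t) mod 6 = 0))"
      proof (cases "subgroup S (sdp rot) \<and> card (rcosets\<^bsub>sdp rot\<^esub> S) = n")
        case True
        then show ?thesis using subgroup_iso_iff[of S t] n t by simp
      next
        case False
        then show ?thesis by blast
      qed
    qed
    then show ?thesis by (simp only: conj_classes_count_def)
  qed
  also have "\<dots> = card (orbits (integer_mod_group 6) (Triples t n) (rot_act t n))"
    by (rule card_orbits_eq[OF n])
  finally have count: "conj_classes_count H pi1_G5 n = \<dots>" .
  interpret B: group_action "integer_mod_group 6" "Triples t n" "rot_act t n"
    by (rule rot_triple_action)
  have finL: "finite (Levels t n)" using n by (simp add: Levels_def)
  have pos: "n div l > 0" if "l \<in> Levels t n" for l
    using that n by (auto simp: Levels_def elim!: dvdE)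
  have finT: "finite (Triples t n)"
    unfolding Triples_def using finL card_fixed_pairs(1)[OF pos] by (intro finite_SigmaI) auto
  have ord: "order (integer_mod_group 6) = 6" "carrier (integer_mod_group 6) = {0..<6}"
    by (simp_all add: order_def carrier_integer_mod_group)
  have "6 * conj_classes_count H pi1_G5 n = (\<Sum>k\<in>{0..<6}. card (invariants (Triples t n) (rot_act t n) k))"
    using B.burnside[OF _ finT] by (simp add: ord count)
  also have "\<dots> = (\<Sum>k\<in>{0..<6}. \<Sum>l\<in>Levels t n. sum_index (gcd (gcd (int l) k) 6) (n div l))"
  proof (rule sum.cong)
    fix k :: int
    have "invariants (Triples t n) (rot_act t n) k =
      (SIGMA l:Levels t n. {(L, D) \<in> Pairs l (n div l). rot k ` L = L \<and> rot k ` D = D})"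
      by (auto simp: invariants_def Triples_def rot_triple_def)
    also have "card \<dots> = (\<Sum>l\<in>Levels t n. card {(L, D) \<in> Pairs l (n div l). rot k ` L = L \<and> rot k ` D = D})"
    proof (rule card_SigmaI[OF finL], rule ballI)
      fix l assume "l \<in> Levels t n"
      then show "finite {(L, D) \<in> Pairs l (n div l). rot k ` L = L \<and> rot k ` D = D}"
        by (rule finite_subset[OF _ card_fixed_pairs(1)[OF pos], rotated]) auto
    qed
    also have "\<dots> = (\<Sum>l\<in>Levels t n. sum_index (gcd (gcd (int l) k) 6) (n div l))"
      by (rule sum.cong) (simp_all add: card_fixed_pairs(2)[OF pos])
    finally show "card (invariants (Triples t n) (rot_act t n) k) = \<dots>" .
  qed simp
  also have "\<dots> = (\<Sum>l\<in>Levels t n. \<Sum>k\<in>{0..<6}. sum_index (gcd (gcd (int l) k) 6) (n div l))"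
    by (rule sum.swap)
  finally show ?thesis .
qed

section \<open>The divisor sums\<close>

lemma divisors_of_div: "c > 0 \<Longrightarrow> n > 0 \<Longrightarrow> divisors_of (of_nat n / of_nat c) = {k. c * k dvd n}"
proof -
  assume c: "c > 0" and n: "n > 0"
  have *: "(of_nat n / of_nat c :: rat) = of_nat m \<longleftrightarrow> n = c * m" for m
  proof -
    have "(of_nat n / of_nat c :: rat) = of_nat m \<longleftrightarrow> (of_nat n :: rat) = of_nat m * of_nat c"
      using c by (simp add: divide_eq_eq)
    also have "\<dots> \<longleftrightarrow> n = c * m" by (metis mult.commute of_nat_eq_iff of_nat_mult)
    finally show ?thesis .
  qed
  show ?thesis
  proof (intro equalityI subsetI)
    fix k assume "k \<in> divisors_of (of_nat n / of_nat c)"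
    then show "k \<in> {k. c * k dvd n}" by (auto simp: divisors_of_def *)
  next
    fix k assume "k \<in> {k. c * k dvd n}"
    then have "c * k dvd n" by simp
    then obtain d where "n = c * k * d" ..
    then have "n = c * (k * d)" by (simp only: mult.assoc)
    then show "k \<in> divisors_of (of_nat n / of_nat c)"
      using n by (auto simp: divisors_of_def * intro!: exI[of _ "k * d"])
  qed
qed

lemma divisors_of_nat: "n > 0 \<Longrightarrow> divisors_of (of_nat n) = {k. k dvd n}"
  using divisors_of_div[of 1 n] by simp

lemma card_Ideals_theta: "m > 0 \<Longrightarrow> of_nat (card (Ideals m)) = theta (of_nat m)"
proof -
  assume m: "m > 0"
  have "int (card (Ideals m)) = (\<Sum>k | k dvd m. chi k)"
    using card_Ideals[OF m] sum_rho_eq_sum_chi[OF m] by simp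
  then have "rat_of_int (int (card (Ideals m))) = (\<Sum>k | k dvd m. of_int (chi k))" by simp
  then show ?thesis by (simp add: theta_def divisors_of_nat[OF m] chi_def)
qed

lemma card_Lat_sigma1: "m > 0 \<Longrightarrow> of_nat (card (Lat m)) = sigma1 (of_nat m)"
  using Lat_card[of m] by (simp add: sigma1_def divisors_of_nat)

text \<open>The sum over the divisors of \<open>n / c\<close>, which vanishes automatically for
  positive \<open>n\<close> if \<open>c\<close> does not divide \<open>n\<close>.\<close>

definition dsum :: "nat \<Rightarrow> nat \<Rightarrow> (nat \<Rightarrow> rat) \<Rightarrow> rat"
  where "dsum n c F = (\<Sum>k | c * k dvd n. F k)"

text \<open>The substitution \<open>k = n div l div c\<close> with inverse
  \<open>l = n div (c * k)\<close> turns a sum over levels into a sum over divisors.\<close>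

lemma sum_dvd_reindex:
  fixes n c :: nat
  assumes n: "n > 0" and c: "c > 0" and A: "\<And>l. l \<in> A \<Longrightarrow> l dvd n"
  shows "(\<Sum>l\<in>A. if c dvd n div l then F (n div l div c) else 0) =
    (\<Sum>k | c * k dvd n \<and> n div (c * k) \<in> A. F k :: rat)"
proof -
  have fin: "finite A" by (rule finite_subset[OF _ finite_divisors_nat[OF n]]) (use A in blast)
  have "(\<Sum>l\<in>A. if c dvd n div l then F (n div l div c) else 0) = (\<Sum>l\<in>{l \<in> A. c dvd n div l}. F (n div l div c))"
    using fin by (simp add: sum.inter_filter)
  also have "\<dots> = (\<Sum>k | c * k dvd n \<and> n div (c * k) \<in> A. F k)"
  proof (rule sum.reindex_bij_witness[of _ "\<lambda>k. n div (c * k)" "\<lambda>l. n div l div c"])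
    fix l assume "l \<in> {l \<in> A. c dvd n div l}"
    then have l: "l \<in> A" "c dvd n div l" by auto
    then obtain d where "n div l = c * d" by blast
    then have d: "n = l * (c * d)" using A[OF l(1)] by (metis dvd_mult_div_cancel)
    have "l > 0" "d > 0" using n d by auto
    then have e: "n div l div c = d" "n div (c * d) = l" using c by (simp_all add: d)
    show "n div (c * (n div l div c)) = l" using e by simp
    show "n div l div c \<in> {k. c * k dvd n \<and> n div (c * k) \<in> A}" unfolding e(1) using e(2) l(1) by (simp add: d)
  next
    fix k assume "k \<in> {k. c * k dvd n \<and> n div (c * k) \<in> A}"
    then have "c * k dvd n" and kA: "n div (c * k) \<in> A" by blast+
    then obtain d where d: "n = c * k * d" by blast
    have "k > 0" "d > 0" using n d by auto
    then have e: "n div (c * k) = d" "n div d = c * k" using c by (simp_all add: d)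
    show "n div (n div (c * k)) div c = k" using c by (simp add: e)
    show "n div (c * k) \<in> {l \<in> A. c dvd n div l}" using kA by (simp add: e)
  qed simp
  finally show ?thesis .
qed

lemma Levels_mem:
  assumes "l dvd n"
  shows "l \<in> Levels 0 n \<longleftrightarrow> 6 dvd l"
    "l \<in> Levels 2 n \<longleftrightarrow> 2 dvd l \<and> \<not> 6 dvd l"
    "l \<in> Levels 3 n \<longleftrightarrow> 3 dvd l \<and> \<not> 6 dvd l"
proof -
  have "l mod 6 = 0 \<or> (l + 0) mod 6 = 0 \<longleftrightarrow> 6 dvd l"
    "l mod 6 = 2 \<or> (l + 2) mod 6 = 0 \<longleftrightarrow> 2 dvd l \<and> \<not> 6 dvd l"
    "l mod 6 = 3 \<or> (l + 3) mod 6 = 0 \<longleftrightarrow> 3 dvd l \<and> \<not> 6 dvd l" by presburger+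
  then show "l \<in> Levels 0 n \<longleftrightarrow> 6 dvd l"
    "l \<in> Levels 2 n \<longleftrightarrow> 2 dvd l \<and> \<not> 6 dvd l"
    "l \<in> Levels 3 n \<longleftrightarrow> 3 dvd l \<and> \<not> 6 dvd l"
    using assms unfolding Levels_def mem_Collect_eq by (simp_all only: simp_thms)
qed

lemma gcd_6: "gcd l 6 = (if 6 dvd l then 6 else if 3 dvd l then 3 else if 2 dvd l then 2 else 1)" for l :: nat
proof -
  have g: "gcd l 6 = gcd 6 (l mod 6)" by (rule gcd_red_nat)
  have d: "6 dvd l \<longleftrightarrow> l mod 6 = 0" "3 dvd l \<longleftrightarrow> l mod 6 mod 3 = 0" "2 dvd l \<longleftrightarrow> l mod 6 mod 2 = 0"
    by (simp_all add: dvd_eq_mod_eq_0 mod_mod_cancel)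
  define r where "r = l mod 6"
  have "r < 6" by (simp add: r_def)
  then have "r = 0 \<or> r = 1 \<or> r = 2 \<or> r = 3 \<or> r = 4 \<or> r = 5" by linarith
  moreover have "gcd 6 4 = (2::nat)" "gcd 6 2 = (2::nat)" "gcd 6 3 = (3::nat)" "gcd 6 5 = (1::nat)"
    by (simp_all add: gcd_non_0_nat)
  ultimately show ?thesis unfolding g d r_def[symmetric] by (elim disjE) simp_all
qed

lemma Levels_1_mem: "l dvd n \<Longrightarrow> l \<in> Levels 1 n \<longleftrightarrow> gcd l 6 = 1"
proof -
  have "l mod 6 = 1 \<or> (l + 1) mod 6 = 0 \<longleftrightarrow> \<not> 3 dvd l \<and> \<not> 2 dvd l \<and> \<not> 6 dvd l" by presburger
  then show "l dvd n \<Longrightarrow> l \<in> Levels 1 n \<longleftrightarrow> gcd l 6 = 1" by (simp add: Levels_def gcd_6)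
qed

lemma sum_Levels_0:
  assumes "n > 0" "c > 0"
  shows "(\<Sum>l\<in>Levels 0 n. if c dvd n div l then F (n div l div c) else 0) = dsum n (6 * c) F"
proof -
  have "c * k dvd n \<and> n div (c * k) \<in> Levels 0 n \<longleftrightarrow> 6 * c * k dvd n" for k
  proof (cases "c * k dvd n")
    case True
    then obtain d where d: "n = c * k * d" ..
    have "n div (c * k) = d" "c * k > 0" using assms d by auto
    moreover have "d dvd n" by (simp add: d)
    moreover have "6 * c * k dvd n \<longleftrightarrow> 6 dvd d"
      using \<open>c * k > 0\<close> by (simp add: d mult.assoc mult.commute[of 6] mult.left_commute[of 6])
    ultimately show ?thesis using True Levels_mem(1) by simp
  next
    case False
    then show ?thesis by (metis dvd_mult_right mult.assoc)
  qed
  then show ?thesis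
    using sum_dvd_reindex[OF assms, of "Levels 0 n" F] by (simp add: Levels_def dsum_def)
qed

text \<open>These levels are the multiples of \<open>t\<close> that are not multiples of 6, whence
  the difference.\<close>

lemma sum_Levels_23:
  assumes "n > 0" "c > 0" and t: "t = 2 \<or> t = 3"
  shows "(\<Sum>l\<in>Levels t n. if c dvd n div l then F (n div l div c) else 0) = dsum n (t * c) F - dsum n (6 * c) F"
proof -
  have "c * k dvd n \<and> n div (c * k) \<in> Levels t n \<longleftrightarrow> t * c * k dvd n \<and> \<not> 6 * c * k dvd n" for k
  proof (cases "c * k dvd n")
    case True
    then obtain d where d: "n = c * k * d" ..
    have pos: "n div (c * k) = d" "c * k > 0" using assms d by auto
    have *: "s * c * k dvd n \<longleftrightarrow> s dvd d" for s
      using pos(2) by (simp add: d mult.assoc mult.commute[of s] mult.left_commute[of s])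
    have "d dvd n" by (simp add: d)
    then show ?thesis using True t Levels_mem(2,3) by (auto simp: * pos(1))
  next
    case False
    then show ?thesis by (metis dvd_mult_right mult.assoc)
  qed
  then have "(\<Sum>l\<in>Levels t n. if c dvd n div l then F (n div l div c) else 0) =
      sum F ({k. t * c * k dvd n} - {k. 6 * c * k dvd n})"
    using sum_dvd_reindex[OF assms(1,2), of "Levels t n" F] by (simp add: Levels_def set_diff_eq)
  also have "\<dots> = dsum n (t * c) F - dsum n (6 * c) F"
    unfolding dsum_def
  proof (rule sum_diff)
    have "k \<le> n" if "t * c * k dvd n" for k
      by (rule dvd_imp_le[OF dvd_mult_right[OF that] assms(1)])
    then have "{k. t * c * k dvd n} \<subseteq> {..n}" by blast
    then show "finite {k. t * c * k dvd n}" by (rule finite_subset) simp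
    have "t dvd 6" using t by auto
    then have "t * c * k dvd 6 * c * k" for k by (intro mult_dvd_mono) simp_all
    then show "{k. 6 * c * k dvd n} \<subseteq> {k. t * c * k dvd n}" using dvd_trans by blast
  qed
  finally show ?thesis .
qed

lemma rotations: "{0..<6} = {0, 1, 2, 3, 4, 5 :: int}"
  by auto

lemma gcd_int_level: "gcd (gcd (int l) k) 6 = gcd k (int (gcd l 6))"
  by (metis gcd.assoc gcd.commute gcd_int_int_eq of_nat_numeral)

abbreviation (input) th :: "nat \<Rightarrow> rat" where "th k \<equiv> theta (of_nat k)"

lemma dvd_div_pos: "m > 0 \<Longrightarrow> c dvd m \<Longrightarrow> m div c > 0" for m c :: nat
  by (auto elim!: dvdE)

lemma sum_index_rat:
  assumes "m > 0"
  shows "of_nat (sum_index 1 m) = th m"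
    "of_nat (sum_index 2 m) = th m + 2 * (if 3 dvd m then th (m div 3) else 0)"
    "of_nat (sum_index 3 m) = sigma1 (of_nat m) + 3 * (if 2 dvd m then sigma1 (of_nat (m div 2)) else 0)"
    "of_nat (sum_index 6 m) = of_nat m * sigma1 (of_nat m)"
  using assms by (simp_all only: sum_index_1 sum_index_2 sum_index_3 sum_index_6 of_nat_add of_nat_mult
    of_nat_numeral card_Ideals_theta card_Lat_sigma1 dvd_div_pos if_distrib[of of_nat] of_nat_0 cong: if_cong)

text \<open>The coefficients count the rotations with a given common divisor with the level and 6.
  For level 6 the exponent 0 gives 6, the exponent 3 gives 3, two exponents give 2 and two give 1;
  for level 3 two give 3 and four give 1; for level 2 three give 2 and three give 1.\<close>

lemma sum_rotations:
  assumes n: "n > 0" and l: "l dvd n"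
  shows "l \<in> Levels 1 n \<Longrightarrow> (\<Sum>k\<in>{0..<6}. rat_of_nat (sum_index (gcd (gcd (int l) k) 6) (n div l))) = 6 * th (n div l)" (is "_ \<Longrightarrow> ?S = _")
    "l \<in> Levels 2 n \<Longrightarrow> (\<Sum>k\<in>{0..<6}. rat_of_nat (sum_index (gcd (gcd (int l) k) 6) (n div l))) =
      6 * th (n div l) + 6 * (if 3 dvd n div l then th (n div l div 3) else 0)" (is "_ \<Longrightarrow> _ = ?R2")
    "l \<in> Levels 3 n \<Longrightarrow> (\<Sum>k\<in>{0..<6}. rat_of_nat (sum_index (gcd (gcd (int l) k) 6) (n div l))) =
      2 * sigma1 (of_nat (n div l)) + 6 * (if 2 dvd n div l then sigma1 (of_nat (n div l div 2)) else 0) + 4 * th (n div l)" (is "_ \<Longrightarrow> _ = ?R3")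
    "l \<in> Levels 0 n \<Longrightarrow> (\<Sum>k\<in>{0..<6}. rat_of_nat (sum_index (gcd (gcd (int l) k) 6) (n div l))) =
      of_nat (n div l) * sigma1 (of_nat (n div l)) + sigma1 (of_nat (n div l))
      + 3 * (if 2 dvd n div l then sigma1 (of_nat (n div l div 2)) else 0)
      + 4 * th (n div l) + 4 * (if 3 dvd n div l then th (n div l div 3) else 0)" (is "_ \<Longrightarrow> _ = ?R0")
proof -
  have m: "n div l > 0" using n l by (auto elim!: dvdE)
  have g: "gcd 0 s = s" "gcd 1 s = 1" if "s > 0" for s :: int using that by simp_all
  have g2: "gcd 2 2 = (2::int)" "gcd 3 2 = (1::int)" "gcd 4 2 = (2::int)" "gcd 5 2 = (1::int)"
    and g3: "gcd 2 3 = (1::int)" "gcd 3 3 = (3::int)" "gcd 4 3 = (1::int)" "gcd 5 3 = (1::int)"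
    and g6: "gcd 2 6 = (2::int)" "gcd 3 6 = (3::int)" "gcd 4 6 = (2::int)" "gcd 5 6 = (1::int)"
    by (simp_all add: gcd_non_0_int)
  show "?S = 6 * th (n div l)" if "l \<in> Levels 1 n"
  proof -
    have "int (gcd l 6) = 1" using Levels_1_mem[OF l] that by simp
    then show ?thesis
      unfolding gcd_int_level by (simp add: sum_index_rat(1)[OF m, simplified])
  qed
  show "?S = ?R2" if "l \<in> Levels 2 n"
  proof -
    have l2: "2 dvd l \<and> \<not> 6 dvd l" using Levels_mem(2)[OF l] that by blast
    then have "\<not> 3 dvd l" by presburger
    then have "int (gcd l 6) = 2" using l2 by (simp add: gcd_6)
    then show ?thesis
      unfolding gcd_int_level rotations by (simp add: g g2 sum_index_rat[OF m, simplified])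
  qed
  show "?S = ?R3"
    if "l \<in> Levels 3 n"
  proof -
    have "3 dvd l \<and> \<not> 6 dvd l" using Levels_mem(3)[OF l] that by blast
    then have "int (gcd l 6) = 3" by (simp add: gcd_6)
    then show ?thesis
      unfolding gcd_int_level rotations by (simp add: g g3 sum_index_rat[OF m, simplified])
  qed
  show "?S = ?R0" if "l \<in> Levels 0 n"
  proof -
    have "6 dvd l" using Levels_mem(1)[OF l] that by blast
    then have "int (gcd l 6) = 6" by (simp add: gcd_6)
    then show ?thesis
      unfolding gcd_int_level rotations by (simp add: g g6 sum_index_rat[OF m, simplified])
  qed
qed

lemma count_rat:
  assumes "n > 0" "t \<in> {0, 1, 2, 3}" "group H" "H \<cong> sdp (\<lambda>j. rot (int t * j))"
  shows "rat_of_nat (conj_classes_count H pi1_G5 n) =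
    1 / 6 * (\<Sum>l\<in>Levels t n. \<Sum>k\<in>{0..<6}. rat_of_nat (sum_index (gcd (gcd (int l) k) 6) (n div l)))"
  using arg_cong[OF count_eq_sum_index[OF assms], of rat_of_nat] by simp

theorem theorem4:
  fixes n :: nat and q :: rat
  assumes "n > 0" and "q = of_nat n"
  shows "of_nat (conj_classes_count pi1_G5 pi1_G5 n) =
      (\<Sum>k | k dvd n \<and> gcd (n div k) 6 = 1. theta (of_nat k)) \<and>
    of_nat (conj_classes_count pi1_G3 pi1_G5 n) =
      (\<Sum>k\<in>divisors_of (q / 2). theta (of_nat k)) - (\<Sum>k\<in>divisors_of (q / 18). theta (of_nat k)) \<and>
    of_nat (conj_classes_count pi1_G2 pi1_G5 n) =
      1 / 3 * (sigma2 (q / 3) + 2 * sigma2 (q / 6) - 3 * sigma2 (q / 12)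
        + 2 * (\<Sum>k\<in>divisors_of (q / 3). theta (of_nat k))
        - 2 * (\<Sum>k\<in>divisors_of (q / 6). theta (of_nat k))) \<and>
    of_nat (conj_classes_count Z3_group pi1_G5 n) =
      1 / 6 * (omega (q / 6) + sigma2 (q / 6) + 3 * sigma2 (q / 12)
        + 4 * (\<Sum>k\<in>divisors_of (q / 6). theta (of_nat k))
        + 4 * (\<Sum>k\<in>divisors_of (q / 18). theta (of_nat k)))"
proof -
  note n = assms(1)
  let ?N = "\<lambda>l. \<Sum>k\<in>{0..<6}. rat_of_nat (sum_index (gcd (gcd (int l) k) 6) (n div l))"
  let ?s = "\<lambda>k. sigma1 (of_nat k)"
  let ?if = "\<lambda>c F l. if c dvd n div l then F (n div l div c) else (0 :: rat)"
  have dvd: "l dvd n" if "l \<in> Levels t n" for l t using that by (simp add: Levels_def)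
  have D: "(\<Sum>k\<in>divisors_of (q / of_nat c). F k) = dsum n c F" if "c > 0" for c and F :: "nat \<Rightarrow> rat"
    using divisors_of_div[OF that n] by (simp add: dsum_def assms(2))
  have D': "(\<Sum>k\<in>divisors_of (q / 2). F k) = dsum n 2 F" "(\<Sum>k\<in>divisors_of (q / 3). F k) = dsum n 3 F"
    "(\<Sum>k\<in>divisors_of (q / 6). F k) = dsum n 6 F" "(\<Sum>k\<in>divisors_of (q / 12). F k) = dsum n 12 F"
    "(\<Sum>k\<in>divisors_of (q / 18). F k) = dsum n 18 F" for F :: "nat \<Rightarrow> rat"
    using D[of 2 F] D[of 3 F] D[of 6 F] D[of 12 F] D[of 18 F] by simp_all
  have grp: "group pi1_G5" "group pi1_G3" "group pi1_G2" "group Z3_group"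
    by (simp_all add: pi1_G5_def pi1_G3_def pi1_G2_def group_presented_group Z3_group_def DirProd_group)
  have 1: "of_nat (conj_classes_count pi1_G5 pi1_G5 n) = (\<Sum>k | k dvd n \<and> gcd (n div k) 6 = 1. th k)"
  proof -
    have "rat_of_nat (conj_classes_count pi1_G5 pi1_G5 n) = 1 / 6 * (\<Sum>l\<in>Levels 1 n. ?N l)"
      by (rule count_rat[OF n]) (simp_all add: grp pi1_G5_iso[simplified])
    also have "(\<Sum>l\<in>Levels 1 n. ?N l) = (\<Sum>l\<in>Levels 1 n. 6 * ?if 1 th l)"
      by (rule sum.cong) (simp_all add: sum_rotations(1)[OF n dvd])
    also have "\<dots> = 6 * (\<Sum>l\<in>Levels 1 n. ?if 1 th l)" by (simp only: sum_distrib_left)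
    also have "(\<Sum>l\<in>Levels 1 n. ?if 1 th l) = (\<Sum>k | 1 * k dvd n \<and> n div (1 * k) \<in> Levels 1 n. th k)"
      by (rule sum_dvd_reindex[OF n]) (simp_all add: dvd)
    also have "\<dots> = (\<Sum>k | k dvd n \<and> gcd (n div k) 6 = 1. th k)"
    proof (rule sum.cong)
      have "n div k \<in> Levels 1 n \<longleftrightarrow> gcd (n div k) 6 = 1" if "k dvd n" for k
        by (rule Levels_1_mem) (metis that dvd_div_mult_self dvd_triv_left)
      then show "{k. 1 * k dvd n \<and> n div (1 * k) \<in> Levels 1 n} = {k. k dvd n \<and> gcd (n div k) 6 = 1}"
        unfolding mult_1 by (intro Collect_cong conj_cong HOL.refl)
    qed simp
    finally show ?thesis by simp
  qed
  have 2: "of_nat (conj_classes_count pi1_G3 pi1_G5 n) = dsum n 2 th - dsum n 18 th"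
  proof -
    have "rat_of_nat (conj_classes_count pi1_G3 pi1_G5 n) = 1 / 6 * (\<Sum>l\<in>Levels 2 n. ?N l)"
      by (rule count_rat[OF n]) (simp_all add: grp pi1_G3_iso)
    also have "(\<Sum>l\<in>Levels 2 n. ?N l) = (\<Sum>l\<in>Levels 2 n. 6 * ?if 1 th l + 6 * ?if 3 th l)"
      by (rule sum.cong) (simp_all only: sum_rotations(2)[OF n dvd] one_dvd if_True div_by_1)
    also have "\<dots> = 6 * (\<Sum>l\<in>Levels 2 n. ?if 1 th l) + 6 * (\<Sum>l\<in>Levels 2 n. ?if 3 th l)"
      by (simp only: sum_distrib_left sum.distrib)
    \<comment> \<open>The terms at \<open>n / 6\<close> cancel: the first sum ends with them and the
      second, where \<open>c = 3\<close>, begins with them.\<close>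
    finally show ?thesis
      using sum_Levels_23[OF n, of 1 2 th] sum_Levels_23[OF n, of 3 2 th] by simp
  qed
  have 3: "of_nat (conj_classes_count pi1_G2 pi1_G5 n) =
      1 / 3 * (dsum n 3 ?s + 2 * dsum n 6 ?s - 3 * dsum n 12 ?s + 2 * dsum n 3 th - 2 * dsum n 6 th)"
  proof -
    have "rat_of_nat (conj_classes_count pi1_G2 pi1_G5 n) = 1 / 6 * (\<Sum>l\<in>Levels 3 n. ?N l)"
      by (rule count_rat[OF n]) (simp_all add: grp pi1_G2_iso)
    also have "(\<Sum>l\<in>Levels 3 n. ?N l) = (\<Sum>l\<in>Levels 3 n. 2 * ?if 1 ?s l + 6 * ?if 2 ?s l + 4 * ?if 1 th l)"
      by (rule sum.cong) (simp_all only: sum_rotations(3)[OF n dvd] one_dvd if_True div_by_1)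
    also have "\<dots> = 2 * (\<Sum>l\<in>Levels 3 n. ?if 1 ?s l) + 6 * (\<Sum>l\<in>Levels 3 n. ?if 2 ?s l)
        + 4 * (\<Sum>l\<in>Levels 3 n. ?if 1 th l)"
      by (simp only: sum_distrib_left sum.distrib)
    \<comment> \<open>The coefficient of the sum at \<open>n / 6\<close> is \<open>- 2\<close> from
      the first sum and 6 from the second; after division by 6 this is two thirds.\<close>
    finally show ?thesis
      using sum_Levels_23[OF n, of 1 3 ?s] sum_Levels_23[OF n, of 2 3 ?s] sum_Levels_23[OF n, of 1 3 th]
      by simp
  qed
  have 4: "of_nat (conj_classes_count Z3_group pi1_G5 n) =
      1 / 6 * (dsum n 6 (\<lambda>k. of_nat k * ?s k) + dsum n 6 ?s + 3 * dsum n 12 ?s + 4 * dsum n 6 th + 4 * dsum n 18 th)"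
  proof -
    have "rat_of_nat (conj_classes_count Z3_group pi1_G5 n) = 1 / 6 * (\<Sum>l\<in>Levels 0 n. ?N l)"
      by (rule count_rat[OF n]) (simp_all add: grp Z3_group_iso[simplified])
    also have "(\<Sum>l\<in>Levels 0 n. ?N l) = (\<Sum>l\<in>Levels 0 n. ?if 1 (\<lambda>k. of_nat k * ?s k) l + ?if 1 ?s l
        + 3 * ?if 2 ?s l + 4 * ?if 1 th l + 4 * ?if 3 th l)"
      by (rule sum.cong) (simp_all only: sum_rotations(4)[OF n dvd] one_dvd if_True div_by_1)
    also have "\<dots> = (\<Sum>l\<in>Levels 0 n. ?if 1 (\<lambda>k. of_nat k * ?s k) l) + (\<Sum>l\<in>Levels 0 n. ?if 1 ?s l)
        + 3 * (\<Sum>l\<in>Levels 0 n. ?if 2 ?s l) + 4 * (\<Sum>l\<in>Levels 0 n. ?if 1 th l) + 4 * (\<Sum>l\<in>Levels 0 n. ?if 3 th l)"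
      by (simp only: sum_distrib_left sum.distrib)
    finally show ?thesis
      using sum_Levels_0[OF n, of 1 "\<lambda>k. of_nat k * ?s k"] sum_Levels_0[OF n, of 1 ?s] sum_Levels_0[OF n, of 2 ?s]
        sum_Levels_0[OF n, of 1 th] sum_Levels_0[OF n, of 3 th] by simp
  qed
  show ?thesis
    unfolding sigma2_def omega_def D' using 1 2 3 4 by blast
qed

end
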